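(* Let $K$ be a field of characteristic $2$ and $n\ge1$. Then the ring maps determined by $$\mathrm{Q}_{K(T_1,\dots,T_n)/K}\longrightarrow K(T_1,\dots,T_n)\otimes_K\Lambda_K[S_1,\dots,S_n],$$ $$T_i\otimes1\otimes1\mapsto T_i\otimes1+1\otimes S_i,\quad 1\otimes T_i\otimes1\mapsto T_i\otimes1+1\otimes S_i,\quad 1\otimes1\otimes T_i\mapsto T_i\otimes1$$ and $$K(T_1,\dots,T_n)\otimes_K\Lambda_K[S_1,\dots,S_n]\longrightarrow\mathrm{Q}_{K(T_1,\dots,T_n)/K},$$ $$T_i\otimes1\mapsto1\otimes1\otimes T_i,\quad 1\otimes S_i\mapsto1\otimes1\otimes T_i+T_i\otimes1\otimes1$$ are inverse isomorphisms. In particular, the dimension of $\mathrm{W}_{K(T_1,\dots,T_n)/K}$ over $K(T_1,\dots,T_n)$ is $2^n-1$, and the map $\mathrm{W}_{K(T_1,\dots,T_n)/K}\to\Omega_{K(T_1,\dots,T_n)/K}$, whose target has dimension $n$, is not injective for $n\ge2$; it vanishes on the square of the augmentation ideal $I$ of $\mathrm{Q}_{K(T_1,\dots,T_n)/K}$.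
   Context: $K(T_1,\dots,T_n)$ is the field of rational functions in $n$ variables and $\Lambda_K[S_1,\dots,S_n]=K[S_1,\dots,S_n]/(S_i^2\mid1\le i\le n)$. For a homomorphism $\varphi\colon R\to A$ of commutative rings let $\Delta_\varphi\subseteq A\otimes_R A$ be the $R$-subalgebra spanned by the elements $a\otimes a$, $a\in A$; regard $A$ as a $\Delta_\varphi$-algebra via multiplication. Put $\mathrm{Q}_\varphi=\mathrm{Q}_{A/R}=(A\otimes_R A)\otimes_{\Delta_\varphi}A$, an $A$-algebra via $a\mapsto1\otimes1\otimes a$, augmented over $A$ by $a\otimes a'\otimes t\mapsto aa't$. Let $\mathrm{W}_{A/R}$ be the kernel of the augmentation $\mathrm{Q}_{A/R}\to A$ (the augmentation ideal). The map $\mathrm{W}_{A/R}\to\Omega_{A/R}$ to the Kähler differentials is the restriction of the $A$-linear map $\mathrm{Q}_{A/R}\to\Omega_{A/R}$, $a\otimes a'\otimes t\mapsto t(d(a)a'-a\,d(a'))$, with $d$ the universal derivation. *)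

theory Defs
  imports
    "HOL-Library.Poly_Mapping"
    "HOL-Computational_Algebra.Fraction_Field"
    "HOL-Algebra.Algebra"
    "HOL-Algebra.Algebraic_Closure_Type"
    "Jordan_Normal_Form.Missing_VectorSpace"
begin

text \<open>
  Throughout, a homomorphism \<open>\<phi>\<close> of commutative rings is given by its source \<open>R\<close>,
  its underlying function, and its target \<open>A\<close>; the constructions below are meant for
  \<open>\<phi> \<in> ring_hom R A\<close> with \<open>R\<close> and \<open>A\<close> commutative.
\<close>

section \<open>Tensor products of algebras\<close>

text \<open>
  The monoid ring \<open>\<int>[A \<times> B]\<close> of the multiplicative monoid \<open>A \<times> B\<close>. Its additive group is
  the free abelian group on \<open>A \<times> B\<close>.
\<close>

definition pair_ring ::
    "('a, 'm) ring_scheme \<Rightarrow> ('b, 'n) ring_scheme \<Rightarrow> ('a \<times> 'b \<Rightarrow>\<^sub>0 int) ring" where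
  "pair_ring A B =
     \<lparr>carrier = {u. Poly_Mapping.keys u \<subseteq> carrier A \<times> carrier B},
      monoid.mult = (\<lambda>u v. \<Sum>x\<in>Poly_Mapping.keys u. \<Sum>y\<in>Poly_Mapping.keys v.
        Poly_Mapping.single (fst x \<otimes>\<^bsub>A\<^esub> fst y, snd x \<otimes>\<^bsub>B\<^esub> snd y)
          (Poly_Mapping.lookup u x * Poly_Mapping.lookup v y)),
      one = Poly_Mapping.single (\<one>\<^bsub>A\<^esub>, \<one>\<^bsub>B\<^esub>) 1,
      ring.zero = 0,
      add = (+)\<rparr>"

abbreviation pair_gen :: "'a \<Rightarrow> 'b \<Rightarrow> ('a \<times> 'b \<Rightarrow>\<^sub>0 int)" where
  "pair_gen a b \<equiv> Poly_Mapping.single (a, b) 1"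

definition tensor_relations ::
    "('r, 'l) ring_scheme \<Rightarrow> ('r \<Rightarrow> 'a) \<Rightarrow> ('a, 'm) ring_scheme \<Rightarrow> ('r \<Rightarrow> 'b) \<Rightarrow> ('b, 'n) ring_scheme
      \<Rightarrow> ('a \<times> 'b \<Rightarrow>\<^sub>0 int) set" where
  "tensor_relations R \<phi> A \<psi> B =
     {pair_gen (a \<oplus>\<^bsub>A\<^esub> a') b - pair_gen a b - pair_gen a' b | a a' b.
        a \<in> carrier A \<and> a' \<in> carrier A \<and> b \<in> carrier B} \<union>
     {pair_gen a (b \<oplus>\<^bsub>B\<^esub> b') - pair_gen a b - pair_gen a b' | a b b'.
        a \<in> carrier A \<and> b \<in> carrier B \<and> b' \<in> carrier B} \<union>
     {pair_gen (\<phi> r \<otimes>\<^bsub>A\<^esub> a) b - pair_gen a (\<psi> r \<otimes>\<^bsub>B\<^esub> b) | r a b.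
        r \<in> carrier R \<and> a \<in> carrier A \<and> b \<in> carrier B}"

text \<open>
  \<open>A \<otimes>\<^sub>R B\<close> for \<open>\<phi> : R \<rightarrow> A\<close> and \<open>\<psi> : R \<rightarrow> B\<close>. The additive subgroup generated by the
  relations is already an ideal, because a generator \<open>(c, d)\<close> times a relation is again a
  relation; so this is the usual quotient of the free abelian group on \<open>A \<times> B\<close>, with the
  product \<open>(a \<otimes> b)(a' \<otimes> b') = aa' \<otimes> bb'\<close>.
\<close>

definition tensor_ideal ::
    "('r, 'l) ring_scheme \<Rightarrow> ('r \<Rightarrow> 'a) \<Rightarrow> ('a, 'm) ring_scheme \<Rightarrow> ('r \<Rightarrow> 'b) \<Rightarrow> ('b, 'n) ring_scheme
      \<Rightarrow> ('a \<times> 'b \<Rightarrow>\<^sub>0 int) set" where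
  "tensor_ideal R \<phi> A \<psi> B = Idl\<^bsub>pair_ring A B\<^esub> (tensor_relations R \<phi> A \<psi> B)"

definition tensor_ring ::
    "('r, 'l) ring_scheme \<Rightarrow> ('r \<Rightarrow> 'a) \<Rightarrow> ('a, 'm) ring_scheme \<Rightarrow> ('r \<Rightarrow> 'b) \<Rightarrow> ('b, 'n) ring_scheme
      \<Rightarrow> ('a \<times> 'b \<Rightarrow>\<^sub>0 int) set ring" where
  "tensor_ring R \<phi> A \<psi> B = pair_ring A B Quot tensor_ideal R \<phi> A \<psi> B"

definition tensor ::
    "('r, 'l) ring_scheme \<Rightarrow> ('r \<Rightarrow> 'a) \<Rightarrow> ('a, 'm) ring_scheme \<Rightarrow> ('r \<Rightarrow> 'b) \<Rightarrow> ('b, 'n) ring_scheme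
      \<Rightarrow> 'a \<Rightarrow> 'b \<Rightarrow> ('a \<times> 'b \<Rightarrow>\<^sub>0 int) set" where
  "tensor R \<phi> A \<psi> B a b = tensor_ideal R \<phi> A \<psi> B +>\<^bsub>pair_ring A B\<^esub> pair_gen a b"

text \<open>
  The additive map \<open>A \<otimes>\<^sub>R B \<rightarrow> M\<close> with \<open>a \<otimes> b \<mapsto> \<beta> a b\<close>, for \<open>\<beta>\<close> biadditive and
  \<open>R\<close>-balanced: for such \<open>\<beta>\<close> the sum below is the same for all representatives \<open>u\<close> of the
  class \<open>C\<close>.
\<close>

definition tensor_lift ::
    "('c, 'k) ring_scheme \<Rightarrow> ('a \<Rightarrow> 'b \<Rightarrow> 'c) \<Rightarrow> ('a \<times> 'b \<Rightarrow>\<^sub>0 int) set \<Rightarrow> 'c" where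
  "tensor_lift M \<beta> C =
     the_elem ((\<lambda>u. \<Oplus>\<^bsub>M\<^esub>x\<in>Poly_Mapping.keys u. add_pow M (Poly_Mapping.lookup u x) (\<beta> (fst x) (snd x))) ` C)"

section \<open>The algebra \<open>Q\<close> and its augmentation ideal\<close>

abbreviation self_tensor_ring ::
    "('r, 'l) ring_scheme \<Rightarrow> ('r \<Rightarrow> 'a) \<Rightarrow> ('a, 'm) ring_scheme \<Rightarrow> ('a \<times> 'a \<Rightarrow>\<^sub>0 int) set ring" where
  "self_tensor_ring R \<phi> A \<equiv> tensor_ring R \<phi> A \<phi> A"

definition mult_map ::
    "('a, 'm) ring_scheme \<Rightarrow> ('a \<times> 'a \<Rightarrow>\<^sub>0 int) set \<Rightarrow> 'a" where
  "mult_map A = tensor_lift A (\<lambda>a a'. a \<otimes>\<^bsub>A\<^esub> a')"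

text \<open>
  \<open>\<Delta>\<^sub>\<phi>\<close>: the \<open>R\<close>-subalgebra generated by the \<open>a \<otimes> a\<close>, i.e.\ the subring generated by
  them and the image of \<open>R\<close>.
\<close>

definition diag_ring ::
    "('r, 'l) ring_scheme \<Rightarrow> ('r \<Rightarrow> 'a) \<Rightarrow> ('a, 'm) ring_scheme \<Rightarrow> ('a \<times> 'a \<Rightarrow>\<^sub>0 int) set ring" where
  "diag_ring R \<phi> A =
     (self_tensor_ring R \<phi> A)\<lparr>carrier :=
        generate_ring (self_tensor_ring R \<phi> A)
          ({tensor R \<phi> A \<phi> A a a | a. a \<in> carrier A} \<union>
           {tensor R \<phi> A \<phi> A (\<phi> r) \<one>\<^bsub>A\<^esub> | r. r \<in> carrier R})\<rparr>"

type_synonym 'a Q = "(('a \<times> 'a \<Rightarrow>\<^sub>0 int) set \<times> 'a \<Rightarrow>\<^sub>0 int) set"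

definition Q_ring ::
    "('r, 'l) ring_scheme \<Rightarrow> ('r \<Rightarrow> 'a) \<Rightarrow> ('a, 'm) ring_scheme \<Rightarrow> 'a Q ring" where
  "Q_ring R \<phi> A = tensor_ring (diag_ring R \<phi> A) (\<lambda>x. x) (self_tensor_ring R \<phi> A) (mult_map A) A"

text \<open>The element \<open>a \<otimes> a' \<otimes> t\<close> of \<open>Q\<close>.\<close>

definition Q_tensor ::
    "('r, 'l) ring_scheme \<Rightarrow> ('r \<Rightarrow> 'a) \<Rightarrow> ('a, 'm) ring_scheme \<Rightarrow> 'a \<Rightarrow> 'a \<Rightarrow> 'a \<Rightarrow> 'a Q" where
  "Q_tensor R \<phi> A a a' t =
     tensor (diag_ring R \<phi> A) (\<lambda>x. x) (self_tensor_ring R \<phi> A) (mult_map A) A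
       (tensor R \<phi> A \<phi> A a a') t"

text \<open>\<open>Q\<close> together with its \<open>A\<close>-module structure via \<open>a \<mapsto> 1 \<otimes> 1 \<otimes> a\<close>.\<close>

definition Q_alg ::
    "('r, 'l) ring_scheme \<Rightarrow> ('r \<Rightarrow> 'a) \<Rightarrow> ('a, 'm) ring_scheme \<Rightarrow> ('a, 'a Q) module" where
  "Q_alg R \<phi> A =
     ring.extend (Q_ring R \<phi> A)
       (module.fields (\<lambda>a x. Q_tensor R \<phi> A \<one>\<^bsub>A\<^esub> \<one>\<^bsub>A\<^esub> a \<otimes>\<^bsub>Q_ring R \<phi> A\<^esub> x))"

definition Q_aug :: "('a, 'm) ring_scheme \<Rightarrow> 'a Q \<Rightarrow> 'a" where
  "Q_aug A = tensor_lift A (\<lambda>x t. mult_map A x \<otimes>\<^bsub>A\<^esub> t)"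

definition aug_ideal ::
    "('r, 'l) ring_scheme \<Rightarrow> ('r \<Rightarrow> 'a) \<Rightarrow> ('a, 'm) ring_scheme \<Rightarrow> 'a Q set" where
  "aug_ideal R \<phi> A = a_kernel (Q_ring R \<phi> A) A (Q_aug A)"

definition W_mod ::
    "('r, 'l) ring_scheme \<Rightarrow> ('r \<Rightarrow> 'a) \<Rightarrow> ('a, 'm) ring_scheme \<Rightarrow> ('a, 'a Q) module" where
  "W_mod R \<phi> A = (Q_alg R \<phi> A)\<lparr>carrier := aug_ideal R \<phi> A\<rparr>"

section \<open>Kaehler differentials\<close>

text \<open>
  Modules are records that extend ring records; the multiplicative part plays no role.
\<close>

definition free_module :: "('a, 'm) ring_scheme \<Rightarrow> 'x set \<Rightarrow> ('a, 'x \<Rightarrow> 'a) module" where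
  "free_module A S =
     \<lparr>carrier = {f. (\<forall>x\<in>S. f x \<in> carrier A) \<and> (\<forall>x. x \<notin> S \<longrightarrow> f x = \<zero>\<^bsub>A\<^esub>) \<and>
        finite {x. f x \<noteq> \<zero>\<^bsub>A\<^esub>}},
      monoid.mult = undefined,
      one = undefined,
      ring.zero = (\<lambda>x. \<zero>\<^bsub>A\<^esub>),
      add = (\<lambda>f g x. f x \<oplus>\<^bsub>A\<^esub> g x),
      module.smult = (\<lambda>a f x. a \<otimes>\<^bsub>A\<^esub> f x)\<rparr>"

definition free_gen :: "('a, 'm) ring_scheme \<Rightarrow> 'x \<Rightarrow> 'x \<Rightarrow> 'a" where
  "free_gen A y = (\<lambda>x. if x = y then \<one>\<^bsub>A\<^esub> else \<zero>\<^bsub>A\<^esub>)"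

definition quot_module :: "('a, 'b, 'n) module_scheme \<Rightarrow> 'b set \<Rightarrow> ('a, 'b set) module" where
  "quot_module M N =
     \<lparr>carrier = a_rcosets\<^bsub>M\<^esub> N,
      monoid.mult = undefined,
      one = undefined,
      ring.zero = N,
      add = set_add M,
      module.smult = (\<lambda>a C. \<Union>x\<in>C. N +>\<^bsub>M\<^esub> (a \<odot>\<^bsub>M\<^esub> x))\<rparr>"

text \<open>
  \<open>\<Omega>\<^bsub>A/R\<^esub>\<close>: the free \<open>A\<close>-module on symbols \<open>d a\<close> modulo additivity, the Leibniz rule and
  \<open>d (\<phi> r) = 0\<close>.
\<close>

definition kaehler_relations ::
    "('r, 'l) ring_scheme \<Rightarrow> ('r \<Rightarrow> 'a) \<Rightarrow> ('a, 'm) ring_scheme \<Rightarrow> ('a \<Rightarrow> 'a) set" where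
  "kaehler_relations R \<phi> A =
     (let F = free_module A (carrier A); e = free_gen A in
      {e (a \<oplus>\<^bsub>A\<^esub> b) \<ominus>\<^bsub>F\<^esub> (e a \<oplus>\<^bsub>F\<^esub> e b) | a b. a \<in> carrier A \<and> b \<in> carrier A} \<union>
      {e (a \<otimes>\<^bsub>A\<^esub> b) \<ominus>\<^bsub>F\<^esub> ((a \<odot>\<^bsub>F\<^esub> e b) \<oplus>\<^bsub>F\<^esub> (b \<odot>\<^bsub>F\<^esub> e a)) | a b. a \<in> carrier A \<and> b \<in> carrier A} \<union>
      {e (\<phi> r) | r. r \<in> carrier R})"

definition kaehler_submodule ::
    "('r, 'l) ring_scheme \<Rightarrow> ('r \<Rightarrow> 'a) \<Rightarrow> ('a, 'm) ring_scheme \<Rightarrow> ('a \<Rightarrow> 'a) set" where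
  "kaehler_submodule R \<phi> A =
     LinearCombinations.module.span A (free_module A (carrier A)) (kaehler_relations R \<phi> A)"

definition kaehler ::
    "('r, 'l) ring_scheme \<Rightarrow> ('r \<Rightarrow> 'a) \<Rightarrow> ('a, 'm) ring_scheme \<Rightarrow> ('a, ('a \<Rightarrow> 'a) set) module" where
  "kaehler R \<phi> A = quot_module (free_module A (carrier A)) (kaehler_submodule R \<phi> A)"

definition univ_deriv ::
    "('r, 'l) ring_scheme \<Rightarrow> ('r \<Rightarrow> 'a) \<Rightarrow> ('a, 'm) ring_scheme \<Rightarrow> 'a \<Rightarrow> ('a \<Rightarrow> 'a) set" where
  "univ_deriv R \<phi> A a = kaehler_submodule R \<phi> A +>\<^bsub>free_module A (carrier A)\<^esub> free_gen A a"

text \<open>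
  The map \<open>Q \<rightarrow> \<Omega>\<close>, \<open>a \<otimes> a' \<otimes> t \<mapsto> t (d a \<sqdot> a' - a \<sqdot> d a')\<close>, built by lifting first along
  \<open>A \<otimes>\<^sub>R A\<close> and then along \<open>(A \<otimes>\<^sub>R A) \<otimes> A\<close>.
\<close>

definition Q_to_kaehler ::
    "('r, 'l) ring_scheme \<Rightarrow> ('r \<Rightarrow> 'a) \<Rightarrow> ('a, 'm) ring_scheme \<Rightarrow> 'a Q \<Rightarrow> ('a \<Rightarrow> 'a) set" where
  "Q_to_kaehler R \<phi> A =
     (let \<Omega> = kaehler R \<phi> A; d = univ_deriv R \<phi> A in
      tensor_lift \<Omega> (\<lambda>x t. t \<odot>\<^bsub>\<Omega>\<^esub>
        tensor_lift \<Omega> (\<lambda>a a'. (a' \<odot>\<^bsub>\<Omega>\<^esub> d a) \<ominus>\<^bsub>\<Omega>\<^esub> (a \<odot>\<^bsub>\<Omega>\<^esub> d a')) x))"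

section \<open>Polynomials, rational functions and \<open>\<Lambda>\<close>\<close>

text \<open>
  Polynomials are finitely supported functions on monomials, and monomials are finitely
  supported exponent functions; the variables allowed in \<open>mpoly_ring n\<close> are those with index
  in \<open>{1..n}\<close>.
\<close>

type_synonym 'k mpoly = "(nat \<Rightarrow>\<^sub>0 nat) \<Rightarrow>\<^sub>0 'k"

definition mpoly_ring :: "nat \<Rightarrow> 'k::field mpoly ring" where
  "mpoly_ring n =
     ring_of_type_algebra\<lparr>carrier := {p. \<forall>m\<in>Poly_Mapping.keys p. Poly_Mapping.keys m \<subseteq> {1..n}}\<rparr>"

definition mpoly_const :: "'k::field \<Rightarrow> 'k mpoly" where
  "mpoly_const c = Poly_Mapping.single 0 c"

definition mpoly_var :: "nat \<Rightarrow> 'k::field mpoly" where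
  "mpoly_var i = Poly_Mapping.single (Poly_Mapping.single i 1) 1"

text \<open>
  \<open>K(T\<^sub>1, \<dots>, T\<^sub>n)\<close>, realised inside the fraction field of the polynomial ring in countably
  many variables as the fractions of elements of \<open>K[T\<^sub>1, \<dots>, T\<^sub>n]\<close>.
\<close>

type_synonym 'k ratfun = "'k mpoly fract"

definition ratfun_field :: "nat \<Rightarrow> 'k::field ratfun ring" where
  "ratfun_field n =
     ring_of_type_algebra\<lparr>carrier :=
       {Fract p q | p q. p \<in> carrier (mpoly_ring n) \<and> q \<in> carrier (mpoly_ring n) \<and> q \<noteq> 0}\<rparr>"

definition ratfun_const :: "'k::field \<Rightarrow> 'k ratfun" where
  "ratfun_const c = Fract (mpoly_const c) 1"

definition ratfun_var :: "nat \<Rightarrow> 'k::field ratfun" where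
  "ratfun_var i = Fract (mpoly_var i) 1"

definition Lambda_ideal :: "nat \<Rightarrow> 'k::field mpoly set" where
  "Lambda_ideal n = Idl\<^bsub>mpoly_ring n\<^esub> {mpoly_var i ^ 2 | i. i \<in> {1..n}}"

definition Lambda_ring :: "nat \<Rightarrow> 'k::field mpoly set ring" where
  "Lambda_ring n = mpoly_ring n Quot Lambda_ideal n"

definition Lambda_const :: "nat \<Rightarrow> 'k::field \<Rightarrow> 'k mpoly set" where
  "Lambda_const n c = Lambda_ideal n +>\<^bsub>mpoly_ring n\<^esub> mpoly_const c"

definition Lambda_var :: "nat \<Rightarrow> nat \<Rightarrow> 'k::field mpoly set" where
  "Lambda_var n i = Lambda_ideal n +>\<^bsub>mpoly_ring n\<^esub> mpoly_var i"

section \<open>Homomorphisms of algebras\<close>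

text \<open>
  Ring homomorphisms \<open>A \<rightarrow> B\<close> under \<open>K\<close>, for structure maps \<open>\<alpha> : K \<rightarrow> A\<close> and \<open>\<beta> : K \<rightarrow> B\<close>.
\<close>

definition alg_hom ::
    "('r, 'l) ring_scheme \<Rightarrow> ('r \<Rightarrow> 'a) \<Rightarrow> ('a, 'm) ring_scheme \<Rightarrow> ('r \<Rightarrow> 'b) \<Rightarrow> ('b, 'n) ring_scheme
      \<Rightarrow> ('a \<Rightarrow> 'b) set" where
  "alg_hom K \<alpha> A \<beta> B = {h \<in> ring_hom A B. \<forall>k\<in>carrier K. h (\<alpha> k) = \<beta> k}"

end

theory Submission
  imports Defs
begin

text \<open>
  Over a ring of characteristic 2, expanding \<open>(a + 1) \<otimes> (a + 1)\<close> shows that \<open>a \<otimes> 1 \<otimes> 1\<close> and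
  \<open>1 \<otimes> a \<otimes> 1\<close> agree in \<open>Q\<close>, so an element \<open>a \<otimes> a' \<otimes> t\<close> depends only on \<open>(a a', t)\<close>, and \<open>Q\<close> is
  universal for biadditive maps \<open>F\<close> with \<open>F(c b, t) = F(b, c t)\<close> for all squares and constants \<open>c\<close>. An
  operator \<open>E\<close> on \<open>A = K(T\<^sub>1, \<dots>, T\<^sub>n)\<close> that is linear over squares and constants gives such an \<open>F\<close>, with
  \<open>F(b, t) = t E(b)\<close>. The partial derivatives are of this kind: a Taylor expansion gives
  the map \<open>T\<^sub>i \<mapsto> T\<^sub>i + S\<^sub>i\<close>, and the mixed derivatives \<open>\<partial>\<^sub>J\<close> give linear functionals on \<open>Q\<close> dual to
  the products \<open>s\<^sub>J\<close> of the elements \<open>s\<^sub>i = 1 \<otimes> 1 \<otimes> T\<^sub>i + T\<^sub>i \<otimes> 1 \<otimes> 1\<close>, because the commutator of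
  \<open>\<partial>\<^sub>J\<close> with multiplication by \<open>T\<^sub>i\<close> is \<open>\<partial>\<^bsub>J - {i}\<^esub>\<close>. Since \<open>1/a = a / a\<^sup>2\<close>, the \<open>s\<^sub>J\<close> also span \<open>Q\<close>.
  The map to differentials is \<open>a \<otimes> a' \<otimes> t \<mapsto> t d(a a')\<close>, a derivation along the augmentation, so it
  kills \<open>I\<^sup>2\<close>, in particular the nonzero element \<open>s\<^sub>1 s\<^sub>2\<close>.
\<close>

section \<open>Tensor products\<close>

text \<open>Each map out of \<open>Q\<close> used here is a \<open>tensor_lift\<close>, whose value
  is meaningful only for a map balanced over \<Delta>, a subring known through its generators.
  Multiplication sends these generators to squares and constants, so balancing becomes linearity
  over squares and constants. Partial derivatives have it in characteristic 2 because
  \<open>d(c^2) = 2 c dc\<close> vanishes.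

  Sending \<open>T_i\<close> to \<open>T_i + S_i\<close> is immediate on polynomials, but on
  fractions it would require inverting \<open>p(T + S)\<close>. The Taylor expansion avoids this:
  the quotient rule is built into the derivatives, which act on all rational functions. The two
  composites are then compared with the identity on constants and variables only.

  The dimension of \<open>W\<close> is computed inside \<open>Q\<close> and not transported through
  the isomorphism: the products \<open>s_J\<close> with \<open>J\<close> nonempty span the
  augmentation ideal, and the mixed derivatives are coordinates dual to them. The number
  \<open>2^n - 1\<close> counts the nonempty subsets of \<open>{1..n}\<close>.\<close>

lemma pair_ring_simps [simp]:
  "carrier (pair_ring A B) = {u. Poly_Mapping.keys u \<subseteq> carrier A \<times> carrier B}"
  "\<one>\<^bsub>pair_ring A B\<^esub> = frag_of (\<one>\<^bsub>A\<^esub>, \<one>\<^bsub>B\<^esub>)"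
  "\<zero>\<^bsub>pair_ring A B\<^esub> = 0"
  "u \<oplus>\<^bsub>pair_ring A B\<^esub> v = u + v"
  by (simp_all add: pair_ring_def)

lemma frag_cmul_single: "frag_cmul c (Poly_Mapping.single x d) = Poly_Mapping.single x (c * d)"
  by (rule poly_mapping_eqI) (simp add: lookup_single when_def)

text \<open>Expressing the double sum by \<open>frag_extend\<close> turns biadditivity of the
  product into the additivity of extensions from a free abelian group.\<close>

lemma pair_ring_mult:
  "u \<otimes>\<^bsub>pair_ring A B\<^esub> v =
     frag_extend (\<lambda>x. frag_extend (\<lambda>y. frag_of (fst x \<otimes>\<^bsub>A\<^esub> fst y, snd x \<otimes>\<^bsub>B\<^esub> snd y)) v) u"
  by (simp add: pair_ring_def frag_extend_def frag_cmul_sum frag_cmul_single)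

lemma pair_ring_mult_of [simp]:
  "frag_of (a, b) \<otimes>\<^bsub>pair_ring A B\<^esub> frag_of (a', b') = frag_of (a \<otimes>\<^bsub>A\<^esub> a', b \<otimes>\<^bsub>B\<^esub> b')"
  by (simp add: pair_ring_mult)

lemma pair_ring_mult_0 [simp]:
  "0 \<otimes>\<^bsub>pair_ring A B\<^esub> v = 0" "u \<otimes>\<^bsub>pair_ring A B\<^esub> 0 = 0"
  by (simp_all add: pair_ring_mult frag_extend_eq_0)

lemma frag_extend_diff_fun:
  fixes f g :: "'b \<Rightarrow> 'a \<Rightarrow>\<^sub>0 int"
  shows "frag_extend (\<lambda>x. f x - g x) u = frag_extend f u - frag_extend g u"
proof -
  have "frag_cmul c (a - b) = frag_cmul c a - frag_cmul c b" for c and a b :: "'a \<Rightarrow>\<^sub>0 int"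
    by (rule poly_mapping_eqI) (simp add: lookup_minus algebra_simps)
  thus ?thesis by (simp add: frag_extend_def sum_subtractf)
qed

lemma pair_ring_mult_diff:
  "(u - u') \<otimes>\<^bsub>pair_ring A B\<^esub> v = u \<otimes>\<^bsub>pair_ring A B\<^esub> v - u' \<otimes>\<^bsub>pair_ring A B\<^esub> v"
  "u \<otimes>\<^bsub>pair_ring A B\<^esub> (v - v') = u \<otimes>\<^bsub>pair_ring A B\<^esub> v - u \<otimes>\<^bsub>pair_ring A B\<^esub> v'"
  by (simp_all add: pair_ring_mult frag_extend_diff frag_extend_diff_fun)

text \<open>Closing under differences also reaches negative coefficients, so integer multiples of
  generators get no case of their own.\<close>

lemma pair_induct [consumes 1, case_names zero gen diff]:
  assumes "u \<in> carrier (pair_ring A B)"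
    and "P 0" and "\<And>a b. a \<in> carrier A \<Longrightarrow> b \<in> carrier B \<Longrightarrow> P (frag_of (a, b))"
    and "\<And>u v. P u \<Longrightarrow> P v \<Longrightarrow> P (u - v)"
  shows "P u"
proof -
  have "Poly_Mapping.keys u \<subseteq> carrier A \<times> carrier B" using assms(1) by simp
  thus ?thesis by (induction u rule: frag_induction) (use assms(2-4) in auto)
qed

lemma keys_diff_subset:
  fixes u v :: "'a \<Rightarrow>\<^sub>0 int"
  shows "Poly_Mapping.keys u \<subseteq> S \<Longrightarrow> Poly_Mapping.keys v \<subseteq> S \<Longrightarrow> Poly_Mapping.keys (u - v) \<subseteq> S"
  using keys_diff[of u v] by blast

text \<open>On generators the monoid laws are those of \<open>A\<close> and \<open>B\<close>. All of
  them are additive in each argument, so one induction per argument carries them to the whole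
  ring.\<close>

lemma pair_ring_cring:
  assumes "cring A" "cring B"
  shows "cring (pair_ring A B)"
proof -
  interpret A: cring A by fact
  interpret B: cring B by fact
  let ?P = "pair_ring A B"
  have closed: "u \<otimes>\<^bsub>?P\<^esub> v \<in> carrier ?P" if "u \<in> carrier ?P" "v \<in> carrier ?P" for u v
    using that(1)
  proof (induction u rule: pair_induct)
    case (gen a b)
    show ?case using that(2)
      by (induction v rule: pair_induct) (use gen in \<open>auto simp: pair_ring_mult_diff keys_diff_subset\<close>)
  qed (auto simp: pair_ring_mult_diff keys_diff_subset)
  have comm: "u \<otimes>\<^bsub>?P\<^esub> v = v \<otimes>\<^bsub>?P\<^esub> u" if "u \<in> carrier ?P" "v \<in> carrier ?P" for u v
    using that(1)
  proof (induction u rule: pair_induct)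
    case (gen a b)
    show ?case using that(2)
      by (induction v rule: pair_induct)
        (use gen in \<open>auto simp: pair_ring_mult_diff A.m_comm B.m_comm\<close>)
  qed (auto simp: pair_ring_mult_diff)
  have assoc: "(u \<otimes>\<^bsub>?P\<^esub> v) \<otimes>\<^bsub>?P\<^esub> w = u \<otimes>\<^bsub>?P\<^esub> (v \<otimes>\<^bsub>?P\<^esub> w)"
    if "u \<in> carrier ?P" "v \<in> carrier ?P" "w \<in> carrier ?P" for u v w
    using that(1)
  proof (induction u rule: pair_induct)
    case (gen a b)
    show ?case using that(2)
    proof (induction v rule: pair_induct)
      case (gen c d)
      show ?case using that(3)
        by (induction w rule: pair_induct)
          (use gen \<open>a \<in> carrier A\<close> \<open>b \<in> carrier B\<close> in
            \<open>auto simp: pair_ring_mult_diff A.m_assoc B.m_assoc\<close>)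
    qed (auto simp: pair_ring_mult_diff)
  qed (auto simp: pair_ring_mult_diff)
  have one: "frag_of (\<one>\<^bsub>A\<^esub>, \<one>\<^bsub>B\<^esub>) \<otimes>\<^bsub>?P\<^esub> u = u" if "u \<in> carrier ?P" for u
    using that by (induction u rule: pair_induct) (auto simp: pair_ring_mult_diff)
  show ?thesis
  proof (rule cringI)
    show "abelian_group ?P"
    proof (rule abelian_groupI)
      fix u assume u: "u \<in> carrier ?P"
      show "\<exists>v\<in>carrier ?P. v \<oplus>\<^bsub>?P\<^esub> u = \<zero>\<^bsub>?P\<^esub>"
        by (rule bexI[of _ "- u"]) (use u in simp_all)
    next
      fix u v assume uv: "u \<in> carrier ?P" "v \<in> carrier ?P"
      show "u \<oplus>\<^bsub>?P\<^esub> v \<in> carrier ?P" using uv Poly_Mapping.keys_add[of u v] by auto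
    qed (auto simp: add.assoc add.commute)
    show "comm_monoid ?P"
      by (rule comm_monoidI) (use closed assoc comm one in auto)
    fix u v w assume "u \<in> carrier ?P" "v \<in> carrier ?P" "w \<in> carrier ?P"
    show "(u \<oplus>\<^bsub>?P\<^esub> v) \<otimes>\<^bsub>?P\<^esub> w = u \<otimes>\<^bsub>?P\<^esub> w \<oplus>\<^bsub>?P\<^esub> v \<otimes>\<^bsub>?P\<^esub> w"
      by (simp add: pair_ring_mult frag_extend_add)
  qed
qed

section \<open>Additive maps out of a tensor product\<close>

definition pair_sum ::
    "('c, 'k) ring_scheme \<Rightarrow> ('a \<Rightarrow> 'b \<Rightarrow> 'c) \<Rightarrow> ('a \<times> 'b \<Rightarrow>\<^sub>0 int) \<Rightarrow> 'c" where
  "pair_sum M \<beta> u =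
     (\<Oplus>\<^bsub>M\<^esub>x\<in>Poly_Mapping.keys u. add_pow M (Poly_Mapping.lookup u x) (\<beta> (fst x) (snd x)))"

lemma (in abelian_group) pair_sum_0 [simp]: "pair_sum G \<beta> 0 = \<zero>"
  by (simp add: pair_sum_def)

lemma (in abelian_group) pair_sum_of:
  "\<beta> a b \<in> carrier G \<Longrightarrow> pair_sum G \<beta> (frag_of (a, b)) = \<beta> a b"
  by (simp add: pair_sum_def)

lemma add_pow_zero [simp]: "add_pow G (0 :: int) x = \<zero>\<^bsub>G\<^esub>"
  by (simp add: add_pow_def)

lemma (in abelian_group) pair_sum_superset:
  assumes "finite Y" "Poly_Mapping.keys u \<subseteq> Y"
    and "\<And>x. x \<in> Y \<Longrightarrow> \<beta> (fst x) (snd x) \<in> carrier G"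
  shows "pair_sum G \<beta> u = (\<Oplus>x\<in>Y. add_pow G (Poly_Mapping.lookup u x) (\<beta> (fst x) (snd x)))"
  unfolding pair_sum_def
  by (rule add.finprod_mono_neutral_cong_left)
    (use assms in \<open>auto simp: not_in_keys_iff_lookup_eq_zero\<close>)

text \<open>The supports of \<open>u\<close>, \<open>v\<close> and \<open>u - v\<close> differ,
  since terms may cancel. All three sums are therefore taken over the union of the first two, where
  the extra terms are zero, and compared term by term.\<close>

lemma (in abelian_group) pair_sum_diff:
  assumes "Poly_Mapping.keys u \<subseteq> S" "Poly_Mapping.keys v \<subseteq> S"
    and "\<And>x. x \<in> S \<Longrightarrow> \<beta> (fst x) (snd x) \<in> carrier G"
  shows "pair_sum G \<beta> (u - v) = pair_sum G \<beta> u \<ominus> pair_sum G \<beta> v"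
proof -
  let ?Y = "Poly_Mapping.keys u \<union> Poly_Mapping.keys v"
  let ?b = "\<lambda>x. \<beta> (fst x) (snd x)"
  have Y: "finite ?Y" "\<And>x. x \<in> ?Y \<Longrightarrow> ?b x \<in> carrier G" using assms by auto
  have "pair_sum G \<beta> (u - v) \<oplus> pair_sum G \<beta> v =
      (\<Oplus>x\<in>?Y. add_pow G (Poly_Mapping.lookup (u - v) x) (?b x) \<oplus> add_pow G (Poly_Mapping.lookup v x) (?b x))"
    (is "_ = ?rhs")
  proof -
    have "?rhs = (\<Oplus>x\<in>?Y. add_pow G (Poly_Mapping.lookup (u - v) x) (?b x)) \<oplus>
        (\<Oplus>x\<in>?Y. add_pow G (Poly_Mapping.lookup v x) (?b x))"
      using Y by (intro add.finprod_multf) auto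
    moreover have "pair_sum G \<beta> (u - v) = (\<Oplus>x\<in>?Y. add_pow G (Poly_Mapping.lookup (u - v) x) (?b x))"
      by (rule pair_sum_superset) (use Y keys_diff[of u v] in auto)
    moreover have "pair_sum G \<beta> v = (\<Oplus>x\<in>?Y. add_pow G (Poly_Mapping.lookup v x) (?b x))"
      by (rule pair_sum_superset) (use Y in auto)
    ultimately show ?thesis by simp
  qed
  also have "\<dots> = (\<Oplus>x\<in>?Y. add_pow G (Poly_Mapping.lookup u x) (?b x))"
    using Y by (intro add.finprod_cong') (auto simp: lookup_minus add.int_pow_mult[symmetric])
  also have "\<dots> = pair_sum G \<beta> u"
    by (rule pair_sum_superset[symmetric]) (use Y in auto)
  finally have *: "pair_sum G \<beta> (u - v) \<oplus> pair_sum G \<beta> v = pair_sum G \<beta> u" .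
  have "pair_sum G \<beta> w \<in> carrier G" if "Poly_Mapping.keys w \<subseteq> S" for w
    unfolding pair_sum_def using assms(3) that by (intro finsum_closed) auto
  moreover have "Poly_Mapping.keys (u - v) \<subseteq> S" using assms keys_diff_subset by blast
  ultimately show ?thesis using * assms(1,2) by (metis add.inv_solve_right' minus_eq)
qed

lemma (in abelian_group) pair_sum_closed:
  assumes "\<And>x. x \<in> Poly_Mapping.keys u \<Longrightarrow> \<beta> (fst x) (snd x) \<in> carrier G"
  shows "pair_sum G \<beta> u \<in> carrier G"
  unfolding pair_sum_def using assms by (intro finsum_closed) auto

text \<open>The clauses after the first correspond to the three families in
  \<open>tensor_relations\<close>: they make the additive extension of \<open>\<beta>\<close> vanish
  on each of them.\<close>

definition balanced ::
    "('r, 'l) ring_scheme \<Rightarrow> ('r \<Rightarrow> 'a) \<Rightarrow> ('a, 'm) ring_scheme \<Rightarrow> ('r \<Rightarrow> 'b) \<Rightarrow> ('b, 'n) ring_scheme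
      \<Rightarrow> ('c, 'k) ring_scheme \<Rightarrow> ('a \<Rightarrow> 'b \<Rightarrow> 'c) \<Rightarrow> bool" where
  "balanced R \<phi> A \<psi> B M \<beta> \<longleftrightarrow>
     (\<forall>a\<in>carrier A. \<forall>b\<in>carrier B. \<beta> a b \<in> carrier M) \<and>
     (\<forall>a\<in>carrier A. \<forall>a'\<in>carrier A. \<forall>b\<in>carrier B. \<beta> (a \<oplus>\<^bsub>A\<^esub> a') b = \<beta> a b \<oplus>\<^bsub>M\<^esub> \<beta> a' b) \<and>
     (\<forall>a\<in>carrier A. \<forall>b\<in>carrier B. \<forall>b'\<in>carrier B. \<beta> a (b \<oplus>\<^bsub>B\<^esub> b') = \<beta> a b \<oplus>\<^bsub>M\<^esub> \<beta> a b') \<and>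
     (\<forall>r\<in>carrier R. \<forall>a\<in>carrier A. \<forall>b\<in>carrier B. \<beta> (\<phi> r \<otimes>\<^bsub>A\<^esub> a) b = \<beta> a (\<psi> r \<otimes>\<^bsub>B\<^esub> b))"

text \<open>Of the base \<open>R\<close> only the images under the structure maps enter, as elements
  of \<open>A\<close> and \<open>B\<close>. In this form \<open>diag_ring\<close>, a record with a
  replaced carrier, can serve directly as the base of the outer tensor product.\<close>

locale tensor_product = A: cring A + B: cring B
  for R :: "('r, 'l) ring_scheme" and \<phi> and A :: "('a, 'm) ring_scheme"
    and \<psi> and B :: "('b, 'n) ring_scheme" +
  assumes \<phi>_closed: "r \<in> carrier R \<Longrightarrow> \<phi> r \<in> carrier A"
    and \<psi>_closed: "r \<in> carrier R \<Longrightarrow> \<psi> r \<in> carrier B"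
begin

abbreviation P where "P \<equiv> pair_ring A B"
abbreviation J where "J \<equiv> tensor_ideal R \<phi> A \<psi> B"
abbreviation T where "T \<equiv> tensor_ring R \<phi> A \<psi> B"
abbreviation tn where "tn \<equiv> tensor R \<phi> A \<psi> B"

lemma P_cring: "cring P"
  by (rule pair_ring_cring) (rule A.is_cring B.is_cring)+

interpretation P: cring P by (rule P_cring)

lemma gen_closed: "a \<in> carrier A \<Longrightarrow> b \<in> carrier B \<Longrightarrow> frag_of (a, b) \<in> carrier P"
  by simp

lemma minus_P:
  assumes "u \<in> carrier P" "v \<in> carrier P"
  shows "u \<ominus>\<^bsub>P\<^esub> v = u - v"
proof -
  have "\<ominus>\<^bsub>P\<^esub> v = - v" by (rule P.minus_equality) (use assms in auto)
  thus ?thesis by (simp add: a_minus_def)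
qed

lemma diff_closed: "u \<in> carrier P \<Longrightarrow> v \<in> carrier P \<Longrightarrow> u - v \<in> carrier P"
  by (simp add: keys_diff_subset)

lemma relations_closed: "tensor_relations R \<phi> A \<psi> B \<subseteq> carrier P"
  unfolding tensor_relations_def
  by (intro Un_least subsetI; elim CollectE exE conjE; hypsubst; intro diff_closed gen_closed)
    (auto simp: \<phi>_closed \<psi>_closed)

lemma ideal_J: "ideal J P"
  unfolding tensor_ideal_def by (rule P.genideal_ideal[OF relations_closed])

lemma relations_J: "tensor_relations R \<phi> A \<psi> B \<subseteq> J"
  unfolding tensor_ideal_def by (rule P.genideal_self[OF relations_closed])

interpretation J: ideal J P by (rule ideal_J)

lemma T_cring: "cring T"
  unfolding tensor_ring_def by (rule J.quotient_is_cring[OF P.is_cring])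

interpretation T: cring T by (rule T_cring)

lemma rcos_hom: "ring_hom_ring P T (\<lambda>u. J +>\<^bsub>P\<^esub> u)"
  unfolding tensor_ring_def by (rule J.rcos_ring_hom_ring)

interpretation rc: ring_hom_ring P T "\<lambda>u. J +>\<^bsub>P\<^esub> u" by (rule rcos_hom)

lemma tensor_closed [intro, simp]: "a \<in> carrier A \<Longrightarrow> b \<in> carrier B \<Longrightarrow> tn a b \<in> carrier T"
  unfolding tensor_def by (rule rc.hom_closed) simp

lemma carrier_T: "carrier T = (\<lambda>u. J +>\<^bsub>P\<^esub> u) ` carrier P"
  by (auto simp: tensor_ring_def FactRing_def A_RCOSETS_def')

lemma coset_eq: "u \<in> carrier P \<Longrightarrow> v \<in> carrier P \<Longrightarrow> u - v \<in> J \<Longrightarrow> J +>\<^bsub>P\<^esub> u = J +>\<^bsub>P\<^esub> v"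
  using P.quotient_eq_iff_same_a_r_cos[OF ideal_J, of u v] minus_P[of u v] by simp

lemma coset_diff: "u \<in> carrier P \<Longrightarrow> v \<in> carrier P \<Longrightarrow> J +>\<^bsub>P\<^esub> (u - v) = (J +>\<^bsub>P\<^esub> u) \<ominus>\<^bsub>T\<^esub> (J +>\<^bsub>P\<^esub> v)"
  using minus_P[of u v, symmetric] by (simp add: a_minus_def del: pair_ring_simps)

lemma tensor_induct [consumes 1, case_names zero gen diff]:
  assumes "x \<in> carrier T" and "Q \<zero>\<^bsub>T\<^esub>"
    and "\<And>a b. a \<in> carrier A \<Longrightarrow> b \<in> carrier B \<Longrightarrow> Q (tn a b)"
    and diff: "\<And>x y. x \<in> carrier T \<Longrightarrow> y \<in> carrier T \<Longrightarrow> Q x \<Longrightarrow> Q y \<Longrightarrow> Q (x \<ominus>\<^bsub>T\<^esub> y)"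
  shows "Q x"
proof -
  obtain u where u: "u \<in> carrier P" "x = J +>\<^bsub>P\<^esub> u" using assms(1) carrier_T by auto
  \<comment> \<open>Membership is carried along because taking cosets commutes with differences only
    for elements of the carrier.\<close>
  have "u \<in> carrier P \<and> Q (J +>\<^bsub>P\<^esub> u)" using u(1)
  proof (induction u rule: pair_induct)
    case zero thus ?case using assms(2) rc.hom_zero by simp
  next
    case (gen a b) thus ?case using assms(3)[of a b] by (simp add: tensor_def)
  next
    case (diff u v)
    thus ?case using assms(4)[of "J +>\<^bsub>P\<^esub> u" "J +>\<^bsub>P\<^esub> v"] diff_closed[of u v] coset_diff[of u v]
        rc.hom_closed[of u] rc.hom_closed[of v]
      by (simp del: pair_ring_simps)
  qed
  thus ?thesis using u by simp
qed

lemma tensor_mult: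
  "a \<in> carrier A \<Longrightarrow> b \<in> carrier B \<Longrightarrow> a' \<in> carrier A \<Longrightarrow> b' \<in> carrier B \<Longrightarrow>
   tn a b \<otimes>\<^bsub>T\<^esub> tn a' b' = tn (a \<otimes>\<^bsub>A\<^esub> a') (b \<otimes>\<^bsub>B\<^esub> b')"
  unfolding tensor_def by (subst rc.hom_mult[symmetric]) auto

lemma tensor_one: "\<one>\<^bsub>T\<^esub> = tn \<one>\<^bsub>A\<^esub> \<one>\<^bsub>B\<^esub>"
  unfolding tensor_def using rc.hom_one by simp

lemma tensor_add_left:
  assumes "a \<in> carrier A" "a' \<in> carrier A" "b \<in> carrier B"
  shows "tn (a \<oplus>\<^bsub>A\<^esub> a') b = tn a b \<oplus>\<^bsub>T\<^esub> tn a' b"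
proof -
  have "frag_of (a \<oplus>\<^bsub>A\<^esub> a', b) - (frag_of (a, b) + frag_of (a', b)) \<in> J"
    using relations_J assms unfolding tensor_relations_def diff_diff_add[symmetric] by blast
  hence "tn (a \<oplus>\<^bsub>A\<^esub> a') b = J +>\<^bsub>P\<^esub> (frag_of (a, b) \<oplus>\<^bsub>P\<^esub> frag_of (a', b))"
    unfolding tensor_def using assms keys_add[of "frag_of (a, b)" "frag_of (a', b)"]
    by (intro coset_eq) auto
  thus ?thesis unfolding tensor_def using assms by (subst rc.hom_add[symmetric]) auto
qed

lemma tensor_add_right:
  assumes "a \<in> carrier A" "b \<in> carrier B" "b' \<in> carrier B"
  shows "tn a (b \<oplus>\<^bsub>B\<^esub> b') = tn a b \<oplus>\<^bsub>T\<^esub> tn a b'"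
proof -
  have "frag_of (a, b \<oplus>\<^bsub>B\<^esub> b') - (frag_of (a, b) + frag_of (a, b')) \<in> J"
    using relations_J assms unfolding tensor_relations_def diff_diff_add[symmetric] by blast
  hence "tn a (b \<oplus>\<^bsub>B\<^esub> b') = J +>\<^bsub>P\<^esub> (frag_of (a, b) \<oplus>\<^bsub>P\<^esub> frag_of (a, b'))"
    unfolding tensor_def using assms keys_add[of "frag_of (a, b)" "frag_of (a, b')"]
    by (intro coset_eq) auto
  thus ?thesis unfolding tensor_def using assms by (subst rc.hom_add[symmetric]) auto
qed

lemma tensor_balanced:
  assumes "r \<in> carrier R" "a \<in> carrier A" "b \<in> carrier B"
  shows "tn (\<phi> r \<otimes>\<^bsub>A\<^esub> a) b = tn a (\<psi> r \<otimes>\<^bsub>B\<^esub> b)"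
proof -
  have "frag_of (\<phi> r \<otimes>\<^bsub>A\<^esub> a, b) - frag_of (a, \<psi> r \<otimes>\<^bsub>B\<^esub> b) \<in> J"
    using relations_J assms unfolding tensor_relations_def by blast
  thus ?thesis unfolding tensor_def using assms \<phi>_closed \<psi>_closed
    by (intro coset_eq) auto
qed

lemma balancedI:
  assumes "\<And>a b. a \<in> carrier A \<Longrightarrow> b \<in> carrier B \<Longrightarrow> \<beta> a b \<in> carrier M"
    and "\<And>a a' b. a \<in> carrier A \<Longrightarrow> a' \<in> carrier A \<Longrightarrow> b \<in> carrier B \<Longrightarrow>
      \<beta> (a \<oplus>\<^bsub>A\<^esub> a') b = \<beta> a b \<oplus>\<^bsub>M\<^esub> \<beta> a' b"
    and "\<And>a b b'. a \<in> carrier A \<Longrightarrow> b \<in> carrier B \<Longrightarrow> b' \<in> carrier B \<Longrightarrow>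
      \<beta> a (b \<oplus>\<^bsub>B\<^esub> b') = \<beta> a b \<oplus>\<^bsub>M\<^esub> \<beta> a b'"
    and "\<And>r a b. r \<in> carrier R \<Longrightarrow> a \<in> carrier A \<Longrightarrow> b \<in> carrier B \<Longrightarrow>
      \<beta> (\<phi> r \<otimes>\<^bsub>A\<^esub> a) b = \<beta> a (\<psi> r \<otimes>\<^bsub>B\<^esub> b)"
  shows "balanced R \<phi> A \<psi> B M \<beta>"
  using assms by (simp add: balanced_def)

end

lemma abelian_group_homI':
  assumes "abelian_group G" "abelian_group H"
    and "\<And>x. x \<in> carrier G \<Longrightarrow> h x \<in> carrier H"
    and "\<And>x y. x \<in> carrier G \<Longrightarrow> y \<in> carrier G \<Longrightarrow> h (x \<oplus>\<^bsub>G\<^esub> y) = h x \<oplus>\<^bsub>H\<^esub> h y"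
  shows "abelian_group_hom G H h"
  using assms
  by (intro abelian_group_homI group_hom.intro abelian_group.a_group group_hom_axioms.intro)
    (auto simp: hom_def)

lemma abelian_group_hom_minus:
  assumes "abelian_group_hom G H h" "x \<in> carrier G" "y \<in> carrier G"
  shows "h (x \<ominus>\<^bsub>G\<^esub> y) = h x \<ominus>\<^bsub>H\<^esub> h y"
proof -
  interpret abelian_group_hom G H h by fact
  show ?thesis using assms(2,3) by (simp add: a_minus_def)
qed

locale tensor_lifting = tensor_product R \<phi> A \<psi> B + M: abelian_group M
  for R :: "('r, 'l) ring_scheme" and \<phi> and A :: "('a, 'm) ring_scheme"
    and \<psi> and B :: "('b, 'n) ring_scheme" and M :: "('c, 'k) ring_scheme"
begin

interpretation P: cring P by (rule P_cring)
interpretation J: ideal J P by (rule ideal_J)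
interpretation T: cring T by (rule T_cring)
interpretation rc: ring_hom_ring P T "\<lambda>u. J +>\<^bsub>P\<^esub> u" by (rule rcos_hom)

abbreviation bal where "bal \<equiv> balanced R \<phi> A \<psi> B M"

lemma balancedD:
  assumes "bal \<beta>"
  shows "a \<in> carrier A \<Longrightarrow> b \<in> carrier B \<Longrightarrow> \<beta> a b \<in> carrier M"
    and "a \<in> carrier A \<Longrightarrow> a' \<in> carrier A \<Longrightarrow> b \<in> carrier B \<Longrightarrow>
      \<beta> (a \<oplus>\<^bsub>A\<^esub> a') b = \<beta> a b \<oplus>\<^bsub>M\<^esub> \<beta> a' b"
    and "a \<in> carrier A \<Longrightarrow> b \<in> carrier B \<Longrightarrow> b' \<in> carrier B \<Longrightarrow>
      \<beta> a (b \<oplus>\<^bsub>B\<^esub> b') = \<beta> a b \<oplus>\<^bsub>M\<^esub> \<beta> a b'"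
    and "r \<in> carrier R \<Longrightarrow> a \<in> carrier A \<Longrightarrow> b \<in> carrier B \<Longrightarrow>
      \<beta> (\<phi> r \<otimes>\<^bsub>A\<^esub> a) b = \<beta> a (\<psi> r \<otimes>\<^bsub>B\<^esub> b)"
  using assms unfolding balanced_def by blast+

lemma psum_diff:
  assumes "bal \<beta>" "u \<in> carrier P" "v \<in> carrier P"
  shows "pair_sum M \<beta> (u - v) = pair_sum M \<beta> u \<ominus>\<^bsub>M\<^esub> pair_sum M \<beta> v"
  by (rule M.pair_sum_diff[of _ "carrier A \<times> carrier B"]) (use assms in \<open>auto intro: balancedD\<close>)

lemma psum_closed: "bal \<beta> \<Longrightarrow> u \<in> carrier P \<Longrightarrow> pair_sum M \<beta> u \<in> carrier M"
  by (rule M.pair_sum_closed) (auto intro: balancedD)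

lemma psum_of: "bal \<beta> \<Longrightarrow> a \<in> carrier A \<Longrightarrow> b \<in> carrier B \<Longrightarrow> pair_sum M \<beta> (frag_of (a, b)) = \<beta> a b"
  by (rule M.pair_sum_of) (auto intro: balancedD)

lemma psum_minus:
  assumes "bal \<beta>" "u \<in> carrier P"
  shows "pair_sum M \<beta> (- u) = \<ominus>\<^bsub>M\<^esub> pair_sum M \<beta> u"
  using psum_diff[of \<beta> 0 u] psum_closed[of \<beta> u] assms by (simp add: a_minus_def)

lemma psum_add:
  assumes "bal \<beta>" "u \<in> carrier P" "v \<in> carrier P"
  shows "pair_sum M \<beta> (u + v) = pair_sum M \<beta> u \<oplus>\<^bsub>M\<^esub> pair_sum M \<beta> v"
  using psum_diff[of \<beta> u "- v"] psum_minus[of \<beta> v] psum_closed[of \<beta> v] assms by (simp add: a_minus_def)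

lemma psum_relation:
  assumes \<beta>: "bal \<beta>" and u: "u \<in> tensor_relations R \<phi> A \<psi> B"
  shows "pair_sum M \<beta> u = \<zero>\<^bsub>M\<^esub>"
proof -
  note * = psum_diff[OF \<beta>] psum_of[OF \<beta>] balancedD[OF \<beta>] diff_closed gen_closed \<phi>_closed \<psi>_closed
  have m: "(x \<oplus>\<^bsub>M\<^esub> y) \<ominus>\<^bsub>M\<^esub> x \<ominus>\<^bsub>M\<^esub> y = \<zero>\<^bsub>M\<^esub>" if "x \<in> carrier M" "y \<in> carrier M" for x y
    using that M.r_neg[of "x \<oplus>\<^bsub>M\<^esub> y"] M.a_assoc[of "x \<oplus>\<^bsub>M\<^esub> y" "\<ominus>\<^bsub>M\<^esub> x" "\<ominus>\<^bsub>M\<^esub> y"]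
    by (simp add: a_minus_def M.minus_add)
  from u consider
      (l) a a' b where "u = frag_of (a \<oplus>\<^bsub>A\<^esub> a', b) - frag_of (a, b) - frag_of (a', b)"
        "a \<in> carrier A" "a' \<in> carrier A" "b \<in> carrier B"
    | (r) a b b' where "u = frag_of (a, b \<oplus>\<^bsub>B\<^esub> b') - frag_of (a, b) - frag_of (a, b')"
        "a \<in> carrier A" "b \<in> carrier B" "b' \<in> carrier B"
    | (s) r a b where "u = frag_of (\<phi> r \<otimes>\<^bsub>A\<^esub> a, b) - frag_of (a, \<psi> r \<otimes>\<^bsub>B\<^esub> b)"
        "r \<in> carrier R" "a \<in> carrier A" "b \<in> carrier B"
    unfolding tensor_relations_def by blast
  thus ?thesis
    by cases (simp_all del: pair_ring_simps add: * m)
qed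

text \<open>The factor \<open>\<phi> r\<close> commutes past \<open>c\<close>, and
  \<open>\<psi> r\<close> past \<open>d\<close>. So multiplication by a pure tensor turns a balanced
  map into another balanced map, which is how vanishing on the relations spreads to the ideal they
  generate.\<close>

lemma balanced_shift:
  assumes \<beta>: "bal \<beta>" and cd: "c \<in> carrier A" "d \<in> carrier B"
  shows "bal (\<lambda>a b. \<beta> (c \<otimes>\<^bsub>A\<^esub> a) (d \<otimes>\<^bsub>B\<^esub> b))"
proof (rule balancedI)
  fix r a b assume r: "r \<in> carrier R" "a \<in> carrier A" "b \<in> carrier B"
  have "c \<otimes>\<^bsub>A\<^esub> (\<phi> r \<otimes>\<^bsub>A\<^esub> a) = \<phi> r \<otimes>\<^bsub>A\<^esub> (c \<otimes>\<^bsub>A\<^esub> a)"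
    "d \<otimes>\<^bsub>B\<^esub> (\<psi> r \<otimes>\<^bsub>B\<^esub> b) = \<psi> r \<otimes>\<^bsub>B\<^esub> (d \<otimes>\<^bsub>B\<^esub> b)"
    using r cd \<phi>_closed \<psi>_closed by (simp_all add: A.m_lcomm B.m_lcomm)
  thus "\<beta> (c \<otimes>\<^bsub>A\<^esub> (\<phi> r \<otimes>\<^bsub>A\<^esub> a)) (d \<otimes>\<^bsub>B\<^esub> b) = \<beta> (c \<otimes>\<^bsub>A\<^esub> a) (d \<otimes>\<^bsub>B\<^esub> (\<psi> r \<otimes>\<^bsub>B\<^esub> b))"
    using balancedD(4)[OF \<beta>] r cd by simp
qed (use cd in \<open>auto simp: A.r_distr B.r_distr balancedD[OF \<beta>]\<close>)

lemma psum_mult_gen: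
  assumes \<beta>: "bal \<beta>" and cd: "c \<in> carrier A" "d \<in> carrier B" and u: "u \<in> carrier P"
  shows "pair_sum M \<beta> (frag_of (c, d) \<otimes>\<^bsub>P\<^esub> u) = pair_sum M (\<lambda>a b. \<beta> (c \<otimes>\<^bsub>A\<^esub> a) (d \<otimes>\<^bsub>B\<^esub> b)) u"
proof -
  have "u \<in> carrier P \<and> ?thesis" using u
  proof (induction u rule: pair_induct)
    case (gen a b)
    thus ?case using cd by (simp add: psum_of[OF \<beta>] psum_of[OF balanced_shift[OF \<beta>]])
  next
    case (diff u v)
    thus ?case using cd psum_diff[OF \<beta>, of "frag_of (c, d) \<otimes>\<^bsub>P\<^esub> u" "frag_of (c, d) \<otimes>\<^bsub>P\<^esub> v"]
        P.m_closed[of "frag_of (c, d)" u] P.m_closed[of "frag_of (c, d)" v]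
      by (simp add: pair_ring_mult_diff psum_diff[OF balanced_shift[OF \<beta> cd]] keys_diff_subset)
  qed simp
  thus ?thesis ..
qed

lemma psum_J:
  assumes \<beta>: "bal \<beta>" and u: "u \<in> J"
  shows "pair_sum M \<beta> u = \<zero>\<^bsub>M\<^esub>"
proof -
  \<comment> \<open>Quantifying over all balanced maps is what makes \<open>N\<close> an ideal:
    multiplying \<open>u\<close> by a generator replaces \<open>\<beta>\<close> by its shift, to
    which membership of \<open>u\<close> applies again.\<close>
  define N where "N = {u \<in> carrier P. \<forall>\<beta>. bal \<beta> \<longrightarrow> pair_sum M \<beta> u = \<zero>\<^bsub>M\<^esub>}"
  have mult: "pair_sum M \<beta> (v \<otimes>\<^bsub>P\<^esub> u) = \<zero>\<^bsub>M\<^esub>" if "u \<in> N" "v \<in> carrier P" "bal \<beta>" for u v \<beta>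
  proof -
    have u: "u \<in> carrier P" using that(1) N_def by auto
    have "v \<in> carrier P \<and> pair_sum M \<beta> (v \<otimes>\<^bsub>P\<^esub> u) = \<zero>\<^bsub>M\<^esub>" using that(2)
    proof (induction v rule: pair_induct)
      case (gen c d)
      thus ?case using psum_mult_gen[OF that(3) gen u] balanced_shift[OF that(3) gen] that(1) N_def
        by simp
    next
      case (diff v w)
      thus ?case using u psum_diff[OF that(3), of "v \<otimes>\<^bsub>P\<^esub> u" "w \<otimes>\<^bsub>P\<^esub> u"] diff_closed[of v w]
        by (simp add: pair_ring_mult_diff a_minus_def del: pair_ring_simps)
    qed simp
    thus ?thesis ..
  qed
  have "ideal N P"
  proof (rule idealI)
    show "ring P" by (rule P.ring_axioms)
    show "subgroup N (add_monoid P)"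
    proof (rule P.add.subgroupI)
      show "N \<subseteq> carrier P" by (auto simp: N_def)
      have "0 \<in> N" unfolding N_def by simp
      thus "N \<noteq> {}" by auto
      fix u assume u: "u \<in> N"
      have "\<ominus>\<^bsub>P\<^esub> u = - u"
        by (rule P.minus_equality) (use u in \<open>auto simp: N_def\<close>)
      thus "\<ominus>\<^bsub>P\<^esub> u \<in> N" using u by (auto simp: N_def psum_minus)
      fix v assume v: "v \<in> N"
      show "u \<oplus>\<^bsub>P\<^esub> v \<in> N" using u v P.a_closed[of u v] by (auto simp: N_def psum_add)
    qed
    fix u v assume "u \<in> N" "v \<in> carrier P"
    moreover have "u \<in> carrier P" using \<open>u \<in> N\<close> N_def by auto
    ultimately show "v \<otimes>\<^bsub>P\<^esub> u \<in> N" "u \<otimes>\<^bsub>P\<^esub> v \<in> N"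
      using mult[of u v] P.m_closed[of v u] P.m_comm[of v u] unfolding N_def by auto
  qed
  moreover have "tensor_relations R \<phi> A \<psi> B \<subseteq> N"
    using relations_closed psum_relation by (auto simp: N_def simp del: pair_ring_simps)
  ultimately have "J \<subseteq> N" unfolding tensor_ideal_def by (rule P.genideal_minimal)
  thus ?thesis using assms N_def by auto
qed

text \<open>The sum is additive and vanishes on \<open>J\<close>, hence is constant on each coset.
  The image under \<open>the_elem\<close> in the definition is thus a singleton.\<close>

lemma tensor_lift_coset:
  assumes \<beta>: "bal \<beta>" and u: "u \<in> carrier P"
  shows "tensor_lift M \<beta> (J +>\<^bsub>P\<^esub> u) = pair_sum M \<beta> u"
  unfolding tensor_lift_def pair_sum_def[symmetric]
proof -
  have "pair_sum M \<beta> v = pair_sum M \<beta> u" if v: "v \<in> J +>\<^bsub>P\<^esub> u" for v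
  proof -
    obtain j where j: "j \<in> J" "v = j + u" using v by (auto simp: a_r_coset_def')
    thus ?thesis
    using psum_add[OF \<beta>, of j u] psum_J[OF \<beta> j(1)] psum_closed[OF \<beta> u] u J.Icarr[of j] by simp
  qed
  moreover have "u \<in> J +>\<^bsub>P\<^esub> u" by (rule J.a_rcos_self[OF u])
  ultimately have "pair_sum M \<beta> ` (J +>\<^bsub>P\<^esub> u) = {pair_sum M \<beta> u}" by blast
  thus "the_elem (pair_sum M \<beta> ` (J +>\<^bsub>P\<^esub> u)) = pair_sum M \<beta> u" by simp
qed

lemma lift_tensor:
  "bal \<beta> \<Longrightarrow> a \<in> carrier A \<Longrightarrow> b \<in> carrier B \<Longrightarrow> tensor_lift M \<beta> (tn a b) = \<beta> a b"
  unfolding tensor_def by (simp add: tensor_lift_coset psum_of)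

lemma lift_hom:
  assumes \<beta>: "bal \<beta>"
  shows "abelian_group_hom T M (tensor_lift M \<beta>)"
proof (rule abelian_group_homI')
  fix x assume "x \<in> carrier T"
  then obtain u where u: "x = J +>\<^bsub>P\<^esub> u" "u \<in> carrier P" using carrier_T by auto
  thus "tensor_lift M \<beta> x \<in> carrier M" by (simp add: tensor_lift_coset[OF \<beta>] psum_closed[OF \<beta>])
  fix y assume "y \<in> carrier T"
  then obtain v where v: "y = J +>\<^bsub>P\<^esub> v" "v \<in> carrier P" using carrier_T by auto
  have "x \<oplus>\<^bsub>T\<^esub> y = J +>\<^bsub>P\<^esub> (u + v)" using u v rc.hom_add[of u v] by simp
  thus "tensor_lift M \<beta> (x \<oplus>\<^bsub>T\<^esub> y) = tensor_lift M \<beta> x \<oplus>\<^bsub>M\<^esub> tensor_lift M \<beta> y"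
    using u v psum_add[OF \<beta>, of u v] tensor_lift_coset[OF \<beta>] P.a_closed[of u v] by simp
qed (unfold_locales)

lemma hom_eqI:
  assumes f: "abelian_group_hom T M f" and g: "abelian_group_hom T M g" and "x \<in> carrier T"
    and eq: "\<And>a b. a \<in> carrier A \<Longrightarrow> b \<in> carrier B \<Longrightarrow> f (tn a b) = g (tn a b)"
  shows "f x = g x"
proof -
  interpret f: abelian_group_hom T M f by fact
  interpret g: abelian_group_hom T M g by fact
  show ?thesis using \<open>x \<in> carrier T\<close>
    by (induction x rule: tensor_induct) (auto simp: eq abelian_group_hom_minus[OF f] abelian_group_hom_minus[OF g])
qed

end

text \<open>Both sides of the multiplicativity law are additive in each factor, so the law on pure
  tensors is enough.\<close>

lemma (in tensor_product) lift_ring_hom: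
  assumes "cring M" and \<beta>: "balanced R \<phi> A \<psi> B M \<beta>"
    and one: "\<beta> \<one>\<^bsub>A\<^esub> \<one>\<^bsub>B\<^esub> = \<one>\<^bsub>M\<^esub>"
    and mult: "\<And>a b a' b'. a \<in> carrier A \<Longrightarrow> b \<in> carrier B \<Longrightarrow> a' \<in> carrier A \<Longrightarrow> b' \<in> carrier B \<Longrightarrow>
       \<beta> (a \<otimes>\<^bsub>A\<^esub> a') (b \<otimes>\<^bsub>B\<^esub> b') = \<beta> a b \<otimes>\<^bsub>M\<^esub> \<beta> a' b'"
  shows "tensor_lift M \<beta> \<in> ring_hom T M"
proof -
  interpret M: cring M by fact
  interpret T: cring T by (rule T_cring)
  interpret tensor_lifting R \<phi> A \<psi> B M by unfold_locales
  let ?l = "tensor_lift M \<beta>"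
  interpret l: abelian_group_hom T M ?l by (rule lift_hom[OF \<beta>])
  have "?l (x \<otimes>\<^bsub>T\<^esub> y) = ?l x \<otimes>\<^bsub>M\<^esub> ?l y" if "x \<in> carrier T" "y \<in> carrier T" for x y
    using that(1)
  proof (induction x rule: tensor_induct)
    case zero thus ?case using that(2) by simp
  next
    case (gen a b)
    show ?case using that(2)
    proof (induction y rule: tensor_induct)
      case zero thus ?case using gen by simp
    next
      case (gen c d)
      thus ?case using \<open>a \<in> _\<close> \<open>b \<in> _\<close> by (simp add: tensor_mult lift_tensor[OF \<beta>] mult)
    next
      case (diff x y)
      thus ?case using gen
        by (simp add: a_minus_def T.r_distr T.r_minus M.r_distr M.r_minus)
    qed
  next
    case (diff x z)
    thus ?case using that(2)
      by (simp add: a_minus_def T.l_distr T.l_minus M.l_distr M.l_minus)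
  qed
  thus ?thesis
    by (intro ring_hom_memI) (auto simp: tensor_one lift_tensor[OF \<beta>] one)
qed

section \<open>The algebra of a homomorphism, and characteristic 2\<close>

locale Q_algebra = A: cring A for R :: "('r, 'l) ring_scheme" and \<phi> and A :: "('a, 'm) ring_scheme" (structure) +
  assumes \<phi>_in: "r \<in> carrier R \<Longrightarrow> \<phi> r \<in> carrier A"
begin

lemma TA_tensor: "tensor_product R \<phi> A \<phi> A"
  by unfold_locales (rule \<phi>_in)+

interpretation TA: tensor_product R \<phi> A \<phi> A by (rule TA_tensor)
interpretation TT: cring TA.T by (rule TA.T_cring)

abbreviation m where "m \<equiv> mult_map A"
abbreviation D where "D \<equiv> diag_ring R \<phi> A"
abbreviation Q where "Q \<equiv> Q_ring R \<phi> A"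
abbreviation q where "q \<equiv> Q_tensor R \<phi> A"

lemma balanced_mult: "balanced R \<phi> A \<phi> A A (\<lambda>a a'. a \<otimes> a')"
  by (rule TA.balancedI) (auto simp: A.l_distr A.r_distr A.m_assoc A.m_lcomm \<phi>_in)

lemma mult_map_hom: "m \<in> ring_hom TA.T A"
  unfolding mult_map_def
  by (rule TA.lift_ring_hom) (auto simp: balanced_mult A.m_ac A.is_cring)

interpretation m: ring_hom_ring TA.T A m
  by (rule ring_hom_ringI2[OF TT.ring_axioms A.ring_axioms mult_map_hom])

lemma mult_map_tensor: "a \<in> carrier A \<Longrightarrow> a' \<in> carrier A \<Longrightarrow> m (TA.tn a a') = a \<otimes> a'"
proof -
  interpret tensor_lifting R \<phi> A \<phi> A A by unfold_locales
  show "a \<in> carrier A \<Longrightarrow> a' \<in> carrier A \<Longrightarrow> m (TA.tn a a') = a \<otimes> a'"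
    unfolding mult_map_def by (rule lift_tensor[OF balanced_mult])
qed

abbreviation H where
  "H \<equiv> {TA.tn a a | a. a \<in> carrier A} \<union> {TA.tn (\<phi> r) \<one> | r. r \<in> carrier R}"

lemma carrier_D: "carrier D = generate_ring TA.T H"
  by (simp add: diag_ring_def)

lemma D_closed: "x \<in> carrier D \<Longrightarrow> x \<in> carrier TA.T"
  unfolding carrier_D by (rule TT.generate_ring_in_carrier) (auto simp: \<phi>_in)

lemma diag_in_D: "a \<in> carrier A \<Longrightarrow> TA.tn a a \<in> carrier D"
  "r \<in> carrier R \<Longrightarrow> TA.tn (\<phi> r) \<one> \<in> carrier D"
  unfolding carrier_D by (auto intro: generate_ring.incl)

lemma QA_tensor: "tensor_product D (\<lambda>x. x) TA.T m A"
proof (intro tensor_product.intro tensor_product_axioms.intro)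
  show "cring TA.T" by (rule TA.T_cring)
  show "cring A" by (rule A.is_cring)
qed (simp_all add: D_closed)

interpretation QA: tensor_product D "\<lambda>x. x" TA.T m A by (rule QA_tensor)

lemma Q_eq: "QA.T = Q" and q_eq: "QA.tn (TA.tn a a') t = q a a' t"
  by (simp_all add: Q_ring_def Q_tensor_def)

sublocale Q: cring Q
  using QA.T_cring by (simp only: Q_eq)

lemma q_closed [simp, intro]:
  "a \<in> carrier A \<Longrightarrow> a' \<in> carrier A \<Longrightarrow> t \<in> carrier A \<Longrightarrow> q a a' t \<in> carrier Q"
  using QA.tensor_closed[of "TA.tn a a'" t] by (simp add: Q_eq q_eq)

lemma q_mult:
  "a \<in> carrier A \<Longrightarrow> a' \<in> carrier A \<Longrightarrow> t \<in> carrier A \<Longrightarrow>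
   b \<in> carrier A \<Longrightarrow> b' \<in> carrier A \<Longrightarrow> s \<in> carrier A \<Longrightarrow>
   q a a' t \<otimes>\<^bsub>Q\<^esub> q b b' s = q (a \<otimes> b) (a' \<otimes> b') (t \<otimes> s)"
  using QA.tensor_mult[of "TA.tn a a'" t "TA.tn b b'" s]
  by (simp add: Q_eq q_eq TA.tensor_mult)

lemma q_one: "\<one>\<^bsub>Q\<^esub> = q \<one> \<one> \<one>"
  using QA.tensor_one by (simp add: Q_eq q_eq TA.tensor_one)

lemma q_add:
  assumes "a \<in> carrier A" "a' \<in> carrier A" "t \<in> carrier A" "b \<in> carrier A"
  shows "q (a \<oplus> b) a' t = q a a' t \<oplus>\<^bsub>Q\<^esub> q b a' t"
    and "q a (a' \<oplus> b) t = q a a' t \<oplus>\<^bsub>Q\<^esub> q a b t"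
    and "q a a' (t \<oplus> b) = q a a' t \<oplus>\<^bsub>Q\<^esub> q a a' b"
  using QA.tensor_add_left[of "TA.tn a a'" "TA.tn b a'" t] QA.tensor_add_left[of "TA.tn a a'" "TA.tn a b" t]
    QA.tensor_add_right[of "TA.tn a a'" t b] assms
  by (simp_all add: Q_eq q_eq TA.tensor_add_left[symmetric] TA.tensor_add_right[symmetric])

text \<open>The element \<open>a \<otimes> a\<close> belongs to \<open>D\<close>, and multiplication
  sends it to the square of \<open>a\<close>. The outer tensor relation therefore moves it into the
  third slot. The constants in the next lemma move for the same reason.\<close>

lemma q_diag:
  assumes "a \<in> carrier A" "t \<in> carrier A"
  shows "q a a t = q \<one> \<one> (a \<otimes> a \<otimes> t)"
  using QA.tensor_balanced[OF diag_in_D(1), of a "TA.tn \<one> \<one>" t] assms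
  by (simp add: q_eq TA.tensor_mult mult_map_tensor)

lemma q_const:
  assumes "r \<in> carrier R" "t \<in> carrier A"
  shows "q (\<phi> r) \<one> t = q \<one> \<one> (\<phi> r \<otimes> t)"
  using QA.tensor_balanced[OF diag_in_D(2), of r "TA.tn \<one> \<one>" t] assms
  by (simp add: q_eq TA.tensor_mult mult_map_tensor \<phi>_in)

lemma Q_induct [consumes 1, case_names zero gen diff]:
  assumes "x \<in> carrier Q" and 0: "S \<zero>\<^bsub>Q\<^esub>"
    and gen: "\<And>a a' t. a \<in> carrier A \<Longrightarrow> a' \<in> carrier A \<Longrightarrow> t \<in> carrier A \<Longrightarrow> S (q a a' t)"
    and diff: "\<And>x y. x \<in> carrier Q \<Longrightarrow> y \<in> carrier Q \<Longrightarrow> S x \<Longrightarrow> S y \<Longrightarrow> S (x \<ominus>\<^bsub>Q\<^esub> y)"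
  shows "S x"
proof -
  have "x \<in> carrier QA.T" using assms(1) by (simp add: Q_eq)
  thus ?thesis
  proof (induction x rule: QA.tensor_induct)
    case (gen x t)
    \<comment> \<open>For fixed \<open>t\<close> the map \<open>x \<mapsto> x \<otimes> t\<close> is
      additive, so the inner induction over \<open>A \<otimes> A\<close> can form its differences in
      \<open>Q\<close>.\<close>
    have "abelian_group_hom TA.T QA.T (\<lambda>x. QA.tn x t)"
      by (rule abelian_group_homI') (use gen QA.tensor_closed[of _ t] in \<open>simp_all add: QA.tensor_add_left TT.abelian_group_axioms Q.abelian_group_axioms Q_eq\<close>)
    then interpret h: abelian_group_hom TA.T QA.T "\<lambda>x. QA.tn x t" .
    show ?case using gen(1)
    proof (induction x rule: TA.tensor_induct)
      case zero thus ?case using 0 by (simp add: Q_eq)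
    next
      case (gen a b) thus ?case using assms(3) \<open>t \<in> _\<close> by (simp add: q_eq)
    next
      case (diff x y)
      thus ?case using assms(4)[of "QA.tn x t" "QA.tn y t"] QA.tensor_closed[of _ t] \<open>t \<in> _\<close>
        by (simp add: abelian_group_hom_minus[OF h.abelian_group_hom_axioms] Q_eq)
    qed
  qed (use 0 diff in \<open>auto simp: Q_eq\<close>)
qed

abbreviation em where "em t \<equiv> q \<one> \<one> t"
abbreviation br where "br a \<equiv> q a \<one> \<one>"

lemma em_hom: "em \<in> ring_hom A Q"
  by (rule ring_hom_memI) (auto simp: q_mult q_add q_one)

lemma br_hom: "br \<in> ring_hom A Q"
  by (rule ring_hom_memI) (auto simp: q_mult q_add q_one)

lemma br_square: "a \<in> carrier A \<Longrightarrow> br a \<otimes>\<^bsub>Q\<^esub> q \<one> a \<one> = em (a \<otimes> a)"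
  using q_diag[of a "\<one>"] by (simp add: q_mult)

lemma br_const: "r \<in> carrier R \<Longrightarrow> br (\<phi> r) = em (\<phi> r)"
  by (simp add: q_const \<phi>_in)

text \<open>
  A biadditive map on \<open>A \<times> A\<close> over which squares and constants can be moved
  factors through \<open>a \<otimes> a' \<otimes> t \<mapsto> (a a', t)\<close>.
\<close>

definition shiftable :: "('c, 'k) ring_scheme \<Rightarrow> ('a \<Rightarrow> 'a \<Rightarrow> 'c) \<Rightarrow> bool" where
  "shiftable M F \<longleftrightarrow>
     (\<forall>b\<in>carrier A. \<forall>t\<in>carrier A. F b t \<in> carrier M) \<and>
     (\<forall>b\<in>carrier A. \<forall>b'\<in>carrier A. \<forall>t\<in>carrier A. F (b \<oplus> b') t = F b t \<oplus>\<^bsub>M\<^esub> F b' t) \<and>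
     (\<forall>b\<in>carrier A. \<forall>t\<in>carrier A. \<forall>t'\<in>carrier A. F b (t \<oplus> t') = F b t \<oplus>\<^bsub>M\<^esub> F b t') \<and>
     (\<forall>c\<in>carrier A. \<forall>b\<in>carrier A. \<forall>t\<in>carrier A. F (c \<otimes> c \<otimes> b) t = F b (c \<otimes> c \<otimes> t)) \<and>
     (\<forall>r\<in>carrier R. \<forall>b\<in>carrier A. \<forall>t\<in>carrier A. F (\<phi> r \<otimes> b) t = F b (\<phi> r \<otimes> t))"

text \<open>The condition over \<open>D\<close> is proved by induction on how an element of the
  subring is generated. Squares and constants are covered by shiftability, negatives and sums by
  biadditivity, products by shifting twice. The map \<open>\<beta>\<close> is kept apart from
  \<open>F\<close> because the map to differentials is given by a nested lift that only turns out to
  depend on \<open>m x\<close>.\<close>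

lemma balanced_shiftable:
  assumes M: "abelian_group M" and F: "shiftable M F"
    and \<beta>: "\<And>x t. x \<in> carrier TA.T \<Longrightarrow> t \<in> carrier A \<Longrightarrow> \<beta> x t = F (m x) t"
  shows "balanced D (\<lambda>x. x) TA.T m A M \<beta>"
proof -
  interpret M: abelian_group M by fact
  have F_closed: "F b t \<in> carrier M" if "b \<in> carrier A" "t \<in> carrier A" for b t
    using F that by (simp add: shiftable_def)
  have F_add1: "F (b \<oplus> b') t = F b t \<oplus>\<^bsub>M\<^esub> F b' t"
    if "b \<in> carrier A" "b' \<in> carrier A" "t \<in> carrier A" for b b' t
    using F that by (simp add: shiftable_def)
  have F_add2: "F b (t \<oplus> t') = F b t \<oplus>\<^bsub>M\<^esub> F b t'"
    if "b \<in> carrier A" "t \<in> carrier A" "t' \<in> carrier A" for b t t'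
    using F that by (simp add: shiftable_def)
  have hom1: "abelian_group_hom A M (\<lambda>b. F b t)" if "t \<in> carrier A" for t
    by (rule abelian_group_homI') (use that in \<open>simp_all add: F_add1 F_closed A.abelian_group_axioms M\<close>)
  have hom2: "abelian_group_hom A M (F b)" if "b \<in> carrier A" for b
    by (rule abelian_group_homI') (use that in \<open>simp_all add: F_add2 F_closed A.abelian_group_axioms M\<close>)
  have shift: "F (m r \<otimes> b) t = F b (m r \<otimes> t)"
    if "r \<in> carrier D" "b \<in> carrier A" "t \<in> carrier A" for r b t
    using that unfolding carrier_D
  proof (induction arbitrary: b t rule: generate_ring.induct)
    case one thus ?case by simp
  next
    case (incl h)
    consider c where "h = TA.tn c c" "c \<in> carrier A"
      | r where "h = TA.tn (\<phi> r) \<one>" "r \<in> carrier R"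
      using incl(1) by blast
    thus ?case
      by cases (use F incl in \<open>simp_all add: shiftable_def mult_map_tensor \<phi>_in\<close>)
  next
    case (a_inv h)
    interpret h1: abelian_group_hom A M "\<lambda>b. F b t" by (rule hom1[OF a_inv(4)])
    interpret h2: abelian_group_hom A M "F b" by (rule hom2[OF a_inv(3)])
    have "h \<in> carrier TA.T" using a_inv(1) D_closed carrier_D by blast
    thus ?case using a_inv by (simp add: A.l_minus)
  next
    case (eng_add h1 h2)
    hence "h1 \<in> carrier TA.T" "h2 \<in> carrier TA.T" using D_closed carrier_D by blast+
    thus ?case using eng_add by (simp add: A.l_distr F_add1 F_add2)
  next
    case (eng_mult h1 h2)
    hence "h1 \<in> carrier TA.T" "h2 \<in> carrier TA.T" using D_closed carrier_D by blast+
    thus ?case using eng_mult by (simp add: A.m_assoc A.m_lcomm)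
  qed
  show ?thesis
  proof (rule QA.balancedI)
    fix r x t assume r: "r \<in> carrier D" "x \<in> carrier TA.T" "t \<in> carrier A"
    hence "F (m r \<otimes> m x) t = F (m x) (m r \<otimes> t)" by (intro shift) simp_all
    thus "\<beta> (r \<otimes>\<^bsub>TA.T\<^esub> x) t = \<beta> x (m r \<otimes> t)" using r D_closed[of r] by (simp add: \<beta>)
  qed (simp_all add: \<beta> F_closed F_add1 F_add2)
qed

lemma Q_lift:
  assumes M: "abelian_group M" and F: "shiftable M F"
    and \<beta>: "\<And>x t. x \<in> carrier TA.T \<Longrightarrow> t \<in> carrier A \<Longrightarrow> \<beta> x t = F (m x) t"
  shows "abelian_group_hom Q M (tensor_lift M \<beta>)"
    and "a \<in> carrier A \<Longrightarrow> a' \<in> carrier A \<Longrightarrow> t \<in> carrier A \<Longrightarrow>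
      tensor_lift M \<beta> (q a a' t) = F (a \<otimes> a') t"
proof -
  interpret M: abelian_group M by fact
  interpret l: tensor_lifting D "\<lambda>x. x" TA.T m A M by unfold_locales
  note b = balanced_shiftable[OF M F \<beta>]
  show "abelian_group_hom Q M (tensor_lift M \<beta>)"
    using l.lift_hom[OF b] by (simp add: Q_eq)
  show "a \<in> carrier A \<Longrightarrow> a' \<in> carrier A \<Longrightarrow> t \<in> carrier A \<Longrightarrow>
      tensor_lift M \<beta> (q a a' t) = F (a \<otimes> a') t"
    using l.lift_tensor[OF b, of "TA.tn a a'" t] by (simp add: q_eq \<beta> mult_map_tensor)
qed

end

section \<open>Consequences of characteristic 2\<close>

locale Q_char2 = Q_algebra +
  assumes two: "\<one> \<oplus> \<one> = \<zero>"
begin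

lemma A_double: "a \<in> carrier A \<Longrightarrow> a \<oplus> a = \<zero>"
  using A.l_distr[of "\<one>" "\<one>" a] two by simp

lemma A_minus: "a \<in> carrier A \<Longrightarrow> \<ominus> a = a"
  using A_double[of a] by (simp add: A.minus_equality)

lemma Q_double:
  assumes "x \<in> carrier Q"
  shows "x \<oplus>\<^bsub>Q\<^esub> x = \<zero>\<^bsub>Q\<^esub>"
proof -
  have "\<one>\<^bsub>Q\<^esub> \<oplus>\<^bsub>Q\<^esub> \<one>\<^bsub>Q\<^esub> = em (\<one> \<oplus> \<one>)" by (simp add: q_add q_one)
  also have "\<dots> = \<zero>\<^bsub>Q\<^esub>" by (simp only: two ring_hom_zero[OF em_hom A.ring_axioms Q.ring_axioms])
  finally show ?thesis using Q.l_distr[of "\<one>\<^bsub>Q\<^esub>" "\<one>\<^bsub>Q\<^esub>" x] assms by simp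
qed

lemma Q_minus: "x \<in> carrier Q \<Longrightarrow> \<ominus>\<^bsub>Q\<^esub> x = x"
  using Q_double[of x] by (simp add: Q.minus_equality)

text \<open>Expand \<open>(a + 1) \<otimes> (a + 1) = a \<otimes> a + a \<otimes> 1 + 1 \<otimes> a + 1 \<otimes> 1\<close>.\<close>

lemma br_swap:
  assumes a: "a \<in> carrier A"
  shows "q \<one> a \<one> = br a"
proof -
  let ?b = "a \<oplus> \<one>"
  have "?b \<otimes> ?b = a \<otimes> a \<oplus> ((a \<oplus> a) \<oplus> \<one>)"
    using a by (simp add: A.l_distr A.r_distr A.a_ac)
  hence "?b \<otimes> ?b = a \<otimes> a \<oplus> \<one>"
    using a by (simp add: A_double)
  hence "q ?b ?b \<one> = q a a \<one> \<oplus>\<^bsub>Q\<^esub> \<one>\<^bsub>Q\<^esub>"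
    using q_diag[of ?b "\<one>"] q_diag[of a "\<one>"] a by (simp add: q_add q_one)
  moreover have "q ?b ?b \<one> = q a a \<one> \<oplus>\<^bsub>Q\<^esub> q \<one> a \<one> \<oplus>\<^bsub>Q\<^esub> (br a \<oplus>\<^bsub>Q\<^esub> \<one>\<^bsub>Q\<^esub>)"
    using a by (simp add: q_add q_one)
  hence "q ?b ?b \<one> = q a a \<one> \<oplus>\<^bsub>Q\<^esub> \<one>\<^bsub>Q\<^esub> \<oplus>\<^bsub>Q\<^esub> (q \<one> a \<one> \<oplus>\<^bsub>Q\<^esub> br a)"
    using a by (simp add: Q.a_ac)
  ultimately have "q \<one> a \<one> \<oplus>\<^bsub>Q\<^esub> br a = \<zero>\<^bsub>Q\<^esub>"
    using a Q.r_neg1[of "q a a \<one> \<oplus>\<^bsub>Q\<^esub> \<one>\<^bsub>Q\<^esub>" "q \<one> a \<one> \<oplus>\<^bsub>Q\<^esub> br a"]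
      Q.l_neg[of "q a a \<one> \<oplus>\<^bsub>Q\<^esub> \<one>\<^bsub>Q\<^esub>"] by simp
  thus ?thesis using a Q.minus_equality[of "q \<one> a \<one>" "br a"] by (simp add: Q_minus)
qed

lemma q_eq_br: 
  assumes "a \<in> carrier A" "a' \<in> carrier A" "t \<in> carrier A"
  shows "q a a' t = br (a \<otimes> a') \<otimes>\<^bsub>Q\<^esub> em t"
proof -
  have "q a a' t = br a \<otimes>\<^bsub>Q\<^esub> q \<one> a' \<one> \<otimes>\<^bsub>Q\<^esub> em t" using assms by (simp add: q_mult)
  thus ?thesis using assms ring_hom_mult[OF br_hom, of a a'] by (simp add: br_swap)
qed

lemma br_sq: "a \<in> carrier A \<Longrightarrow> br a \<otimes>\<^bsub>Q\<^esub> br a = em (a \<otimes> a)"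
  using br_square[of a] by (simp add: br_swap)

end

section \<open>Derivations on rational functions\<close>

lemma poly_mapping_sum_singles: "p = (\<Sum>x\<in>Poly_Mapping.keys p. Poly_Mapping.single x (Poly_Mapping.lookup p x))"
  by (rule poly_mapping_eqI)
    (auto simp: lookup_sum lookup_single when_def sum.delta[OF finite_keys] in_keys_iff)

lemma poly_mapping_induct_add [consumes 1, case_names zero single add]:
  fixes p :: "'a \<Rightarrow>\<^sub>0 'b :: comm_monoid_add"
  assumes "Poly_Mapping.keys p \<subseteq> S" and 0: "P 0"
    and single: "\<And>x c. x \<in> S \<Longrightarrow> P (Poly_Mapping.single x c)"
    and add: "\<And>p q. P p \<Longrightarrow> P q \<Longrightarrow> P (p + q)"
  shows "P p"
proof -
  have "P (\<Sum>x\<in>Y. Poly_Mapping.single x (Poly_Mapping.lookup p x))" if "finite Y" "Y \<subseteq> S" for Y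
    using that by (induction Y rule: finite_induct) (auto intro: 0 single add)
  thus ?thesis using poly_mapping_sum_singles[of p] assms(1) finite_keys[of p] by metis
qed

lemma sum_keys_add:
  fixes p q :: "'a \<Rightarrow>\<^sub>0 'b :: comm_monoid_add" and f :: "'a \<Rightarrow> 'b \<Rightarrow> 'c :: comm_monoid_add"
  assumes 0: "\<And>x. f x 0 = 0" and add: "\<And>x a b. f x (a + b) = f x a + f x b"
  shows "(\<Sum>x\<in>Poly_Mapping.keys (p + q). f x (Poly_Mapping.lookup (p + q) x)) =
    (\<Sum>x\<in>Poly_Mapping.keys p. f x (Poly_Mapping.lookup p x)) +
    (\<Sum>x\<in>Poly_Mapping.keys q. f x (Poly_Mapping.lookup q x))"
proof -
  let ?Y = "Poly_Mapping.keys p \<union> Poly_Mapping.keys q"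
  have *: "(\<Sum>x\<in>Poly_Mapping.keys r. f x (Poly_Mapping.lookup r x)) =
      (\<Sum>x\<in>?Y. f x (Poly_Mapping.lookup r x))" if "Poly_Mapping.keys r \<subseteq> ?Y" for r
    by (rule sum.mono_neutral_left) (use that 0 in \<open>auto simp: in_keys_iff\<close>)
  show ?thesis
    unfolding *[OF keys_add] *[OF Un_upper1] *[OF Un_upper2]
    by (simp add: lookup_add add sum.distrib)
qed

text \<open>Subtraction of exponents truncates at 0. This affects only monomials in which variable
  \<open>i\<close> does not occur, and their coefficient is multiplied by 0.\<close>

definition poly_deriv :: "nat \<Rightarrow> 'k::field mpoly \<Rightarrow> 'k mpoly" where
  "poly_deriv i p = (\<Sum>m\<in>Poly_Mapping.keys p.
     Poly_Mapping.single (m - Poly_Mapping.single i 1)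
       (of_nat (Poly_Mapping.lookup m i) * Poly_Mapping.lookup p m))"

lemma poly_deriv_add: "poly_deriv i (p + q) = poly_deriv i p + poly_deriv i q"
  unfolding poly_deriv_def by (rule sum_keys_add) (simp_all add: algebra_simps single_add)

lemma poly_deriv_0 [simp]: "poly_deriv i 0 = 0"
  by (simp add: poly_deriv_def)

lemma poly_deriv_single:
  "poly_deriv i (Poly_Mapping.single m c) =
     Poly_Mapping.single (m - Poly_Mapping.single i 1) (of_nat (Poly_Mapping.lookup m i) * c)"
  by (simp add: poly_deriv_def)

lemma poly_deriv_mult: "poly_deriv i (p * q) = poly_deriv i p * q + p * poly_deriv i q"
proof -
  have ms: "poly_deriv i (Poly_Mapping.single m c * Poly_Mapping.single m' c') =
      poly_deriv i (Poly_Mapping.single m c) * Poly_Mapping.single m' c' +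
      Poly_Mapping.single m c * poly_deriv i (Poly_Mapping.single m' c')"
    for m m' :: "nat \<Rightarrow>\<^sub>0 nat" and c c' :: 'a
  proof -
    let ?e = "Poly_Mapping.single i (1 :: nat)"
    \<comment> \<open>Truncated subtraction can be moved across the sum only if variable
      \<open>i\<close> occurs in \<open>a\<close>. In the other case the factor
      \<open>of_nat 0\<close> makes both sides of the equations below zero.\<close>
    have shift: "a - ?e + b = a + b - ?e" if "Poly_Mapping.lookup a i \<noteq> 0" for a b :: "nat \<Rightarrow>\<^sub>0 nat"
      by (rule poly_mapping_eqI) (use that in \<open>auto simp: lookup_add lookup_minus lookup_single when_def\<close>)
    have 1: "Poly_Mapping.single (m - ?e + m') (of_nat (Poly_Mapping.lookup m i) * c * c') =
        Poly_Mapping.single (m + m' - ?e) (of_nat (Poly_Mapping.lookup m i) * c * c')"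
      using shift[of m m'] by (cases "Poly_Mapping.lookup m i = 0") (simp_all del: One_nat_def)
    have 2: "Poly_Mapping.single (m + (m' - ?e)) (c * (of_nat (Poly_Mapping.lookup m' i) * c')) =
        Poly_Mapping.single (m + m' - ?e) (c * (of_nat (Poly_Mapping.lookup m' i) * c'))"
      using shift[of m' m] by (cases "Poly_Mapping.lookup m' i = 0") (simp_all add: add.commute del: One_nat_def)
    show ?thesis
      unfolding mult_single poly_deriv_single 1 2 single_add[symmetric] lookup_add
      by (simp add: algebra_simps)
  qed
  have "Poly_Mapping.keys p \<subseteq> UNIV" "Poly_Mapping.keys q \<subseteq> UNIV" by auto
  thus ?thesis
  proof (induction p rule: poly_mapping_induct_add)
    case (single m c)
    show ?case using single(2)
      by (induction q rule: poly_mapping_induct_add) (simp_all add: ms poly_deriv_add algebra_simps)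
  qed (simp_all add: poly_deriv_add algebra_simps)
qed

text \<open>This is the independence of the quotient rule from the chosen fraction:
  \<open>eq\<close> says that \<open>a/b\<close> and \<open>a'/b'\<close> are equal,
  \<open>deq\<close> is its derivative by the Leibniz rule, and the conclusion compares the two
  quotient-rule fractions with denominators cleared.\<close>

lemma quotient_rule_unique:
  fixes a b a' b' :: "'a :: comm_ring_1"
  assumes eq: "a * b' = a' * b" and deq: "da * b' + a * db' = da' * b + a' * db"
  shows "(da * b - a * db) * (b' * b') = (da' * b' - a' * db') * (b * b)"
proof -
  have "(da * b - a * db) * (b' * b') = b * b' * (da * b' + a * db') - (a * b') * (db' * b) - (a * b') * (db * b')"
    by (simp add: algebra_simps)
  also have "\<dots> = (da' * b' - a' * db') * (b * b)"
    unfolding eq deq by (simp add: algebra_simps)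
  finally show ?thesis .
qed

text \<open>The description ranges over all representing fractions of \<open>x\<close>;
  \<open>quotient_rule_unique\<close> shows that they give one value.\<close>

definition rat_deriv :: "nat \<Rightarrow> 'k::field ratfun \<Rightarrow> 'k ratfun" where
  "rat_deriv i x = (THE y. \<exists>a b. b \<noteq> 0 \<and> x = Fract a b \<and>
     y = Fract (poly_deriv i a * b - a * poly_deriv i b) (b * b))"

lemma rat_deriv_Fract:
  assumes "b \<noteq> 0"
  shows "rat_deriv i (Fract a b) = Fract (poly_deriv i a * b - a * poly_deriv i b) (b * b)"
  unfolding rat_deriv_def
proof (rule the_equality)
  fix y assume "\<exists>a' b'. b' \<noteq> 0 \<and> Fract a b = Fract a' b' \<and>
     y = Fract (poly_deriv i a' * b' - a' * poly_deriv i b') (b' * b')"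
  then obtain a' b' where *: "b' \<noteq> 0" "Fract a b = Fract a' b'"
    "y = Fract (poly_deriv i a' * b' - a' * poly_deriv i b') (b' * b')" by blast
  hence eq: "a * b' = a' * b" using assms by (simp add: eq_fract)
  have "poly_deriv i a * b' + a * poly_deriv i b' = poly_deriv i a' * b + a' * poly_deriv i b"
    unfolding poly_deriv_mult[symmetric] eq ..
  with eq have "(poly_deriv i a * b - a * poly_deriv i b) * (b' * b') =
      (poly_deriv i a' * b' - a' * poly_deriv i b') * (b * b)"
    by (rule quotient_rule_unique)
  thus "y = Fract (poly_deriv i a * b - a * poly_deriv i b) (b * b)"
    using * assms by (simp add: eq_fract)
qed (use assms in blast)

lemma rat_deriv_add: "rat_deriv i (x + y) = rat_deriv i x + rat_deriv i y"
proof (cases x; cases y)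
  fix a b c d assume "x = Fract a b" "b \<noteq> 0" "y = Fract c d" "d \<noteq> 0"
  thus ?thesis
    by (simp add: rat_deriv_Fract eq_fract poly_deriv_add poly_deriv_mult algebra_simps)
qed

lemma rat_deriv_mult: "rat_deriv i (x * y) = rat_deriv i x * y + x * rat_deriv i y"
proof (cases x; cases y)
  fix a b c d assume "x = Fract a b" "b \<noteq> 0" "y = Fract c d" "d \<noteq> 0"
  thus ?thesis
    by (simp add: rat_deriv_Fract eq_fract poly_deriv_mult algebra_simps)
qed

lemma rat_deriv_0 [simp]: "rat_deriv i 0 = 0"
  using rat_deriv_add[of i 0 0] by (metis add_cancel_right_right)

lemma rat_deriv_const [simp]: "rat_deriv i (ratfun_const c) = 0"
proof -
  have "poly_deriv i (mpoly_const d) = 0" for d :: 'a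
    by (simp add: mpoly_const_def poly_deriv_single)
  from this[of c] this[of 1] have "poly_deriv i (mpoly_const c) = 0" "poly_deriv i (1 :: 'a mpoly) = 0"
    by (simp_all add: mpoly_const_def)
  thus ?thesis by (simp add: ratfun_const_def rat_deriv_Fract fract_collapse)
qed

lemma rat_deriv_var: "rat_deriv i (ratfun_var j :: 'k::field ratfun) = (if i = j then 1 else 0)"
proof -
  have "poly_deriv i (mpoly_var j :: 'k mpoly) = (if i = j then 1 else 0)"
    by (simp add: mpoly_var_def poly_deriv_single lookup_single when_def)
  moreover have "poly_deriv i (1 :: 'k mpoly) = 0"
    using poly_deriv_single[of i 0 "1::'k"] by simp
  ultimately show ?thesis by (simp add: ratfun_var_def rat_deriv_Fract fract_collapse)
qed

section \<open>Polynomials and rational functions in n variables as subrings\<close>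

lemma ring_of_type_simps [simp]:
  "carrier ring_of_type_algebra = UNIV"
  "x \<otimes>\<^bsub>ring_of_type_algebra\<^esub> y = x * y"
  "x \<oplus>\<^bsub>ring_of_type_algebra\<^esub> y = x + y"
  "\<one>\<^bsub>ring_of_type_algebra\<^esub> = 1" "\<zero>\<^bsub>ring_of_type_algebra\<^esub> = 0"
  by (simp_all add: ring_of_type_algebra_def)

lemma subring_of_type_cring:
  fixes S :: "'a :: comm_ring_1 set"
  assumes "1 \<in> S" "\<And>x y. x \<in> S \<Longrightarrow> y \<in> S \<Longrightarrow> x - y \<in> S" "\<And>x y. x \<in> S \<Longrightarrow> y \<in> S \<Longrightarrow> x * y \<in> S"
  shows "cring (ring_of_type_algebra\<lparr>carrier := S\<rparr>)"
proof -
  have 0: "0 \<in> S" using assms(2)[OF assms(1) assms(1)] by simp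
  have minus: "- x \<in> S" if "x \<in> S" for x using assms(2)[OF 0 that] by simp
  have add: "x + y \<in> S" if "x \<in> S" "y \<in> S" for x y using assms(2)[OF that(1) minus[OF that(2)]] by simp
  show ?thesis
  proof (rule cringI)
    show "abelian_group (ring_of_type_algebra\<lparr>carrier := S\<rparr>)"
      by (rule abelian_groupI) (use 0 add minus in \<open>auto simp: algebra_simps intro!: bexI[of _ "- _"]\<close>)
    show "comm_monoid (ring_of_type_algebra\<lparr>carrier := S\<rparr>)"
      by (rule comm_monoidI) (use assms in \<open>auto simp: algebra_simps\<close>)
  qed (simp add: algebra_simps)
qed

lemma mpoly_carrier: "p \<in> carrier (mpoly_ring n) \<longleftrightarrow> (\<forall>m\<in>Poly_Mapping.keys p. Poly_Mapping.keys m \<subseteq> {1..n})"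
  by (simp add: mpoly_ring_def)

lemma mpoly_closed:
  "mpoly_const c \<in> carrier (mpoly_ring n)"
  "i \<in> {1..n} \<Longrightarrow> mpoly_var i \<in> carrier (mpoly_ring n)"
  "p \<in> carrier (mpoly_ring n) \<Longrightarrow> q \<in> carrier (mpoly_ring n) \<Longrightarrow> p + q \<in> carrier (mpoly_ring n)"
  "p \<in> carrier (mpoly_ring n) \<Longrightarrow> q \<in> carrier (mpoly_ring n) \<Longrightarrow> p - q \<in> carrier (mpoly_ring n)"
  "p \<in> carrier (mpoly_ring n) \<Longrightarrow> q \<in> carrier (mpoly_ring n) \<Longrightarrow> p * q \<in> carrier (mpoly_ring n)"
  "1 \<in> carrier (mpoly_ring n)" "0 \<in> carrier (mpoly_ring n)"
  "p \<in> carrier (mpoly_ring n) \<Longrightarrow> poly_deriv i p \<in> carrier (mpoly_ring n)"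
proof -
  assume p: "p \<in> carrier (mpoly_ring n)"
  have shrink: "Poly_Mapping.keys (m - Poly_Mapping.single i 1) \<subseteq> Poly_Mapping.keys m" for m :: "nat \<Rightarrow>\<^sub>0 nat"
    by (auto simp: in_keys_iff lookup_minus)
  show "poly_deriv i p \<in> carrier (mpoly_ring n)"
    unfolding mpoly_carrier
  proof
    fix m assume "m \<in> Poly_Mapping.keys (poly_deriv i p)"
    then obtain m' where m': "m' \<in> Poly_Mapping.keys p" "m \<in> Poly_Mapping.keys
        (Poly_Mapping.single (m' - Poly_Mapping.single i 1) (of_nat (Poly_Mapping.lookup m' i) * Poly_Mapping.lookup p m'))"
      unfolding poly_deriv_def using keys_sum by (metis (no_types, lifting) UN_E subsetD)
    hence "m = m' - Poly_Mapping.single i 1" by (simp split: if_splits)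
    thus "Poly_Mapping.keys m \<subseteq> {1..n}" using p m'(1) shrink[of m'] unfolding mpoly_carrier by blast
  qed
next
  assume p: "p \<in> carrier (mpoly_ring n)" and q: "q \<in> carrier (mpoly_ring n)"
  show "p + q \<in> carrier (mpoly_ring n)" using p q keys_add[of p q] unfolding mpoly_carrier by blast
  show "p - q \<in> carrier (mpoly_ring n)"
  proof -
    have "Poly_Mapping.keys (p - q) \<subseteq> Poly_Mapping.keys p \<union> Poly_Mapping.keys q"
      by (auto simp: in_keys_iff lookup_minus)
    thus ?thesis using p q unfolding mpoly_carrier by blast
  qed
  show "p * q \<in> carrier (mpoly_ring n)"
    unfolding mpoly_carrier
  proof
    fix m assume "m \<in> Poly_Mapping.keys (p * q)"
    then obtain a b where "a \<in> Poly_Mapping.keys p" "b \<in> Poly_Mapping.keys q" "m = a + b"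
      using keys_mult[of p q] by blast
    thus "Poly_Mapping.keys m \<subseteq> {1..n}" using p q keys_add[of a b] unfolding mpoly_carrier by blast
  qed
qed (auto simp: mpoly_carrier mpoly_const_def mpoly_var_def)

lemma mpoly_cring: "cring (mpoly_ring n)"
proof -
  have "cring (ring_of_type_algebra\<lparr>carrier := carrier (mpoly_ring n)\<rparr>)"
    by (rule subring_of_type_cring) (simp_all add: mpoly_closed)
  thus ?thesis by (simp add: mpoly_ring_def)
qed

lemma mpoly_simps [simp]:
  "p \<otimes>\<^bsub>mpoly_ring n\<^esub> q = p * q" "p \<oplus>\<^bsub>mpoly_ring n\<^esub> q = p + q"
  "\<one>\<^bsub>mpoly_ring n\<^esub> = 1" "\<zero>\<^bsub>mpoly_ring n\<^esub> = 0"
  by (simp_all add: mpoly_ring_def)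

lemma mpoly_induct [consumes 1, case_names const var add mult]:
  fixes p :: "'k::field mpoly"
  assumes "p \<in> carrier (mpoly_ring n)"
    and const: "\<And>c. P (mpoly_const c)" and var: "\<And>i. i \<in> {1..n} \<Longrightarrow> P (mpoly_var i)"
    and add: "\<And>p q. p \<in> carrier (mpoly_ring n) \<Longrightarrow> q \<in> carrier (mpoly_ring n) \<Longrightarrow> P p \<Longrightarrow> P q \<Longrightarrow> P (p + q)"
    and mult: "\<And>p q. p \<in> carrier (mpoly_ring n) \<Longrightarrow> q \<in> carrier (mpoly_ring n) \<Longrightarrow> P p \<Longrightarrow> P q \<Longrightarrow> P (p * q)"
  shows "P p"
proof -
  \<comment> \<open>Bundling membership with \<open>P\<close> lets single powers, monomials and
    polynomials be assembled by the same two closure rules.\<close>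
  define G where "G p \<longleftrightarrow> p \<in> carrier (mpoly_ring n) \<and> P p" for p
  have G: "G (mpoly_const c)" "i \<in> {1..n} \<Longrightarrow> G (mpoly_var i)"
    "G p \<Longrightarrow> G q \<Longrightarrow> G (p + q)" "G p \<Longrightarrow> G q \<Longrightarrow> G (p * q)" for c i p q
    using assms(2-) by (auto simp: G_def mpoly_closed)
  have pow: "G (Poly_Mapping.single (Poly_Mapping.single i k) 1)" if "i \<in> {1..n}" for i k
  proof (induction k)
    case 0 thus ?case using G(1)[of 1] by (simp add: mpoly_const_def)
  next
    case (Suc k)
    have "Poly_Mapping.single (Poly_Mapping.single i (Suc k)) 1 =
        mpoly_var i * Poly_Mapping.single (Poly_Mapping.single i k) (1 :: 'k)"
      by (simp add: mpoly_var_def mult_single single_add[symmetric])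
    thus ?case using G(4)[OF G(2)[OF that] Suc] by simp
  qed
  have mon: "G (Poly_Mapping.single m 1)" if "Poly_Mapping.keys m \<subseteq> {1..n}" for m
    using that
  proof (induction m rule: poly_mapping_induct_add)
    case zero thus ?case using G(1)[of 1] by (simp add: mpoly_const_def)
  next
    case (add m m')
    thus ?case using G(4)[OF add] by (simp add: mult_single)
  qed (rule pow)
  have "Poly_Mapping.keys p \<subseteq> {m. Poly_Mapping.keys m \<subseteq> {1..n}}"
    using assms(1) by (auto simp: mpoly_carrier)
  hence "G p"
  proof (induction p rule: poly_mapping_induct_add)
    case zero thus ?case using G(1)[of 0] by (simp add: mpoly_const_def)
  next
    case (single m c)
    thus ?case using G(4)[OF G(1)[of c] mon[of m]] by (simp add: mpoly_const_def mult_single)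
  qed (rule G(3))
  thus ?thesis by (simp add: G_def)
qed

lemma ratfun_simps [simp]:
  "p \<otimes>\<^bsub>ratfun_field n\<^esub> q = p * q" "p \<oplus>\<^bsub>ratfun_field n\<^esub> q = p + q"
  "\<one>\<^bsub>ratfun_field n\<^esub> = 1" "\<zero>\<^bsub>ratfun_field n\<^esub> = 0"
  by (simp_all add: ratfun_field_def)

lemma ratfun_carrier:
  "x \<in> carrier (ratfun_field n) \<longleftrightarrow>
    (\<exists>p q. x = Fract p q \<and> p \<in> carrier (mpoly_ring n) \<and> q \<in> carrier (mpoly_ring n) \<and> q \<noteq> 0)"
  by (auto simp: ratfun_field_def)

lemma Fract_closed:
  "p \<in> carrier (mpoly_ring n) \<Longrightarrow> q \<in> carrier (mpoly_ring n) \<Longrightarrow> q \<noteq> 0 \<Longrightarrow> Fract p q \<in> carrier (ratfun_field n)"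
  by (auto simp: ratfun_carrier)

lemma ratfun_closed:
  "ratfun_const c \<in> carrier (ratfun_field n)"
  "i \<in> {1..n} \<Longrightarrow> ratfun_var i \<in> carrier (ratfun_field n)"
  "1 \<in> carrier (ratfun_field n)" "0 \<in> carrier (ratfun_field n)"
  by (simp_all add: ratfun_const_def ratfun_var_def Fract_closed mpoly_closed One_fract_def Zero_fract_def)

lemma ratfun_closed2:
  assumes "x \<in> carrier (ratfun_field n)" "y \<in> carrier (ratfun_field n)"
  shows "x + y \<in> carrier (ratfun_field n)" "x - y \<in> carrier (ratfun_field n)"
    "x * y \<in> carrier (ratfun_field n)" "inverse x \<in> carrier (ratfun_field n)"
    "rat_deriv i x \<in> carrier (ratfun_field n)"
proof -
  from assms obtain p q r s where *: "x = Fract p q" "y = Fract r s" "q \<noteq> 0" "s \<noteq> 0"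
    "p \<in> carrier (mpoly_ring n)" "q \<in> carrier (mpoly_ring n)"
    "r \<in> carrier (mpoly_ring n)" "s \<in> carrier (mpoly_ring n)"
    unfolding ratfun_carrier by blast
  thus "x + y \<in> carrier (ratfun_field n)" "x - y \<in> carrier (ratfun_field n)"
    "x * y \<in> carrier (ratfun_field n)" "rat_deriv i x \<in> carrier (ratfun_field n)"
    by (simp_all add: rat_deriv_Fract Fract_closed mpoly_closed)
  show "inverse x \<in> carrier (ratfun_field n)"
  proof (cases "p = 0")
    case True
    thus ?thesis using * by (simp add: fract_collapse ratfun_closed)
  qed (use * in \<open>simp add: Fract_closed\<close>)
qed

lemma ratfun_cring: "cring (ratfun_field n)"
proof -
  have "cring (ring_of_type_algebra\<lparr>carrier := carrier (ratfun_field n)\<rparr>)"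
    by (rule subring_of_type_cring) (simp_all add: ratfun_closed ratfun_closed2)
  thus ?thesis by (simp add: ratfun_field_def)
qed

lemma ratfun_is_field: "field (ratfun_field n)"
proof -
  interpret cring "ratfun_field n" by (rule ratfun_cring)
  show ?thesis
  proof (rule cring_fieldI2)
    fix a assume "a \<in> carrier (ratfun_field n)" "a \<noteq> \<zero>\<^bsub>ratfun_field n\<^esub>"
    thus "\<exists>b\<in>carrier (ratfun_field n). a \<otimes>\<^bsub>ratfun_field n\<^esub> b = \<one>\<^bsub>ratfun_field n\<^esub>"
      by (intro bexI[of _ "inverse a"]) (simp_all add: ratfun_closed2(4))
  qed simp
qed

text \<open>A fraction is a polynomial times the inverse of another. Inversion is a separate case
  because each application handles it by its own argument: uniqueness of inverses for homomorphisms,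
  differentiation of \<open>x * inverse x = 1\<close> for differentials, and multiplication by an
  inverse square in \<open>Q\<close>.\<close>

lemma ratfun_induct [consumes 1, case_names const var add mult inverse]:
  fixes x :: "'k::field ratfun"
  assumes "x \<in> carrier (ratfun_field n)"
    and const: "\<And>c. P (ratfun_const c)" and var: "\<And>i. i \<in> {1..n} \<Longrightarrow> P (ratfun_var i)"
    and add: "\<And>x y. x \<in> carrier (ratfun_field n) \<Longrightarrow> y \<in> carrier (ratfun_field n) \<Longrightarrow> P x \<Longrightarrow> P y \<Longrightarrow> P (x + y)"
    and mult: "\<And>x y. x \<in> carrier (ratfun_field n) \<Longrightarrow> y \<in> carrier (ratfun_field n) \<Longrightarrow> P x \<Longrightarrow> P y \<Longrightarrow> P (x * y)"
    and inv: "\<And>x. x \<in> carrier (ratfun_field n) \<Longrightarrow> x \<noteq> 0 \<Longrightarrow> P x \<Longrightarrow> P (inverse x)"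
  shows "P x"
proof -
  have poly: "P (Fract p 1)" if "p \<in> carrier (mpoly_ring n)" for p
    using that
  proof (induction p rule: mpoly_induct)
    case (const c) thus ?case using assms(2)[of c] by (simp add: ratfun_const_def)
  next
    case (var i) thus ?case using assms(3)[of i] by (simp add: ratfun_var_def)
  next
    case (add p q) thus ?case using assms(4)[of "Fract p 1" "Fract q 1"] by (simp add: Fract_closed mpoly_closed)
  next
    case (mult p q) thus ?case using assms(5)[of "Fract p 1" "Fract q 1"] by (simp add: Fract_closed mpoly_closed)
  qed
  obtain p q where x: "x = Fract p q" "p \<in> carrier (mpoly_ring n)" "q \<in> carrier (mpoly_ring n)" "q \<noteq> 0"
    using assms(1) ratfun_carrier by blast
  have "x = Fract p 1 * inverse (Fract q 1)" by (simp add: x)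
  moreover have "Fract q 1 \<noteq> 0" using x(4) by (simp add: Zero_fract_def eq_fract)
  ultimately show ?thesis
    using x mult[of "Fract p 1" "inverse (Fract q 1)"] inv[of "Fract q 1"] poly
    by (simp add: Fract_closed mpoly_closed)
qed

lemma ratfun_const_hom: "ratfun_const \<in> ring_hom ring_of_type_algebra (ratfun_field n)"
proof (rule ring_hom_memI)
  show "ratfun_const c \<in> carrier (ratfun_field n)" for c by (rule ratfun_closed)
qed (simp_all add: ratfun_const_def mpoly_const_def mult_single single_add One_fract_def)

section \<open>Characteristic 2 and mixed partial derivatives\<close>

lemma ratfun_double:
  fixes x :: "'k::field ratfun"
  assumes "CHAR('k) = 2"
  shows "x + x = 0"
proof -
  have "(2 :: 'k) = 0" using of_nat_CHAR[where 'a = 'k] assms by simp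
  hence "(2 :: 'k mpoly) = 0" by (metis single_numeral single_zero)
  hence "(1 :: 'k ratfun) + 1 = 0" by (simp add: One_fract_def Zero_fract_def del: one_add_one)
  thus ?thesis using distrib_right[of 1 1 x] by (simp del: one_add_one)
qed

text \<open>The partial derivatives with index in \<open>S\<close> are applied once each, in
  increasing order of the index. The cut-off \<open>k\<close> carries the inductions; the operator
  that acts on \<open>Q\<close> has \<open>k = n\<close>.\<close>

fun multi_deriv :: "nat \<Rightarrow> nat set \<Rightarrow> 'k::field ratfun \<Rightarrow> 'k ratfun" where
  "multi_deriv 0 S x = x"
| "multi_deriv (Suc k) S x =
     (if Suc k \<in> S then rat_deriv (Suc k) (multi_deriv k S x) else multi_deriv k S x)"

lemma multi_deriv_add: "multi_deriv k S (x + y) = multi_deriv k S x + multi_deriv k S y"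
  by (induction k) (simp_all add: rat_deriv_add)

lemma multi_deriv_closed:
  "x \<in> carrier (ratfun_field n) \<Longrightarrow> multi_deriv k S x \<in> carrier (ratfun_field n)"
  by (induction k) (simp_all add: ratfun_closed2)

text \<open>Elements killed by every partial derivative behave like scalars. Constants are of this
  kind, and in characteristic 2 squares are too, which is the linearity that shiftability asks
  for.\<close>

lemma multi_deriv_linear:
  assumes "\<And>i. rat_deriv i c = 0"
  shows "multi_deriv k S (c * x) = c * multi_deriv k S x"
  by (induction k) (simp_all add: rat_deriv_mult assms)

lemma rat_deriv_square:
  fixes c :: "'k::field ratfun"
  assumes "CHAR('k) = 2"
  shows "rat_deriv i (c * c) = 0"
  using ratfun_double[OF assms, of "c * rat_deriv i c"] by (simp add: rat_deriv_mult mult.commute)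

lemma multi_deriv_1: "multi_deriv k S 1 = (if S \<inter> {1..k} = {} then 1 else 0)"
proof (induction k)
  case (Suc k)
  have "rat_deriv (Suc k) (1 :: 'a ratfun) = 0"
    using rat_deriv_mult[of "Suc k" "1 :: 'a ratfun" 1] by (metis add_cancel_right_right mult_1 mult_1_right)
  thus ?case using Suc by (auto simp: atLeastAtMostSuc_conv)
qed simp

lemma multi_deriv_cong: "S \<inter> {1..k} = S' \<inter> {1..k} \<Longrightarrow> multi_deriv k S x = multi_deriv k S' x"
proof (induction k)
  case (Suc k)
  hence *: "i \<in> S \<longleftrightarrow> i \<in> S'" if "i \<in> {1..Suc k}" for i using that by blast
  hence "S \<inter> {1..k} = S' \<inter> {1..k}" by auto
  thus ?case using Suc.IH *[of "Suc k"] by simp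
qed simp

text \<open>In characteristic 2 the left-hand side is the commutator of \<open>\<partial>\<^sub>S\<close> with multiplication by \<open>T\<^sub>i\<close>.\<close>

lemma multi_deriv_commutator:
  fixes x :: "'k::field ratfun"
  assumes char: "CHAR('k) = 2" and "i \<ge> 1"
  shows "multi_deriv k S (ratfun_var i * x) + ratfun_var i * multi_deriv k S x =
    (if i \<in> S \<and> i \<le> k then multi_deriv k (S - {i}) x else 0)"
proof (induction k)
  case 0 thus ?case using ratfun_double[OF char, of "ratfun_var i * x"] \<open>i \<ge> 1\<close> by simp
next
  case (Suc k)
  let ?T = "ratfun_var i :: 'k ratfun" and ?d = "rat_deriv (Suc k)"
  note d2 = ratfun_double[OF char]
  have eq: "multi_deriv k S (?T * x) =
      ?T * multi_deriv k S x + (if i \<in> S \<and> i \<le> k then multi_deriv k (S - {i}) x else 0)"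
    unfolding Suc[symmetric] using d2[of "?T * multi_deriv k S x"] by (simp add: algebra_simps)
  show ?case
  proof (cases "Suc k \<in> S")
    case True
    let ?M = "multi_deriv k S x" and ?C = "if i \<in> S \<and> i \<le> k then multi_deriv k (S - {i}) x else 0"
    have "?d (multi_deriv k S (?T * x)) + ?T * ?d ?M = ?d ?T * ?M + ?d ?C + (?T * ?d ?M + ?T * ?d ?M)"
      by (simp only: eq rat_deriv_add rat_deriv_mult add_ac)
    also have "\<dots> = (if Suc k = i then ?M else 0) + ?d ?C"
      unfolding d2 by (simp add: rat_deriv_var)
    finally have *: "?d (multi_deriv k S (?T * x)) + ?T * ?d ?M = (if Suc k = i then ?M else 0) + ?d ?C" .
    show ?thesis
    proof (cases "Suc k = i")
      case i: True
      have "?M = multi_deriv k (S - {i}) x"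
        by (rule multi_deriv_cong) (use i in auto)
      with * show ?thesis using True i by auto
    next
      case False
      with * True show ?thesis by (simp add: le_Suc_eq)
    qed
  next
    case False
    thus ?thesis using Suc by (auto simp: le_Suc_eq)
  qed
qed

section \<open>Vector spaces, quotient modules and differentials\<close>

lemma abelian_group_hom_finsum:
  assumes h: "abelian_group_hom G H h" and "finite Y" "\<And>y. y \<in> Y \<Longrightarrow> f y \<in> carrier G"
  shows "h (\<Oplus>\<^bsub>G\<^esub>y\<in>Y. f y) = (\<Oplus>\<^bsub>H\<^esub>y\<in>Y. h (f y))"
proof -
  interpret h: abelian_group_hom G H h by (rule h)
  show ?thesis using assms(2,3)
    by (induction Y rule: finite_induct) (simp_all add: Pi_def)
qed

text \<open>Applying \<open>\<mu> y\<close> to a linear relation among the vectors isolates the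
  coefficient of \<open>v y\<close>, so the family is independent. Duality also makes
  \<open>v\<close> injective, so the basis has as many elements as \<open>Y\<close>. Both dimensions
  in the theorem are obtained this way.\<close>

lemma vectorspace_dim_dual_family:
  assumes V: "vectorspace K V" and fin: "finite Y" and v: "\<And>y. y \<in> Y \<Longrightarrow> v y \<in> carrier V"
    and span: "carrier V \<subseteq> LinearCombinations.module.span K V (v ` Y)"
    and hom: "\<And>y. y \<in> Y \<Longrightarrow> abelian_group_hom V K (\<mu> y)"
    and smult: "\<And>y a x. y \<in> Y \<Longrightarrow> a \<in> carrier K \<Longrightarrow> x \<in> carrier V \<Longrightarrow>
      \<mu> y (a \<odot>\<^bsub>V\<^esub> x) = a \<otimes>\<^bsub>K\<^esub> \<mu> y x"
    and dual: "\<And>y z. y \<in> Y \<Longrightarrow> z \<in> Y \<Longrightarrow> \<mu> y (v z) = (if y = z then \<one>\<^bsub>K\<^esub> else \<zero>\<^bsub>K\<^esub>)"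
  shows "vectorspace.fin_dim K V \<and> vectorspace.dim K V = card Y"
proof -
  interpret V: vectorspace K V by (rule V)
  have K: "abelian_monoid K"
    using V by (simp add: vectorspace_def module_def cring_def ring_def abelian_group_def)
  have inj: "inj_on v Y"
    by (rule inj_onI) (metis dual V.field.one_not_zero)
  have sub: "v ` Y \<subseteq> carrier V" using v by auto
  have finB: "finite (v ` Y)" using fin by simp
  have gen: "V.module.gen_set (v ` Y)"
    using span V.module.span_is_subset2[OF sub] by blast
  have "V.module.lin_indpt (v ` Y)"
  proof (rule V.module.finite_lin_indpt2[OF finB sub], rule ballI)
    fix a b assume a: "a \<in> v ` Y \<rightarrow> carrier K" and l: "V.module.lincomb a (v ` Y) = \<zero>\<^bsub>V\<^esub>"
      and "b \<in> v ` Y"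
    then obtain y where y: "y \<in> Y" "b = v y" by blast
    interpret h: abelian_group_hom V K "\<mu> y" by (rule hom[OF y(1)])
    have "\<zero>\<^bsub>K\<^esub> = \<mu> y (V.module.lincomb a (v ` Y))" using l by simp
    also have "\<dots> = (\<Oplus>\<^bsub>K\<^esub>w\<in>v ` Y. \<mu> y (a w \<odot>\<^bsub>V\<^esub> w))"
      unfolding V.module.lincomb_def
      by (rule abelian_group_hom_finsum[OF hom[OF y(1)] finB]) (use a v in auto)
    also have "\<dots> = (\<Oplus>\<^bsub>K\<^esub>w\<in>v ` Y. if v y = w then a w else \<zero>\<^bsub>K\<^esub>)"
    proof (rule abelian_monoid.finsum_cong'[OF K], rule refl)
      fix w assume "w \<in> v ` Y"
      then obtain z where z: "z \<in> Y" "w = v z" by blast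
      have "a (v z) \<in> carrier K" "v z \<in> carrier V" using a v z by auto
      moreover have "v y = v z \<longleftrightarrow> y = z" using inj y z by (auto simp: inj_on_def)
      ultimately show "\<mu> y (a w \<odot>\<^bsub>V\<^esub> w) = (if v y = w then a w else \<zero>\<^bsub>K\<^esub>)"
        using z y by (auto simp: smult dual)
    qed (use a in auto)
    also have "\<dots> = a (v y)"
      by (rule abelian_monoid.finsum_singleton[OF K]) (use a y fin in auto)
    finally show "a b = \<zero>\<^bsub>K\<^esub>" using y by simp
  qed
  with gen sub have "V.basis (v ` Y)" unfolding V.basis_def by simp
  hence "V.dim = card (v ` Y)" by (rule V.dim_basis[OF finB])
  moreover have "V.fin_dim" unfolding V.fin_dim_def using finB sub gen by blast
  ultimately show ?thesis using card_image[OF inj] by simp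
qed

lemma (in module) span_closure:
  assumes "S \<subseteq> carrier M"
  shows "S \<subseteq> span S" and "\<zero>\<^bsub>M\<^esub> \<in> span S"
    and "x \<in> span S \<Longrightarrow> y \<in> span S \<Longrightarrow> x \<oplus>\<^bsub>M\<^esub> y \<in> span S"
    and "a \<in> carrier R \<Longrightarrow> x \<in> span S \<Longrightarrow> a \<odot>\<^bsub>M\<^esub> x \<in> span S"
    and "span S \<subseteq> carrier M" and "x \<in> span S \<Longrightarrow> \<ominus>\<^bsub>M\<^esub> x \<in> span S"
proof -
  interpret s: LinearCombinations.submodule R "span S" M by (rule span_is_submodule[OF assms])
  show "S \<subseteq> span S" by (rule in_own_span[OF assms])
  show "\<zero>\<^bsub>M\<^esub> \<in> span S" "x \<in> span S \<Longrightarrow> y \<in> span S \<Longrightarrow> x \<oplus>\<^bsub>M\<^esub> y \<in> span S"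
    "a \<in> carrier R \<Longrightarrow> x \<in> span S \<Longrightarrow> a \<odot>\<^bsub>M\<^esub> x \<in> span S" "span S \<subseteq> carrier M"
    using s.subset by auto
  show "\<ominus>\<^bsub>M\<^esub> x \<in> span S" if "x \<in> span S"
  proof -
    have "(\<ominus>\<^bsub>R\<^esub> \<one>\<^bsub>R\<^esub>) \<odot>\<^bsub>M\<^esub> x = \<ominus>\<^bsub>M\<^esub> x"
      using that s.subset by (subst smult_l_minus) auto
    thus ?thesis using s.smult_closed[of "\<ominus>\<^bsub>R\<^esub> \<one>\<^bsub>R\<^esub>" x] that by simp
  qed
qed

section \<open>Quotient modules\<close>

locale quotient_module = M: module R M + N: abelian_subgroup N M
  for R :: "('r, 'l) ring_scheme" and M :: "('r, 'a, 'm) module_scheme" and N +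
  assumes N_smult: "a \<in> carrier R \<Longrightarrow> x \<in> N \<Longrightarrow> a \<odot>\<^bsub>M\<^esub> x \<in> N"
begin

abbreviation MN where "MN \<equiv> quot_module M N"
abbreviation cos where "cos x \<equiv> N +>\<^bsub>M\<^esub> x"

lemma quot_simps [simp]: "\<zero>\<^bsub>MN\<^esub> = N" "C \<oplus>\<^bsub>MN\<^esub> C' = C <+>\<^bsub>M\<^esub> C'"
  by (simp_all add: quot_module_def)

lemma cos_closed [simp]: "x \<in> carrier M \<Longrightarrow> cos x \<in> carrier MN"
  by (auto simp: quot_module_def A_RCOSETS_def')

lemma quot_carrierE: "C \<in> carrier MN \<Longrightarrow> (\<And>x. x \<in> carrier M \<Longrightarrow> C = cos x \<Longrightarrow> thesis) \<Longrightarrow> thesis"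
  by (auto simp: quot_module_def A_RCOSETS_def')

lemma cos_add: "x \<in> carrier M \<Longrightarrow> y \<in> carrier M \<Longrightarrow> cos (x \<oplus>\<^bsub>M\<^esub> y) = cos x \<oplus>\<^bsub>MN\<^esub> cos y"
  by (simp add: N.a_rcos_sum)

lemma cos_eq: "y \<in> carrier M \<Longrightarrow> x \<in> cos y \<Longrightarrow> cos x = cos y"
  using M.a_repr_independence[of x N y] N.a_subgroup by metis

lemma cos_eqI:
  assumes "x \<in> carrier M" "y \<in> carrier M" "x \<ominus>\<^bsub>M\<^esub> y \<in> N"
  shows "cos x = cos y"
proof (rule cos_eq[OF assms(2)])
  have "x = (x \<ominus>\<^bsub>M\<^esub> y) \<oplus>\<^bsub>M\<^esub> y" using assms(1,2) by (simp add: a_minus_def M.a_assoc M.l_neg)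
  thus "x \<in> cos y" using assms(3) by (auto simp: a_r_coset_def')
qed

lemma cos_zero: "x \<in> N \<Longrightarrow> cos x = \<zero>\<^bsub>MN\<^esub>"
  by (simp add: N.a_rcos_const)

text \<open>The scalar product in the quotient is a union over all representatives. They differ by
  elements of \<open>N\<close>, which is stable under scalars, so every member of the union is the
  same coset.\<close>

lemma cos_smult:
  assumes a: "a \<in> carrier R" and x: "x \<in> carrier M"
  shows "a \<odot>\<^bsub>MN\<^esub> cos x = cos (a \<odot>\<^bsub>M\<^esub> x)"
proof -
  have "cos (a \<odot>\<^bsub>M\<^esub> x') = cos (a \<odot>\<^bsub>M\<^esub> x)" if x': "x' \<in> cos x" for x'
  proof -
    obtain k where k: "k \<in> N" "x' = k \<oplus>\<^bsub>M\<^esub> x" using x' by (auto simp: a_r_coset_def')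
    have "a \<odot>\<^bsub>M\<^esub> x' = a \<odot>\<^bsub>M\<^esub> k \<oplus>\<^bsub>M\<^esub> a \<odot>\<^bsub>M\<^esub> x"
      using k x a by (simp add: M.smult_r_distr)
    hence "a \<odot>\<^bsub>M\<^esub> x' \<in> cos (a \<odot>\<^bsub>M\<^esub> x)" using N_smult[OF a k(1)] by (auto simp: a_r_coset_def')
    thus ?thesis using a x by (intro cos_eq) auto
  qed
  moreover have "x \<in> cos x" by (rule N.a_rcos_self[OF x])
  ultimately have "(\<Union>x'\<in>cos x. cos (a \<odot>\<^bsub>M\<^esub> x')) = cos (a \<odot>\<^bsub>M\<^esub> x)" by blast
  thus ?thesis by (simp add: quot_module_def)
qed

lemma quot_module_module: "module R MN"
proof (rule moduleI)
  show "cring R" by (rule M.R.is_cring)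
  have N_cos: "\<zero>\<^bsub>MN\<^esub> = cos \<zero>\<^bsub>M\<^esub>" by (simp add: N.a_rcos_const)
  show "abelian_group MN"
  proof (rule abelian_groupI)
    fix C assume "C \<in> carrier MN"
    then obtain x where "x \<in> carrier M" "C = cos x" by (rule quot_carrierE)
    thus "\<exists>C'\<in>carrier MN. C' \<oplus>\<^bsub>MN\<^esub> C = \<zero>\<^bsub>MN\<^esub>"
      by (intro bexI[of _ "cos (\<ominus>\<^bsub>M\<^esub> x)"])
        (simp_all add: cos_add[symmetric] N_cos M.l_neg del: quot_simps)
  qed (auto elim!: quot_carrierE simp: N_cos cos_add[symmetric] M.a_ac simp del: quot_simps)
next
  fix a C assume "a \<in> carrier R" "C \<in> carrier MN"
  thus "a \<odot>\<^bsub>MN\<^esub> C \<in> carrier MN" by (auto elim!: quot_carrierE simp: cos_smult simp del: quot_simps)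
next
  fix a b C assume "a \<in> carrier R" "b \<in> carrier R" "C \<in> carrier MN"
  thus "(a \<oplus>\<^bsub>R\<^esub> b) \<odot>\<^bsub>MN\<^esub> C = a \<odot>\<^bsub>MN\<^esub> C \<oplus>\<^bsub>MN\<^esub> b \<odot>\<^bsub>MN\<^esub> C"
    by (auto elim!: quot_carrierE simp: cos_smult cos_add[symmetric] M.smult_l_distr simp del: quot_simps)
next
  fix a C C' assume "a \<in> carrier R" "C \<in> carrier MN" "C' \<in> carrier MN"
  thus "a \<odot>\<^bsub>MN\<^esub> (C \<oplus>\<^bsub>MN\<^esub> C') = a \<odot>\<^bsub>MN\<^esub> C \<oplus>\<^bsub>MN\<^esub> a \<odot>\<^bsub>MN\<^esub> C'"
    by (auto elim!: quot_carrierE simp: cos_smult cos_add[symmetric] M.smult_r_distr simp del: quot_simps)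
next
  fix a b C assume "a \<in> carrier R" "b \<in> carrier R" "C \<in> carrier MN"
  thus "(a \<otimes>\<^bsub>R\<^esub> b) \<odot>\<^bsub>MN\<^esub> C = a \<odot>\<^bsub>MN\<^esub> (b \<odot>\<^bsub>MN\<^esub> C)"
    by (auto elim!: quot_carrierE simp: cos_smult M.smult_assoc1 simp del: quot_simps)
next
  fix C assume "C \<in> carrier MN"
  thus "\<one>\<^bsub>R\<^esub> \<odot>\<^bsub>MN\<^esub> C = C" by (auto elim!: quot_carrierE simp: cos_smult simp del: quot_simps)
qed

lemma quot_lift:
  assumes f: "abelian_group_hom M G f" and kern: "\<And>x. x \<in> N \<Longrightarrow> f x = \<zero>\<^bsub>G\<^esub>"
  obtains g where "abelian_group_hom MN G g" "\<And>x. x \<in> carrier M \<Longrightarrow> g (cos x) = f x"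
proof
  interpret f: abelian_group_hom M G f by fact
  interpret MN: module R MN by (rule quot_module_module)
  \<comment> \<open>The chosen representative differs from any other by an element of
    \<open>N\<close>, which \<open>f\<close> kills, so the choice does not affect the value.\<close>
  define g where "g C = f (SOME x. x \<in> C)" for C
  show eq: "g (cos x) = f x" if x: "x \<in> carrier M" for x
  proof -
    have "(SOME y. y \<in> cos x) \<in> cos x" by (rule someI[of _ x]) (rule N.a_rcos_self[OF x])
    then obtain k where k: "k \<in> N" "(SOME y. y \<in> cos x) = k \<oplus>\<^bsub>M\<^esub> x" by (auto simp: a_r_coset_def')
    thus ?thesis using x kern[OF k(1)] by (simp add: g_def)
  qed
  show "abelian_group_hom MN G g"
  proof (rule abelian_group_homI')
    fix C C' assume "C \<in> carrier MN" "C' \<in> carrier MN"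
    thus "g (C \<oplus>\<^bsub>MN\<^esub> C') = g C \<oplus>\<^bsub>G\<^esub> g C'"
      by (auto elim!: quot_carrierE simp: eq cos_add[symmetric] simp del: quot_simps)
  next
    fix C assume "C \<in> carrier MN"
    thus "g C \<in> carrier G" by (auto elim!: quot_carrierE simp: eq simp del: quot_simps)
  qed (rule MN.abelian_group_axioms f.H.abelian_group_axioms)+
qed

end

section \<open>Differentials and derivations\<close>

locale kaehler_setting = A: cring A for R :: "('r, 'l) ring_scheme" and \<phi> and A :: "('a, 'm) ring_scheme" (structure) +
  assumes \<phi>_in: "r \<in> carrier R \<Longrightarrow> \<phi> r \<in> carrier A"
begin

abbreviation F where "F \<equiv> free_module A (carrier A)"
abbreviation e where "e \<equiv> free_gen A"
abbreviation N where "N \<equiv> kaehler_submodule R \<phi> A"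
abbreviation \<Omega> where "\<Omega> \<equiv> kaehler R \<phi> A"
abbreviation d where "d \<equiv> univ_deriv R \<phi> A"

lemma free_simps [simp]:
  "\<zero>\<^bsub>F\<^esub> = (\<lambda>x. \<zero>)" "f \<oplus>\<^bsub>F\<^esub> g = (\<lambda>x. f x \<oplus> g x)" "a \<odot>\<^bsub>F\<^esub> f = (\<lambda>x. a \<otimes> f x)"
  by (simp_all add: free_module_def)

lemma free_carrier:
  "f \<in> carrier F \<longleftrightarrow> (\<forall>x. f x \<in> carrier A) \<and> {x. f x \<noteq> \<zero>} \<subseteq> carrier A \<and> finite {x. f x \<noteq> \<zero>}"
  unfolding free_module_def by auto

lemma free_module_module: "module A F"
proof (rule moduleI)
  have add: "f \<oplus>\<^bsub>F\<^esub> g \<in> carrier F" if "f \<in> carrier F" "g \<in> carrier F" for f g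
  proof -
    have *: "{x. f x \<oplus> g x \<noteq> \<zero>} \<subseteq> {x. f x \<noteq> \<zero>} \<union> {x. g x \<noteq> \<zero>}"
      by auto
    show ?thesis using that finite_subset[OF *] * by (auto simp: free_carrier)
  qed
  have smult: "a \<odot>\<^bsub>F\<^esub> f \<in> carrier F" if "a \<in> carrier A" "f \<in> carrier F" for a f
  proof -
    have *: "{x. a \<otimes> f x \<noteq> \<zero>} \<subseteq> {x. f x \<noteq> \<zero>}" using that by auto
    show ?thesis using that finite_subset[OF *] * by (auto simp: free_carrier)
  qed
  show "cring A" by (rule A.is_cring)
  show "abelian_group F"
  proof (rule abelian_groupI)
    fix f assume f: "f \<in> carrier F"
    show "\<exists>g\<in>carrier F. g \<oplus>\<^bsub>F\<^esub> f = \<zero>\<^bsub>F\<^esub>"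
      using f smult[of "\<ominus> \<one>" f]
      by (intro bexI[of _ "(\<ominus> \<one>) \<odot>\<^bsub>F\<^esub> f"]) (auto simp: free_carrier A.l_minus A.l_neg)
  qed (use add in \<open>auto simp: free_carrier A.a_ac\<close>)
  show "a \<odot>\<^bsub>F\<^esub> f \<in> carrier F" if "a \<in> carrier A" "f \<in> carrier F" for a f by (rule smult[OF that])
qed (auto simp: free_carrier A.l_distr A.r_distr A.m_assoc)

lemma free_gen_closed [simp]: "a \<in> carrier A \<Longrightarrow> e a \<in> carrier F"
  by (auto simp: free_carrier free_gen_def)

lemma relations_closed: "kaehler_relations R \<phi> A \<subseteq> carrier F"
proof -
  interpret F: module A F by (rule free_module_module)
  show ?thesis
    unfolding kaehler_relations_def Let_def
    by (intro Un_least subsetI; elim CollectE exE conjE; hypsubst)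
      (auto simp: \<phi>_in simp del: free_simps)
qed

lemma kaehler_quotient: "quotient_module A F N"
proof -
  interpret F: module A F by (rule free_module_module)
  note s = module.span_closure[OF free_module_module relations_closed, folded kaehler_submodule_def]
  show ?thesis
  proof (intro quotient_module.intro quotient_module_axioms.intro abelian_subgroupI3 free_module_module)
    show "additive_subgroup N F"
      by (intro additive_subgroup.intro F.add.subgroupI) (use s in auto)
    show "abelian_group F" by (rule F.abelian_group_axioms)
    show "a \<odot>\<^bsub>F\<^esub> x \<in> N" if "a \<in> carrier A" "x \<in> N" for a x using that s by simp
  qed
qed

interpretation q: quotient_module A F N by (rule kaehler_quotient)

lemma kaehler_eq: "q.MN = \<Omega>" by (simp add: kaehler_def)

lemma univ_deriv_eq: "d a = q.cos (e a)" by (simp add: univ_deriv_def)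

lemma kaehler_module: "module A \<Omega>"
  using q.quot_module_module by (simp add: kaehler_eq)

lemma d_closed [simp]: "a \<in> carrier A \<Longrightarrow> d a \<in> carrier \<Omega>"
  using q.cos_closed[of "e a"] by (simp add: kaehler_eq univ_deriv_eq)

lemma relations_N: "kaehler_relations R \<phi> A \<subseteq> N"
  using module.span_closure(1)[OF free_module_module relations_closed] by (simp add: kaehler_submodule_def)

lemma d_add:
  assumes "a \<in> carrier A" "b \<in> carrier A"
  shows "d (a \<oplus> b) = d a \<oplus>\<^bsub>\<Omega>\<^esub> d b"
proof -
  have "e (a \<oplus> b) \<ominus>\<^bsub>F\<^esub> (e a \<oplus>\<^bsub>F\<^esub> e b) \<in> N"
    using relations_N assms unfolding kaehler_relations_def Let_def by blast
  hence "q.cos (e (a \<oplus> b)) = q.cos (e a \<oplus>\<^bsub>F\<^esub> e b)"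
    using assms by (intro q.cos_eqI) (auto simp del: free_simps)
  also have "\<dots> = q.cos (e a) \<oplus>\<^bsub>q.MN\<^esub> q.cos (e b)" by (rule q.cos_add) (use assms in auto)
  finally show ?thesis unfolding univ_deriv_eq kaehler_eq .
qed

lemma d_mult:
  assumes "a \<in> carrier A" "b \<in> carrier A"
  shows "d (a \<otimes> b) = a \<odot>\<^bsub>\<Omega>\<^esub> d b \<oplus>\<^bsub>\<Omega>\<^esub> b \<odot>\<^bsub>\<Omega>\<^esub> d a"
proof -
  have "e (a \<otimes> b) \<ominus>\<^bsub>F\<^esub> (a \<odot>\<^bsub>F\<^esub> e b \<oplus>\<^bsub>F\<^esub> b \<odot>\<^bsub>F\<^esub> e a) \<in> N"
    using relations_N assms unfolding kaehler_relations_def Let_def by blast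
  hence "q.cos (e (a \<otimes> b)) = q.cos (a \<odot>\<^bsub>F\<^esub> e b \<oplus>\<^bsub>F\<^esub> b \<odot>\<^bsub>F\<^esub> e a)"
    using assms by (intro q.cos_eqI) (auto simp del: free_simps)
  also have "\<dots> = q.cos (a \<odot>\<^bsub>F\<^esub> e b) \<oplus>\<^bsub>q.MN\<^esub> q.cos (b \<odot>\<^bsub>F\<^esub> e a)"
    by (rule q.cos_add) (use assms in \<open>auto simp del: free_simps\<close>)
  also have "\<dots> = a \<odot>\<^bsub>q.MN\<^esub> q.cos (e b) \<oplus>\<^bsub>q.MN\<^esub> b \<odot>\<^bsub>q.MN\<^esub> q.cos (e a)"
    using assms q.cos_smult[of a "e b"] q.cos_smult[of b "e a"] by (simp del: free_simps q.quot_simps)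
  finally show ?thesis unfolding univ_deriv_eq kaehler_eq .
qed

lemma d_const: "r \<in> carrier R \<Longrightarrow> d (\<phi> r) = \<zero>\<^bsub>\<Omega>\<^esub>"
proof -
  assume "r \<in> carrier R"
  hence "e (\<phi> r) \<in> N" using relations_N unfolding kaehler_relations_def Let_def by blast
  hence "q.cos (e (\<phi> r)) = \<zero>\<^bsub>q.MN\<^esub>" by (rule q.cos_zero)
  thus ?thesis unfolding univ_deriv_eq kaehler_eq .
qed

lemma free_induct [consumes 1, case_names zero smult add]:
  assumes "f \<in> carrier F" and 0: "P (\<zero>\<^bsub>F\<^esub>)"
    and smult: "\<And>a x. a \<in> carrier A \<Longrightarrow> x \<in> carrier A \<Longrightarrow> P (a \<odot>\<^bsub>F\<^esub> e x)"
    and add: "\<And>f g. f \<in> carrier F \<Longrightarrow> g \<in> carrier F \<Longrightarrow> P f \<Longrightarrow> P g \<Longrightarrow> P (f \<oplus>\<^bsub>F\<^esub> g)"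
  shows "P f"
proof -
  have "P f" if "finite Y" "{x. f x \<noteq> \<zero>} \<subseteq> Y" "f \<in> carrier F" for Y f
    using that
  proof (induction Y arbitrary: f rule: finite_induct)
    case empty
    hence "f = \<zero>\<^bsub>F\<^esub>" by auto
    thus ?case using 0 by simp
  next
    case (insert y Y)
    show ?case
    proof (cases "f y = \<zero>")
      case True
      thus ?thesis using insert by (intro insert.IH) auto
    next
      case False
      \<comment> \<open>One coefficient is removed from \<open>f\<close>; the rest has its support
        in the smaller set, and the removed term is a multiple of a generator.\<close>
      let ?g = "\<lambda>x. if x = y then \<zero> else f x"
      have y: "y \<in> carrier A" "f y \<in> carrier A" using False insert.prems(2) by (auto simp: free_carrier)
      have *: "{x. ?g x \<noteq> \<zero>} \<subseteq> {x. f x \<noteq> \<zero>}" by auto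
      have g: "?g \<in> carrier F" using insert.prems(2) finite_subset[OF *] by (auto simp: free_carrier)
      have "P ?g" by (rule insert.IH) (use insert.prems g in auto)
      moreover have "f y \<odot>\<^bsub>F\<^esub> e y \<in> carrier F"
        using module.smult_closed[OF free_module_module y(2) free_gen_closed[OF y(1)]] .
      ultimately have "P ((f y \<odot>\<^bsub>F\<^esub> e y) \<oplus>\<^bsub>F\<^esub> ?g)"
        using add smult[OF y(2,1)] g by blast
      moreover have "(f y \<odot>\<^bsub>F\<^esub> e y) \<oplus>\<^bsub>F\<^esub> ?g = f"
        using y insert.prems(2) by (auto simp: fun_eq_iff free_gen_def free_carrier)
      ultimately show ?thesis by simp
    qed
  qed
  thus ?thesis using assms(1) by (auto simp: free_carrier)
qed

lemma kaehler_induct [consumes 1, case_names zero smult add]: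
  assumes "w \<in> carrier \<Omega>" and 0: "P \<zero>\<^bsub>\<Omega>\<^esub>"
    and smult: "\<And>a x. a \<in> carrier A \<Longrightarrow> x \<in> carrier A \<Longrightarrow> P (a \<odot>\<^bsub>\<Omega>\<^esub> d x)"
    and add: "\<And>w w'. w \<in> carrier \<Omega> \<Longrightarrow> w' \<in> carrier \<Omega> \<Longrightarrow> P w \<Longrightarrow> P w' \<Longrightarrow> P (w \<oplus>\<^bsub>\<Omega>\<^esub> w')"
  shows "P w"
proof -
  obtain f where f: "f \<in> carrier F" "w = q.cos f"
    using assms(1) q.quot_carrierE unfolding kaehler_eq by metis
  have "P (q.cos f)" using f(1)
  proof (induction f rule: free_induct)
    case zero
    thus ?case using 0 q.cos_zero[OF q.N.zero_closed] by (simp add: kaehler_eq del: free_simps q.quot_simps)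
  next
    case (smult a x)
    thus ?case using assms(3)[OF smult] q.cos_smult[of a "e x"]
      by (simp add: kaehler_eq univ_deriv_eq del: free_simps q.quot_simps)
  next
    case (add f g)
    thus ?case using assms(4)[of "q.cos f" "q.cos g"] q.cos_add[of f g] q.cos_closed[of f] q.cos_closed[of g]
      by (simp add: kaehler_eq del: free_simps q.quot_simps)
  qed
  thus ?thesis using f by simp
qed

text \<open>A derivation extends linearly to the free module on the symbols \<open>d x\<close>.
  Additivity, the Leibniz rule and vanishing on constants say exactly that this extension kills the
  defining relations, so it descends to the quotient. Linearity of \<open>g\<close> is recorded
  because \<open>g\<close> is to serve as a coordinate functional.\<close>

lemma kaehler_lift:
  assumes \<delta>: "\<And>a. a \<in> carrier A \<Longrightarrow> \<delta> a \<in> carrier A"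
    and add: "\<And>a b. a \<in> carrier A \<Longrightarrow> b \<in> carrier A \<Longrightarrow> \<delta> (a \<oplus> b) = \<delta> a \<oplus> \<delta> b"
    and mult: "\<And>a b. a \<in> carrier A \<Longrightarrow> b \<in> carrier A \<Longrightarrow> \<delta> (a \<otimes> b) = a \<otimes> \<delta> b \<oplus> b \<otimes> \<delta> a"
    and const: "\<And>r. r \<in> carrier R \<Longrightarrow> \<delta> (\<phi> r) = \<zero>"
  obtains g where "abelian_group_hom \<Omega> A g" "\<And>a x. a \<in> carrier A \<Longrightarrow> x \<in> carrier A \<Longrightarrow>
      g (a \<odot>\<^bsub>\<Omega>\<^esub> d x) = a \<otimes> \<delta> x"
    "\<And>a w. a \<in> carrier A \<Longrightarrow> w \<in> carrier \<Omega> \<Longrightarrow> g (a \<odot>\<^bsub>\<Omega>\<^esub> w) = a \<otimes> g w"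
proof -
  interpret O: module A \<Omega> by (rule kaehler_module)
  have Fab: "abelian_group F" using free_module_module by (simp add: module_def)
  \<comment> \<open>The sum runs over the support so that it is finite; \<open>s_superset\<close>
    then allows any larger finite index set, which additivity requires.\<close>
  define s where "s f = (\<Oplus>x\<in>{x. f x \<noteq> \<zero>}. f x \<otimes> \<delta> x)" for f
  have s_superset: "s f = (\<Oplus>x\<in>Y. f x \<otimes> \<delta> x)"
    if "f \<in> carrier F" "finite Y" "Y \<subseteq> carrier A" "{x. f x \<noteq> \<zero>} \<subseteq> Y" for f Y
    unfolding s_def using that \<delta>
    by (intro A.add.finprod_mono_neutral_cong_left) (auto simp: free_carrier)
  have s_add: "s (f \<oplus>\<^bsub>F\<^esub> g) = s f \<oplus> s g" if f: "f \<in> carrier F" and g: "g \<in> carrier F" for f g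
  proof -
    let ?Y = "{x. f x \<noteq> \<zero>} \<union> {x. g x \<noteq> \<zero>}"
    have Y: "finite ?Y" "?Y \<subseteq> carrier A" using f g by (auto simp: free_carrier)
    have fg: "f x \<in> carrier A" "g x \<in> carrier A" for x using f g by (auto simp: free_carrier)
    have "{x. f x \<oplus> g x \<noteq> \<zero>} \<subseteq> ?Y" by auto
    hence "s (f \<oplus>\<^bsub>F\<^esub> g) = (\<Oplus>x\<in>?Y. (f x \<oplus> g x) \<otimes> \<delta> x)"
      using s_superset[of "f \<oplus>\<^bsub>F\<^esub> g" ?Y] abelian_groupE(1)[OF Fab f g] Y by auto
    also have "\<dots> = (\<Oplus>x\<in>?Y. f x \<otimes> \<delta> x \<oplus> g x \<otimes> \<delta> x)"
      using Y(2) fg \<delta> by (intro A.finsum_cong') (auto simp: A.l_distr)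
    also have "\<dots> = (\<Oplus>x\<in>?Y. f x \<otimes> \<delta> x) \<oplus> (\<Oplus>x\<in>?Y. g x \<otimes> \<delta> x)"
      using Y(2) fg \<delta> by (intro A.finsum_addf) auto
    also have "(\<Oplus>x\<in>?Y. f x \<otimes> \<delta> x) = s f" by (rule s_superset[symmetric]) (use f Y in auto)
    also have "(\<Oplus>x\<in>?Y. g x \<otimes> \<delta> x) = s g" by (rule s_superset[symmetric]) (use g Y in auto)
    finally show ?thesis .
  qed
  have s_closed: "s f \<in> carrier A" if "f \<in> carrier F" for f
    unfolding s_def using that \<delta> by (intro A.finsum_closed) (auto simp: free_carrier)
  have s_hom: "abelian_group_hom F A s"
    by (rule abelian_group_homI')
      (auto simp del: free_simps simp: s_add s_closed Fab A.abelian_group_axioms)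
  interpret s: abelian_group_hom F A s by (rule s_hom)
  have s_gen: "s (a \<odot>\<^bsub>F\<^esub> e x) = a \<otimes> \<delta> x" if "a \<in> carrier A" "x \<in> carrier A" for a x
  proof -
    have "s (a \<odot>\<^bsub>F\<^esub> e x) = (\<Oplus>y\<in>{x}. (a \<odot>\<^bsub>F\<^esub> e x) y \<otimes> \<delta> y)"
      by (rule s_superset[OF q.M.smult_closed[OF that(1) free_gen_closed[OF that(2)]]])
        (use that in \<open>auto simp: free_gen_def split: if_splits\<close>)
    thus ?thesis using that \<delta> by (simp add: free_gen_def)
  qed
  have s_e: "s (e x) = \<delta> x" if "x \<in> carrier A" for x
    using s_gen[of "\<one>" x] that \<delta> q.M.smult_one[of "e x"] by simp
  have s_smult: "s (a \<odot>\<^bsub>F\<^esub> f) = a \<otimes> s f" if a: "a \<in> carrier A" and f: "f \<in> carrier F" for a f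
    using f
  proof (induction f rule: free_induct)
    case zero
    have "a \<odot>\<^bsub>F\<^esub> \<zero>\<^bsub>F\<^esub> = \<zero>\<^bsub>F\<^esub>" using a by simp
    thus ?case using a s.hom_zero by (simp del: free_simps)
  next
    case (smult b x)
    have "a \<odot>\<^bsub>F\<^esub> (b \<odot>\<^bsub>F\<^esub> e x) = (a \<otimes> b) \<odot>\<^bsub>F\<^esub> e x"
      using q.M.smult_assoc1[of a b "e x"] smult a by (simp del: free_simps)
    thus ?case using a smult s_gen \<delta> by (simp add: A.m_assoc del: free_simps)
  next
    case (add f g)
    thus ?case using a q.M.smult_r_distr[of a f g] by (simp add: s_closed A.r_distr del: free_simps)
  qed
  \<comment> \<open>Since \<open>s\<close> is linear, its kernel is a submodule; once it contains
    the relations it contains their span.\<close>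
  have "N \<subseteq> {f \<in> carrier F. s f = \<zero>}"
    unfolding kaehler_submodule_def
  proof (rule q.M.span_is_subset)
    show "LinearCombinations.submodule A {f \<in> carrier F. s f = \<zero>} F"
      by (intro LinearCombinations.submodule.intro free_module_module)
        (use s.hom_zero in \<open>auto simp: s_smult simp del: free_simps\<close>)
    have minus: "s (f \<ominus>\<^bsub>F\<^esub> g) = s f \<ominus> s g" if "f \<in> carrier F" "g \<in> carrier F" for f g
      by (rule abelian_group_hom_minus[OF s_hom that])
    show "kaehler_relations R \<phi> A \<subseteq> {f \<in> carrier F. s f = \<zero>}"
    proof
      fix f assume f: "f \<in> kaehler_relations R \<phi> A"
      hence "f \<in> carrier F" using relations_closed by blast
      moreover from f consider
          (1) a b where "f = e (a \<oplus> b) \<ominus>\<^bsub>F\<^esub> (e a \<oplus>\<^bsub>F\<^esub> e b)" "a \<in> carrier A" "b \<in> carrier A"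
        | (2) a b where "f = e (a \<otimes> b) \<ominus>\<^bsub>F\<^esub> (a \<odot>\<^bsub>F\<^esub> e b \<oplus>\<^bsub>F\<^esub> b \<odot>\<^bsub>F\<^esub> e a)"
          "a \<in> carrier A" "b \<in> carrier A"
        | (3) r where "f = e (\<phi> r)" "r \<in> carrier R"
        unfolding kaehler_relations_def Let_def by blast
      hence "s f = \<zero>"
        by cases (simp_all del: free_simps
          add: minus s_add s_e s_gen add mult const \<delta> \<phi>_in A.minus_eq A.r_neg)
      ultimately show "f \<in> {f \<in> carrier F. s f = \<zero>}" by blast
    qed
  qed
  hence kern: "s f = \<zero>" if "f \<in> N" for f using that by blast
  obtain g where g: "abelian_group_hom \<Omega> A g" "\<And>f. f \<in> carrier F \<Longrightarrow> g (q.cos f) = s f"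
    using q.quot_lift[OF s_hom kern] unfolding kaehler_eq by metis
  show thesis
  proof (rule that[OF g(1)])
    show lin: "g (a \<odot>\<^bsub>\<Omega>\<^esub> w) = a \<otimes> g w" if aw: "a \<in> carrier A" "w \<in> carrier \<Omega>" for a w
    proof -
      obtain f where f: "f \<in> carrier F" "w = q.cos f"
        using aw(2) q.quot_carrierE unfolding kaehler_eq by metis
      have "a \<odot>\<^bsub>\<Omega>\<^esub> w = q.cos (a \<odot>\<^bsub>F\<^esub> f)" using q.cos_smult[OF aw(1) f(1)] f by (simp add: kaehler_eq)
      thus ?thesis using f aw(1) g(2) q.M.smult_closed[of a f] by (simp add: s_smult del: free_simps)
    qed
    show "g (a \<odot>\<^bsub>\<Omega>\<^esub> d x) = a \<otimes> \<delta> x" if "a \<in> carrier A" "x \<in> carrier A" for a x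
      using that g(2)[of "e x"] by (simp add: lin s_e univ_deriv_eq[symmetric])
  qed
qed

end

text \<open>The elements \<open>d T_i\<close> span because the \<open>x\<close> whose differential
  lies in their span are closed under all operations that build rational functions. They are
  independent because the partial derivatives factor through differentials and form a dual
  family.\<close>

lemma kaehler_ratfun_dim:
  fixes n :: nat
  defines "A \<equiv> (ratfun_field n :: 'k::field ratfun ring)"
  defines "\<Omega> \<equiv> kaehler (ring_of_type_algebra :: 'k ring) ratfun_const A"
  shows "vectorspace A \<Omega> \<and> vectorspace.fin_dim A \<Omega> \<and> vectorspace.dim A \<Omega> = n"
proof -
  let ?K = "ring_of_type_algebra :: 'k ring"
  interpret A: field A unfolding A_def by (rule ratfun_is_field)
  interpret k: kaehler_setting ?K ratfun_const A
    by unfold_locales (simp add: A_def ratfun_closed)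
  interpret O: module A \<Omega> unfolding \<Omega>_def by (rule k.kaehler_module)
  have V: "vectorspace A \<Omega>" by unfold_locales
  let ?d = "\<lambda>i. k.d (ratfun_var i)"
  have simps: "x \<oplus>\<^bsub>A\<^esub> y = x + y" "x \<otimes>\<^bsub>A\<^esub> y = x * y" "\<one>\<^bsub>A\<^esub> = 1" "\<zero>\<^bsub>A\<^esub> = 0" for x y
    by (simp_all add: A_def)
  have var: "ratfun_var i \<in> carrier A" if "i \<in> {1..n}" for i using that by (simp add: A_def ratfun_closed)
  have vc: "?d i \<in> carrier \<Omega>" if "i \<in> {1..n}" for i
    using k.d_closed[OF var[OF that]] by (simp add: \<Omega>_def)
  have const: "ratfun_const c \<in> carrier A" for c by (simp add: A_def ratfun_closed)
  have "\<exists>g. abelian_group_hom \<Omega> A g \<and> (\<forall>a\<in>carrier A. \<forall>x\<in>carrier A. g (a \<odot>\<^bsub>\<Omega>\<^esub> k.d x) = a * rat_deriv i x)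
      \<and> (\<forall>a\<in>carrier A. \<forall>w\<in>carrier \<Omega>. g (a \<odot>\<^bsub>\<Omega>\<^esub> w) = a * g w)" for i
  proof (rule k.kaehler_lift[of "rat_deriv i"])
    fix g assume "abelian_group_hom k.\<Omega> A g" "\<And>a x. a \<in> carrier A \<Longrightarrow> x \<in> carrier A \<Longrightarrow>
        g (a \<odot>\<^bsub>k.\<Omega>\<^esub> k.d x) = a \<otimes>\<^bsub>A\<^esub> rat_deriv i x"
      "\<And>a w. a \<in> carrier A \<Longrightarrow> w \<in> carrier k.\<Omega> \<Longrightarrow> g (a \<odot>\<^bsub>k.\<Omega>\<^esub> w) = a \<otimes>\<^bsub>A\<^esub> g w"
    thus ?thesis by (intro exI[of _ g]) (simp add: simps \<Omega>_def)
  qed (simp_all add: simps rat_deriv_add rat_deriv_mult, simp_all add: A_def ratfun_closed2)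
  then obtain g where g: "abelian_group_hom \<Omega> A (g i)"
    "\<And>a x. a \<in> carrier A \<Longrightarrow> x \<in> carrier A \<Longrightarrow> g i (a \<odot>\<^bsub>\<Omega>\<^esub> k.d x) = a * rat_deriv i x"
    "\<And>a w. a \<in> carrier A \<Longrightarrow> w \<in> carrier \<Omega> \<Longrightarrow> g i (a \<odot>\<^bsub>\<Omega>\<^esub> w) = a * g i w" for i
    by metis
  let ?S = "LinearCombinations.module.span A \<Omega> (?d ` {1..n})"
  have sub: "?d ` {1..n} \<subseteq> carrier \<Omega>" using vc by auto
  note s = module.span_closure[OF O.module_axioms sub]
  have dS: "k.d x \<in> ?S" if "x \<in> carrier A" for x
    using that unfolding A_def
  proof (induction x rule: ratfun_induct)
    case (const c)
    thus ?case using s(2) k.d_const[of c] by (simp add: \<Omega>_def A_def)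
  next
    case (var i) thus ?case using s(1) by (auto simp: A_def)
  next
    case (add x y)
    thus ?case using s(3) k.d_add[of x y] by (simp add: \<Omega>_def A_def)
  next
    case (mult x y)
    thus ?case using s(3,4) k.d_mult[of x y] by (simp add: \<Omega>_def A_def)
  next
    case (inverse x)
    let ?y = "inverse x"
    have xy: "x \<in> carrier A" "?y \<in> carrier A" using inverse ratfun_closed2(4)[of x n] by (simp_all add: A_def)
    have cl: "k.d x \<in> carrier \<Omega>" "k.d ?y \<in> carrier \<Omega>" using xy k.d_closed by (simp_all add: \<Omega>_def)
    \<comment> \<open>Differentiating \<open>x * inverse x = 1\<close> expresses \<open>x\<close>
      times the differential of the inverse through \<open>d x\<close>; multiplying by the inverse
      once more isolates it.\<close>
    have "k.d (1::'k ratfun) = \<zero>\<^bsub>\<Omega>\<^esub>"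
      using k.d_const[of 1] by (simp add: ratfun_const_def mpoly_const_def One_fract_def \<Omega>_def)
    moreover have "x \<otimes>\<^bsub>A\<^esub> ?y = 1" using inverse by (simp add: simps)
    ultimately have "x \<odot>\<^bsub>\<Omega>\<^esub> k.d ?y \<oplus>\<^bsub>\<Omega>\<^esub> ?y \<odot>\<^bsub>\<Omega>\<^esub> k.d x = \<zero>\<^bsub>\<Omega>\<^esub>"
      using k.d_mult[OF xy] by (simp add: \<Omega>_def)
    hence "x \<odot>\<^bsub>\<Omega>\<^esub> k.d ?y = \<ominus>\<^bsub>\<Omega>\<^esub> (?y \<odot>\<^bsub>\<Omega>\<^esub> k.d x)"
      using O.minus_equality[of "x \<odot>\<^bsub>\<Omega>\<^esub> k.d ?y" "?y \<odot>\<^bsub>\<Omega>\<^esub> k.d x"] xy cl by simp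
    hence "x \<odot>\<^bsub>\<Omega>\<^esub> k.d ?y \<in> ?S" using s(4,6) xy inverse by (simp add: A_def)
    hence "?y \<odot>\<^bsub>\<Omega>\<^esub> (x \<odot>\<^bsub>\<Omega>\<^esub> k.d ?y) \<in> ?S" using s(4) xy by simp
    moreover have "?y \<odot>\<^bsub>\<Omega>\<^esub> (x \<odot>\<^bsub>\<Omega>\<^esub> k.d ?y) = (?y \<otimes>\<^bsub>A\<^esub> x) \<odot>\<^bsub>\<Omega>\<^esub> k.d ?y"
      using O.smult_assoc1[of ?y x "k.d ?y"] xy cl by simp
    moreover have "?y \<otimes>\<^bsub>A\<^esub> x = \<one>\<^bsub>A\<^esub>" using inverse by (simp add: simps)
    hence "(?y \<otimes>\<^bsub>A\<^esub> x) \<odot>\<^bsub>\<Omega>\<^esub> k.d ?y = k.d ?y" using O.smult_one[OF cl(2)] by simp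
    ultimately have "k.d ?y \<in> ?S" by metis
    thus ?case by (simp only: A_def)
  qed
  have span: "carrier \<Omega> \<subseteq> ?S"
  proof
    fix w assume "w \<in> carrier \<Omega>"
    hence "w \<in> carrier k.\<Omega>" by (simp add: \<Omega>_def)
    thus "w \<in> ?S"
      by (induction w rule: k.kaehler_induct) (use s dS in \<open>auto simp: \<Omega>_def[symmetric]\<close>)
  qed
  have "vectorspace.fin_dim A \<Omega> \<and> vectorspace.dim A \<Omega> = card {1..n}"
  proof (rule vectorspace_dim_dual_family[OF V _ vc span g(1)])
    show "g y (?d z) = (if y = z then \<one>\<^bsub>A\<^esub> else \<zero>\<^bsub>A\<^esub>)" if "y \<in> {1..n}" "z \<in> {1..n}" for y z
      using g(2)[of "\<one>\<^bsub>A\<^esub>" "ratfun_var z" y] var[OF that(2)] O.smult_one[OF vc[OF that(2)]]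
        ratfun_closed(3)[of n] by (auto simp: simps(3,4) rat_deriv_var A_def)
  qed (use g(3) in \<open>auto simp: simps\<close>)
  thus ?thesis using V by simp
qed

section \<open>The isomorphism\<close>

locale mpoly_evaluation = S: cring S for S :: "('c, 'l) ring_scheme" (structure) +
  fixes n :: nat and h :: "'k::field \<Rightarrow> 'c" and s :: "nat \<Rightarrow> 'c"
  assumes h: "h \<in> ring_hom ring_of_type_algebra S" and s_closed: "i \<in> {1..n} \<Longrightarrow> s i \<in> carrier S"
begin

text \<open>Variables with index outside \<open>{1..n}\<close> are sent to 1. With this convention
  the evaluation is additive and multiplicative on the whole polynomial type, whatever the support
  of its arguments.\<close>

definition mon :: "(nat \<Rightarrow>\<^sub>0 nat) \<Rightarrow> 'c" where
  "mon m = (\<Otimes>i\<in>{1..n}. s i [^] Poly_Mapping.lookup m i)"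

definition ev :: "'k mpoly \<Rightarrow> 'c" where
  "ev p = (\<Oplus>m\<in>Poly_Mapping.keys p. h (Poly_Mapping.lookup p m) \<otimes> mon m)"

lemma h_closed [simp]: "h c \<in> carrier S"
  using ring_hom_closed[OF h] by simp

lemma h_simps: "h (a + b) = h a \<oplus> h b" "h (a * b) = h a \<otimes> h b" "h 1 = \<one>"
  using ring_hom_add[OF h, of a b] ring_hom_mult[OF h, of a b] ring_hom_one[OF h] by simp_all

lemma h_0: "h 0 = \<zero>"
  using h_simps(1)[of 0 0] S.add.l_cancel_one[of "h 0" "h 0"] by simp

lemma mon_closed [simp]: "mon m \<in> carrier S"
  unfolding mon_def using s_closed by (intro S.finprod_closed) auto

lemma mon_0: "mon 0 = \<one>"
  unfolding mon_def using s_closed by (intro S.finprod_one_eqI) auto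

lemma mon_add: "mon (m + m') = mon m \<otimes> mon m'"
proof -
  have "mon (m + m') = (\<Otimes>i\<in>{1..n}. s i [^] Poly_Mapping.lookup m i \<otimes> s i [^] Poly_Mapping.lookup m' i)"
    unfolding mon_def using s_closed by (intro S.finprod_cong') (auto simp: lookup_add S.nat_pow_mult)
  thus ?thesis unfolding mon_def using s_closed by (simp add: S.finprod_multf Pi_def)
qed

lemma mon_single: "i \<in> {1..n} \<Longrightarrow> mon (Poly_Mapping.single i 1) = s i"
proof -
  assume i: "i \<in> {1..n}"
  have "mon (Poly_Mapping.single i 1) = (\<Otimes>j\<in>{1..n}. if i = j then s j else \<one>)"
    unfolding mon_def using s_closed
    by (intro S.finprod_cong') (auto simp: lookup_single when_def)
  also have "\<dots> = s i" by (rule S.finprod_singleton) (use i s_closed in auto)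
  finally show ?thesis .
qed

lemma ev_superset:
  assumes "finite Y" "Poly_Mapping.keys p \<subseteq> Y"
  shows "ev p = (\<Oplus>m\<in>Y. h (Poly_Mapping.lookup p m) \<otimes> mon m)"
  unfolding ev_def
  by (rule S.add.finprod_mono_neutral_cong_left)
    (use assms in \<open>auto simp: h_0 not_in_keys_iff_lookup_eq_zero\<close>)

lemma ev_closed [simp]: "ev p \<in> carrier S"
  unfolding ev_def by (intro S.finsum_closed) auto

lemma ev_add: "ev (p + q) = ev p \<oplus> ev q"
proof -
  let ?Y = "Poly_Mapping.keys p \<union> Poly_Mapping.keys q"
  have Y: "finite ?Y" by simp
  have "ev (p + q) = (\<Oplus>m\<in>?Y. h (Poly_Mapping.lookup (p + q) m) \<otimes> mon m)"
    by (rule ev_superset[OF Y keys_add])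
  also have "\<dots> = (\<Oplus>m\<in>?Y. h (Poly_Mapping.lookup p m) \<otimes> mon m \<oplus>
      h (Poly_Mapping.lookup q m) \<otimes> mon m)"
    by (rule S.finsum_cong') (auto simp: lookup_add h_simps S.l_distr)
  also have "\<dots> = (\<Oplus>m\<in>?Y. h (Poly_Mapping.lookup p m) \<otimes> mon m) \<oplus>
      (\<Oplus>m\<in>?Y. h (Poly_Mapping.lookup q m) \<otimes> mon m)"
    by (rule S.finsum_addf) auto
  finally show ?thesis using ev_superset[OF Y Un_upper1] ev_superset[OF Y Un_upper2] by simp
qed

lemma ev_single: "ev (Poly_Mapping.single m c) = h c \<otimes> mon m"
  by (cases "c = 0") (auto simp: ev_def h_0)

lemma ev_0: "ev 0 = \<zero>" by (simp add: ev_def)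

lemma ev_mult: "ev (p * q) = ev p \<otimes> ev q"
proof -
  have "Poly_Mapping.keys p \<subseteq> UNIV" "Poly_Mapping.keys q \<subseteq> UNIV" by auto
  thus ?thesis
  proof (induction p rule: poly_mapping_induct_add)
    case (single m c)
    show ?case using single(2)
      by (induction q rule: poly_mapping_induct_add)
        (simp_all add: mult_single ev_single mon_add h_simps ev_add ev_0 distrib_left S.r_distr S.m_ac)
  qed (simp_all add: ev_0 ev_add distrib_right S.l_distr)
qed

lemma ev_const: "ev (mpoly_const c) = h c" and ev_var: "i \<in> {1..n} \<Longrightarrow> ev (mpoly_var i) = s i"
  using s_closed by (simp_all add: mpoly_const_def mpoly_var_def ev_single mon_0 mon_single[unfolded One_nat_def] h_simps)

lemma ev_hom: "ev \<in> ring_hom (mpoly_ring n) S"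
  using ev_const[of 1] by (intro ring_hom_memI) (simp_all add: ev_add ev_mult mpoly_const_def h_simps)

end

section \<open>The algebra Lambda and its universal property\<close>

lemma carrier_FactRing: "carrier (R Quot I) = (\<lambda>x. I +>\<^bsub>R\<^esub> x) ` carrier R"
  by (auto simp: FactRing_def A_RCOSETS_def')

lemma quotient_ring_hom_lift:
  assumes h: "ring_hom_ring R S h" and I: "ideal I R" and kern: "\<And>x. x \<in> I \<Longrightarrow> h x = \<zero>\<^bsub>S\<^esub>"
  obtains g where "g \<in> ring_hom (R Quot I) S" "\<And>x. x \<in> carrier R \<Longrightarrow> g (I +>\<^bsub>R\<^esub> x) = h x"
proof
  interpret h: ring_hom_ring R S h by fact
  interpret I: ideal I R by fact
  interpret rc: ring_hom_ring R "R Quot I" "\<lambda>x. I +>\<^bsub>R\<^esub> x" by (rule I.rcos_ring_hom_ring)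
  define g where "g C = h (SOME x. x \<in> C)" for C
  show eq: "g (I +>\<^bsub>R\<^esub> x) = h x" if x: "x \<in> carrier R" for x
  proof -
    have "(SOME y. y \<in> I +>\<^bsub>R\<^esub> x) \<in> I +>\<^bsub>R\<^esub> x" by (rule someI[of _ x]) (rule I.a_rcos_self[OF x])
    then obtain k where k: "k \<in> I" "(SOME y. y \<in> I +>\<^bsub>R\<^esub> x) = k \<oplus>\<^bsub>R\<^esub> x" by (auto simp: a_r_coset_def')
    thus ?thesis using x kern[OF k(1)] I.Icarr[OF k(1)] by (simp add: g_def)
  qed
  show "g \<in> ring_hom (R Quot I) S"
  proof (rule ring_hom_memI)
    fix C assume "C \<in> carrier (R Quot I)"
    then obtain x where x: "C = I +>\<^bsub>R\<^esub> x" "x \<in> carrier R" unfolding carrier_FactRing by (rule imageE)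
    thus "g C \<in> carrier S" by (simp add: eq)
    fix C' assume "C' \<in> carrier (R Quot I)"
    then obtain y where y: "C' = I +>\<^bsub>R\<^esub> y" "y \<in> carrier R" unfolding carrier_FactRing by (rule imageE)
    show "g (C \<otimes>\<^bsub>R Quot I\<^esub> C') = g C \<otimes>\<^bsub>S\<^esub> g C'"
      using x y eq[of "x \<otimes>\<^bsub>R\<^esub> y"] eq[of x] eq[of y] rc.hom_mult[of x y] by simp
    show "g (C \<oplus>\<^bsub>R Quot I\<^esub> C') = g C \<oplus>\<^bsub>S\<^esub> g C'"
      using x y eq[of "x \<oplus>\<^bsub>R\<^esub> y"] eq[of x] eq[of y] rc.hom_add[of x y] by simp
  next
    show "g \<one>\<^bsub>R Quot I\<^esub> = \<one>\<^bsub>S\<^esub>" using eq[of "\<one>\<^bsub>R\<^esub>"] rc.hom_one by simp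
  qed
qed

lemma ideal_Lambda: "ideal (Lambda_ideal n :: 'k::field mpoly set) (mpoly_ring n)"
proof -
  interpret P: cring "mpoly_ring n :: 'k mpoly ring" by (rule mpoly_cring)
  show ?thesis unfolding Lambda_ideal_def
    by (rule P.genideal_ideal) (auto simp: power2_eq_square mpoly_closed)
qed

lemma Lambda_cring: "cring (Lambda_ring n :: 'k::field mpoly set ring)"
  unfolding Lambda_ring_def by (rule ideal.quotient_is_cring[OF ideal_Lambda mpoly_cring])

lemma Lambda_quotient_hom:
  "ring_hom_ring (mpoly_ring n :: 'k::field mpoly ring) (Lambda_ring n) (\<lambda>p. Lambda_ideal n +>\<^bsub>mpoly_ring n\<^esub> p)"
  unfolding Lambda_ring_def by (rule ideal.rcos_ring_hom_ring[OF ideal_Lambda])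

lemma Lambda_const_hom: "Lambda_const n \<in> ring_hom ring_of_type_algebra (Lambda_ring n)"
proof -
  interpret c: ring_hom_ring "mpoly_ring n :: 'a mpoly ring" "Lambda_ring n" "\<lambda>p. Lambda_ideal n +>\<^bsub>mpoly_ring n\<^esub> p"
    by (rule Lambda_quotient_hom)
  have "mpoly_const (a + b) = mpoly_const a + mpoly_const b" "mpoly_const (a * b) = mpoly_const a * mpoly_const b"
    for a b :: 'a by (simp_all add: mpoly_const_def single_add mult_single)
  moreover have "mpoly_const (1 :: 'a) = 1" by (simp add: mpoly_const_def)
  ultimately show ?thesis
    using c.hom_add[OF mpoly_closed(1) mpoly_closed(1)] c.hom_mult[OF mpoly_closed(1) mpoly_closed(1)] c.hom_one
      c.hom_closed[OF mpoly_closed(1)]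
    by (intro ring_hom_memI) (simp_all add: Lambda_const_def)
qed

lemma Lambda_var_closed: "i \<in> {1..n} \<Longrightarrow> (Lambda_var n i :: 'k::field mpoly set) \<in> carrier (Lambda_ring n)"
  using ring_hom_closed[OF ring_hom_ring.homh[OF Lambda_quotient_hom] mpoly_closed(2)]
  by (simp add: Lambda_var_def)

lemma Lambda_var_square:
  assumes i: "i \<in> {1..n}"
  shows "Lambda_var n i \<otimes>\<^bsub>Lambda_ring n\<^esub> Lambda_var n i = (\<zero>\<^bsub>Lambda_ring n\<^esub> :: 'k::field mpoly set)"
proof -
  interpret P: cring "mpoly_ring n :: 'k mpoly ring" by (rule mpoly_cring)
  interpret I: ideal "Lambda_ideal n :: 'k mpoly set" "mpoly_ring n" by (rule ideal_Lambda)
  interpret c: ring_hom_ring "mpoly_ring n :: 'k mpoly ring" "Lambda_ring n" "\<lambda>p. Lambda_ideal n +>\<^bsub>mpoly_ring n\<^esub> p"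
    by (rule Lambda_quotient_hom)
  have "{mpoly_var i ^ 2 | i. i \<in> {1..n}} \<subseteq> (Lambda_ideal n :: 'k mpoly set)"
    unfolding Lambda_ideal_def by (rule P.genideal_self) (auto simp: power2_eq_square mpoly_closed)
  hence "mpoly_var i * mpoly_var i \<in> (Lambda_ideal n :: 'k mpoly set)"
    using i by (auto simp: power2_eq_square)
  thus ?thesis
    using c.hom_mult[OF mpoly_closed(2)[OF i] mpoly_closed(2)[OF i]] I.a_rcos_const
    by (simp add: Lambda_var_def Lambda_ring_def FactRing_def)
qed

lemma Lambda_induct [consumes 1, case_names const var add mult]:
  fixes l :: "'k::field mpoly set"
  assumes "l \<in> carrier (Lambda_ring n)"
    and const: "\<And>c. P (Lambda_const n c)" and var: "\<And>i. i \<in> {1..n} \<Longrightarrow> P (Lambda_var n i)"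
    and add: "\<And>x y. x \<in> carrier (Lambda_ring n) \<Longrightarrow> y \<in> carrier (Lambda_ring n) \<Longrightarrow> P x \<Longrightarrow> P y \<Longrightarrow>
      P (x \<oplus>\<^bsub>Lambda_ring n\<^esub> y)"
    and mult: "\<And>x y. x \<in> carrier (Lambda_ring n) \<Longrightarrow> y \<in> carrier (Lambda_ring n) \<Longrightarrow> P x \<Longrightarrow> P y \<Longrightarrow>
      P (x \<otimes>\<^bsub>Lambda_ring n\<^esub> y)"
  shows "P l"
proof -
  interpret c: ring_hom_ring "mpoly_ring n :: 'k mpoly ring" "Lambda_ring n" "\<lambda>p. Lambda_ideal n +>\<^bsub>mpoly_ring n\<^esub> p"
    by (rule Lambda_quotient_hom)
  obtain p where p: "p \<in> carrier (mpoly_ring n)" "l = Lambda_ideal n +>\<^bsub>mpoly_ring n\<^esub> p"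
    using assms(1) unfolding Lambda_ring_def carrier_FactRing by blast
  have "P (Lambda_ideal n +>\<^bsub>mpoly_ring n\<^esub> p)" using p(1)
  proof (induction p rule: mpoly_induct)
    case (add p q)
    thus ?case using assms(4) c.hom_add[OF add(1,2)] by simp
  next
    case (mult p q)
    thus ?case using assms(5) c.hom_mult[OF mult(1,2)] by simp
  qed (use const var in \<open>simp_all add: Lambda_const_def Lambda_var_def\<close>)
  thus ?thesis using p by simp
qed

text \<open>Evaluation at the \<open>s i\<close> kills the generators \<open>S_i^2\<close> of the
  ideal, so its kernel contains the ideal and it factors through \<Lambda>.\<close>

lemma Lambda_lift:
  fixes h :: "'k::field \<Rightarrow> 'c" and s :: "nat \<Rightarrow> 'c"
  assumes S: "cring S" and h: "h \<in> ring_hom ring_of_type_algebra S"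
    and s: "\<And>i. i \<in> {1..n} \<Longrightarrow> s i \<in> carrier S" "\<And>i. i \<in> {1..n} \<Longrightarrow> s i \<otimes>\<^bsub>S\<^esub> s i = \<zero>\<^bsub>S\<^esub>"
  obtains g where "g \<in> ring_hom (Lambda_ring n) S" "\<And>c. g (Lambda_const n c) = h c"
    "\<And>i. i \<in> {1..n} \<Longrightarrow> g (Lambda_var n i) = s i"
proof -
  interpret P: cring "mpoly_ring n :: 'k mpoly ring" by (rule mpoly_cring)
  interpret S: cring S by fact
  interpret mpoly_evaluation S n h s
    by (intro mpoly_evaluation.intro mpoly_evaluation_axioms.intro S h s(1))
  interpret ev: ring_hom_ring "mpoly_ring n" S ev
    by (rule ring_hom_ringI2[OF P.ring_axioms S.ring_axioms ev_hom])
  have sq: "ev (mpoly_var i ^ 2) = \<zero>\<^bsub>S\<^esub>" if "i \<in> {1..n}" for i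
    unfolding power2_eq_square ev_mult ev_var[OF that] by (rule s(2)[OF that])
  have "Lambda_ideal n \<subseteq> a_kernel (mpoly_ring n) S ev"
    unfolding Lambda_ideal_def
  proof (rule P.genideal_minimal[OF ev.kernel_is_ideal], rule subsetI, elim CollectE exE conjE, hypsubst)
    fix i assume i: "i \<in> {1..n}"
    show "mpoly_var i ^ 2 \<in> a_kernel (mpoly_ring n) S ev"
      unfolding a_kernel_def' using sq[OF i] mpoly_closed(5)[OF mpoly_closed(2) mpoly_closed(2), OF i i]
      by (simp add: power2_eq_square)
  qed
  hence kern: "ev p = \<zero>\<^bsub>S\<^esub>" if "p \<in> Lambda_ideal n" for p using that unfolding a_kernel_def' by blast
  obtain g where g: "g \<in> ring_hom (Lambda_ring n) S"
    "\<And>p. p \<in> carrier (mpoly_ring n) \<Longrightarrow> g (Lambda_ideal n +>\<^bsub>mpoly_ring n\<^esub> p) = ev p"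
    using quotient_ring_hom_lift[OF ev.ring_hom_ring_axioms ideal_Lambda kern]
    unfolding Lambda_ring_def by metis
  show thesis
    by (rule that[OF g(1)])
      (simp_all add: Lambda_const_def Lambda_var_def g(2) mpoly_closed ev_const ev_var)
qed

text \<open>A homomorphism sends the inverse of \<open>x\<close> to an inverse of its image, and
  inverses in a commutative ring are unique. So agreement at \<open>x\<close> forces agreement at
  \<open>inverse x\<close>.\<close>

lemma ratfun_hom_eqI:
  fixes u v :: "'k::field ratfun \<Rightarrow> 'c"
  assumes M: "cring M" and u: "u \<in> ring_hom (ratfun_field n) M" and v: "v \<in> ring_hom (ratfun_field n) M"
    and const: "\<And>c. u (ratfun_const c) = v (ratfun_const c)"
    and var: "\<And>i. i \<in> {1..n} \<Longrightarrow> u (ratfun_var i) = v (ratfun_var i)"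
    and x: "x \<in> carrier (ratfun_field n)"
  shows "u x = v x"
  using x
proof (induction x rule: ratfun_induct)
  case (add x y) thus ?case using ring_hom_add[OF u, of x y] ring_hom_add[OF v, of x y] by simp
next
  case (mult x y) thus ?case using ring_hom_mult[OF u, of x y] ring_hom_mult[OF v, of x y] by simp
next
  case (inverse x)
  interpret M: cring M by fact
  let ?y = "inverse x"
  have y: "?y \<in> carrier (ratfun_field n)" using ratfun_closed2(4)[of x n] inverse by simp
  have 1: "u x \<otimes>\<^bsub>M\<^esub> u ?y = \<one>\<^bsub>M\<^esub>" "v x \<otimes>\<^bsub>M\<^esub> v ?y = \<one>\<^bsub>M\<^esub>"
    using ring_hom_mult[OF u inverse(1) y] ring_hom_mult[OF v inverse(1) y] ring_hom_one[OF u] ring_hom_one[OF v] inverse(2)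
    by simp_all
  have cl: "u x \<in> carrier M" "u ?y \<in> carrier M" "v ?y \<in> carrier M"
    using ring_hom_closed[OF u] ring_hom_closed[OF v] inverse(1) y by simp_all
  have "u ?y = u ?y \<otimes>\<^bsub>M\<^esub> (u x \<otimes>\<^bsub>M\<^esub> v ?y)" using 1(2) inverse.IH cl by simp
  also have "\<dots> = (u x \<otimes>\<^bsub>M\<^esub> u ?y) \<otimes>\<^bsub>M\<^esub> v ?y" using cl by (simp add: M.m_ac)
  finally show ?case using 1 cl by simp
qed (use const var in auto)

lemma (in Q_algebra) Q_ring_homI:
  assumes M: "cring M" and g: "abelian_group_hom Q M g"
    and one: "g \<one>\<^bsub>Q\<^esub> = \<one>\<^bsub>M\<^esub>"
    and mult: "\<And>a a' t b b' u. a \<in> carrier A \<Longrightarrow> a' \<in> carrier A \<Longrightarrow> t \<in> carrier A \<Longrightarrow>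
       b \<in> carrier A \<Longrightarrow> b' \<in> carrier A \<Longrightarrow> u \<in> carrier A \<Longrightarrow>
       g (q (a \<otimes>\<^bsub>A\<^esub> b) (a' \<otimes>\<^bsub>A\<^esub> b') (t \<otimes>\<^bsub>A\<^esub> u)) = g (q a a' t) \<otimes>\<^bsub>M\<^esub> g (q b b' u)"
  shows "g \<in> ring_hom Q M"
proof -
  interpret M: cring M by fact
  interpret g: abelian_group_hom Q M g by fact
  have "g (x \<otimes>\<^bsub>Q\<^esub> y) = g x \<otimes>\<^bsub>M\<^esub> g y" if "x \<in> carrier Q" "y \<in> carrier Q" for x y
    using that(1)
  proof (induction x rule: Q_induct)
    case zero thus ?case using that(2) by simp
  next
    case (gen a a' t)
    show ?case using that(2)
    proof (induction y rule: Q_induct)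
      case zero thus ?case using gen by simp
    next
      case (gen b b' u)
      thus ?case using \<open>a \<in> _\<close> \<open>a' \<in> _\<close> \<open>t \<in> _\<close> by (simp add: q_mult mult)
    next
      case (diff x y)
      thus ?case using gen by (simp add: a_minus_def Q.r_distr Q.r_minus M.r_distr M.r_minus)
    qed
  next
    case (diff x z)
    thus ?case using that(2) by (simp add: a_minus_def Q.l_distr Q.l_minus M.l_distr M.l_minus)
  qed
  thus ?thesis by (intro ring_hom_memI) (auto simp: one)
qed

text \<open>This is multiplication of dual numbers with \<open>s\<close> in the role of epsilon.
  When \<open>x'\<close> and \<open>y'\<close> are the derivatives of \<open>x\<close> and
  \<open>y\<close>, the coefficient of \<open>s\<close> is the Leibniz expression for the
  product.\<close>

lemma (in cring) dual_number_mult: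
  assumes "s \<in> carrier R" "s \<otimes> s = \<zero>"
    and "x \<in> carrier R" "x' \<in> carrier R" "y \<in> carrier R" "y' \<in> carrier R"
  shows "(x \<oplus> s \<otimes> x') \<otimes> (y \<oplus> s \<otimes> y') = x \<otimes> y \<oplus> s \<otimes> (x' \<otimes> y \<oplus> x \<otimes> y')"
proof -
  have "(s \<otimes> x') \<otimes> (s \<otimes> y') = (s \<otimes> s) \<otimes> (x' \<otimes> y')" using assms(1,3-) by (simp add: m_ac)
  hence 0: "(s \<otimes> x') \<otimes> (s \<otimes> y') = \<zero>" using assms by simp
  show ?thesis using assms by (simp add: l_distr r_distr 0) (simp add: m_ac a_ac)
qed

text \<open>The elements \<open>1 \<otimes> 1 \<otimes> T_i\<close> and
  \<open>T_i \<otimes> 1 \<otimes> 1\<close> have equal squares in \<open>Q\<close>; for them this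
  becomes the relation \<open>s_i^2 = 0\<close> that matches \<open>S_i^2 = 0\<close> in
  \<Lambda>.\<close>

lemma (in cring) square_sum_char2:
  assumes e: "e \<in> carrier R" and b: "b \<in> carrier R" and sq: "e \<otimes> e = b \<otimes> b"
    and double: "\<And>x. x \<in> carrier R \<Longrightarrow> x \<oplus> x = \<zero>"
  shows "(e \<oplus> b) \<otimes> (e \<oplus> b) = \<zero>"
proof -
  have "(e \<oplus> b) \<otimes> (e \<oplus> b) = (e \<otimes> e \<oplus> b \<otimes> b) \<oplus> (e \<otimes> b \<oplus> e \<otimes> b)"
    using e b by (simp add: l_distr r_distr m_comm a_ac)
  thus ?thesis using e b double[of "b \<otimes> b"] double[of "e \<otimes> b"] by (simp add: sq)
qed

text \<open>The \<open>itself\<close> parameter pins down the coefficient type, which occurs in no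
  other parameter.\<close>

locale ratfun_char2 =
  fixes n :: nat and k_type :: "'k::field itself"
  assumes char2: "CHAR('k) = 2"
begin

abbreviation K where "K \<equiv> (ring_of_type_algebra :: 'k ring)"
abbreviation \<iota> where "\<iota> \<equiv> (ratfun_const :: 'k \<Rightarrow> 'k ratfun)"
abbreviation A where "A \<equiv> (ratfun_field n :: 'k ratfun ring)"
abbreviation T where "T \<equiv> (ratfun_var :: nat \<Rightarrow> 'k ratfun)"
abbreviation \<Lambda> where "\<Lambda> \<equiv> (Lambda_ring n :: 'k mpoly set ring)"
abbreviation S where "S \<equiv> (Lambda_var n :: nat \<Rightarrow> 'k mpoly set)"
abbreviation Lc where "Lc \<equiv> (Lambda_const n :: 'k \<Rightarrow> 'k mpoly set)"

lemma Q_char2: "Q_char2 K \<iota> A"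
  by (intro Q_char2.intro Q_algebra.intro ratfun_cring Q_algebra_axioms.intro Q_char2_axioms.intro)
    (use ratfun_double[OF char2, of 1] in \<open>simp_all add: ratfun_closed\<close>)

interpretation Q: Q_char2 K \<iota> A by (rule Q_char2)
interpretation L: cring \<Lambda> by (rule Lambda_cring)

lemma Lc_closed: "Lc c \<in> carrier \<Lambda>" using ring_hom_closed[OF Lambda_const_hom] by simp

lemma B_tensor: "tensor_product K \<iota> A Lc \<Lambda>"
  by (intro tensor_product.intro tensor_product_axioms.intro ratfun_cring Lambda_cring)
    (simp_all add: ratfun_closed Lc_closed)

interpretation B: tensor_product K \<iota> A Lc \<Lambda> by (rule B_tensor)
interpretation BT: cring B.T by (rule B.T_cring)

abbreviation Q_mult (infixl "\<otimes>\<^sub>Q" 70) where "x \<otimes>\<^sub>Q y \<equiv> x \<otimes>\<^bsub>Q.Q\<^esub> y"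
abbreviation Q_add (infixl "\<oplus>\<^sub>Q" 65) where "x \<oplus>\<^sub>Q y \<equiv> x \<oplus>\<^bsub>Q.Q\<^esub> y"
abbreviation B_mult (infixl "\<otimes>\<^sub>B" 70) where "x \<otimes>\<^sub>B y \<equiv> x \<otimes>\<^bsub>B.T\<^esub> y"
abbreviation B_add (infixl "\<oplus>\<^sub>B" 65) where "x \<oplus>\<^sub>B y \<equiv> x \<oplus>\<^bsub>B.T\<^esub> y"
abbreviation bA where "bA a \<equiv> B.tn a \<one>\<^bsub>\<Lambda>\<^esub>"
abbreviation bL where "bL l \<equiv> B.tn \<one>\<^bsub>A\<^esub> l"

lemma A_1: "1 \<in> carrier A" and A_0: "0 \<in> carrier A" by (rule ratfun_closed)+

lemma A_mult: "a \<in> carrier A \<Longrightarrow> b \<in> carrier A \<Longrightarrow> a * b \<in> carrier A"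
  and A_add: "a \<in> carrier A \<Longrightarrow> b \<in> carrier A \<Longrightarrow> a + b \<in> carrier A"
  and A_deriv: "a \<in> carrier A \<Longrightarrow> rat_deriv i a \<in> carrier A"
  by (rule ratfun_closed2; assumption)+

lemma T_closed: "i \<in> {1..n} \<Longrightarrow> T i \<in> carrier A" and iota_closed: "\<iota> c \<in> carrier A"
  by (simp_all add: ratfun_closed)

lemma bA_hom: "bA \<in> ring_hom A B.T"
  by (rule ring_hom_memI)
    (use B.tensor_add_left B.tensor_mult[of _ "\<one>\<^bsub>\<Lambda>\<^esub>" _ "\<one>\<^bsub>\<Lambda>\<^esub>"] B.tensor_one in \<open>auto\<close>)

lemma bL_hom: "bL \<in> ring_hom \<Lambda> B.T"
  by (rule ring_hom_memI)
    (use B.tensor_add_right[of 1] B.tensor_mult[of 1 _ 1] B.tensor_one A_1 in \<open>auto\<close>)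

lemma tn_split: "a \<in> carrier A \<Longrightarrow> l \<in> carrier \<Lambda> \<Longrightarrow> B.tn a l = bA a \<otimes>\<^sub>B bL l"
  using B.tensor_mult[of a "\<one>\<^bsub>\<Lambda>\<^esub>" 1 l] A_1 by simp

lemma bA_const: "bL (Lc c) = bA (\<iota> c)"
  using B.tensor_balanced[of c 1 "\<one>\<^bsub>\<Lambda>\<^esub>"] A_1 Lc_closed by simp

lemma bA_closed: "a \<in> carrier A \<Longrightarrow> bA a \<in> carrier B.T"
  by simp

lemma bS_closed: "i \<in> {1..n} \<Longrightarrow> bL (S i) \<in> carrier B.T"
  by (rule B.tensor_closed[OF Q.A.one_closed Lambda_var_closed])

lemma bS_square:
  assumes i: "i \<in> {1..n}"
  shows "bL (S i) \<otimes>\<^sub>B bL (S i) = \<zero>\<^bsub>B.T\<^esub>"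
  using ring_hom_mult[OF bL_hom Lambda_var_closed[OF i] Lambda_var_closed[OF i]] Lambda_var_square[OF i]
    ring_hom_zero[OF bL_hom L.ring_axioms BT.ring_axioms] by metis

text \<open>The homomorphism \<open>T\<^sub>i \<mapsto> T\<^sub>i + S\<^sub>i\<close> as a Taylor expansion, one variable at a time; since
  \<open>S\<^sub>i\<^sup>2 = 0\<close>, the Leibniz rule makes \<open>a \<mapsto> a + S\<^sub>i \<partial>a/\<partial>T\<^sub>i\<close> multiplicative.\<close>

fun taylor :: "nat \<Rightarrow> 'k ratfun \<Rightarrow> ('k ratfun \<times> 'k mpoly set \<Rightarrow>\<^sub>0 int) set" where
  "taylor 0 a = bA a"
| "taylor (Suc k) a = taylor k a \<oplus>\<^sub>B bL (S (Suc k)) \<otimes>\<^sub>B taylor k (rat_deriv (Suc k) a)"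

text \<open>Each step is a dual-number extension by the next \<open>S\<close>. The bound
  \<open>k \<le> n\<close> ensures that this \<open>S\<close> is an element of \<Lambda> with square
  zero.\<close>

lemma taylor_hom: "k \<le> n \<Longrightarrow> taylor k \<in> ring_hom A B.T"
proof (induction k)
  case 0
  have "taylor 0 = bA" by (rule ext) simp
  thus ?case using bA_hom by simp
next
  case (Suc k)
  let ?s = "bL (S (Suc k))" and ?t = "taylor k" and ?d = "rat_deriv (Suc k)"
  have t: "?t \<in> ring_hom A B.T" using Suc by simp
  have s: "?s \<in> carrier B.T" "?s \<otimes>\<^sub>B ?s = \<zero>\<^bsub>B.T\<^esub>" using bS_closed bS_square Suc.prems by auto
  have tc: "?t a \<in> carrier B.T" if "a \<in> carrier A" for a by (rule ring_hom_closed[OF t that])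
  have tm: "?t (a * b) = ?t a \<otimes>\<^sub>B ?t b" "?t (a + b) = ?t a \<oplus>\<^sub>B ?t b"
    if "a \<in> carrier A" "b \<in> carrier A" for a b
    using ring_hom_mult[OF t that] ring_hom_add[OF t that] by simp_all
  note expand = BT.dual_number_mult[OF s, unfolded ratfun_simps(3)]
  show ?case
  proof (rule ring_hom_memI)
    fix a assume a: "a \<in> carrier A"
    show "taylor (Suc k) a \<in> carrier B.T" using a s tc A_deriv by simp
    fix b assume b: "b \<in> carrier A"
    show "taylor (Suc k) (a \<otimes>\<^bsub>A\<^esub> b) = taylor (Suc k) a \<otimes>\<^sub>B taylor (Suc k) b"
      using a b A_deriv[OF a, of "Suc k"] A_deriv[OF b, of "Suc k"]
      by (simp add: expand tc rat_deriv_mult tm A_mult)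
    show "taylor (Suc k) (a \<oplus>\<^bsub>A\<^esub> b) = taylor (Suc k) a \<oplus>\<^sub>B taylor (Suc k) b"
      using a b A_deriv[OF a, of "Suc k"] A_deriv[OF b, of "Suc k"] s(1)
      by (simp add: rat_deriv_add tm tc BT.r_distr BT.a_ac)
  next
    have "?d (1 :: 'k ratfun) = 0" using rat_deriv_const[of "Suc k" "1 :: 'k"]
      by (simp add: ratfun_const_def mpoly_const_def One_fract_def)
    moreover have "?t 0 = \<zero>\<^bsub>B.T\<^esub>" using ring_hom_zero[OF t Q.A.ring_axioms BT.ring_axioms] by simp
    moreover have "?t 1 = \<one>\<^bsub>B.T\<^esub>" using ring_hom_one[OF t] by simp
    ultimately show "taylor (Suc k) \<one>\<^bsub>A\<^esub> = \<one>\<^bsub>B.T\<^esub>" using s(1) by simp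
  qed
qed

lemma taylor_0: "k \<le> n \<Longrightarrow> taylor k 0 = \<zero>\<^bsub>B.T\<^esub>"
  using ring_hom_zero[OF taylor_hom Q.A.ring_axioms BT.ring_axioms] by simp

text \<open>All correction terms contain a derivative of \<open>c\<close>. Applied to squares and
  constants, this is what lets them pass between the two factors of \<open>Phi\<close>.\<close>

lemma taylor_deriv_0:
  assumes "c \<in> carrier A" "\<And>i. rat_deriv i c = 0"
  shows "k \<le> n \<Longrightarrow> taylor k c = bA c"
  by (induction k) (use assms taylor_0 bS_closed bA_closed in auto)

text \<open>Only the step with index \<open>i\<close> has a nonzero derivative of
  \<open>T i\<close>, namely 1, and it contributes a single \<open>S i\<close>.\<close>

lemma taylor_T:
  assumes i: "i \<in> {1..n}"
  shows "k \<le> n \<Longrightarrow> taylor k (T i) = bA (T i) \<oplus>\<^sub>B (if i \<le> k then bL (S i) else \<zero>\<^bsub>B.T\<^esub>)"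
proof (induction k)
  case 0 thus ?case using i bA_closed[OF T_closed[OF i]] by simp
next
  case (Suc k)
  have "taylor k 1 = \<one>\<^bsub>B.T\<^esub>" "taylor k 0 = \<zero>\<^bsub>B.T\<^esub>"
    using ring_hom_one[OF taylor_hom] taylor_0 Suc by auto
  moreover have "bL (S (Suc k)) \<in> carrier B.T" using Suc.prems by (intro bS_closed) simp
  moreover note Suc.IH bA_closed[OF T_closed[OF i]] bS_closed[OF i]
  ultimately show ?case using Suc.prems
    by (cases "i \<le> k"; cases "i = Suc k") (simp_all add: rat_deriv_var)
qed

section \<open>The homomorphism out of Q\<close>

definition Phi :: "'k ratfun Q \<Rightarrow> ('k ratfun \<times> 'k mpoly set \<Rightarrow>\<^sub>0 int) set" where
  "Phi = tensor_lift B.T (\<lambda>x t. taylor n (Q.m x) \<otimes>\<^sub>B bA t)"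

lemma taylor_closed: "a \<in> carrier A \<Longrightarrow> taylor n a \<in> carrier B.T"
  by (rule ring_hom_closed[OF taylor_hom]) auto

lemma taylor_mult: "a \<in> carrier A \<Longrightarrow> b \<in> carrier A \<Longrightarrow> taylor n (a * b) = taylor n a \<otimes>\<^sub>B taylor n b"
  using ring_hom_mult[OF taylor_hom, of n a b] by simp

lemma taylor_add: "a \<in> carrier A \<Longrightarrow> b \<in> carrier A \<Longrightarrow> taylor n (a + b) = taylor n a \<oplus>\<^sub>B taylor n b"
  using ring_hom_add[OF taylor_hom, of n a b] by simp

lemma bA_mult: "a \<in> carrier A \<Longrightarrow> b \<in> carrier A \<Longrightarrow> bA (a * b) = bA a \<otimes>\<^sub>B bA b"
  using ring_hom_mult[OF bA_hom, of a b] by simp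

lemma bA_add: "a \<in> carrier A \<Longrightarrow> b \<in> carrier A \<Longrightarrow> bA (a + b) = bA a \<oplus>\<^sub>B bA b"
  using ring_hom_add[OF bA_hom, of a b] by simp

lemma bA_1: "bA 1 = \<one>\<^bsub>B.T\<^esub>" and taylor_1: "taylor n 1 = \<one>\<^bsub>B.T\<^esub>"
  using ring_hom_one[OF bA_hom] ring_hom_one[OF taylor_hom, of n] by simp_all

lemma Phi_shiftable: "Q.shiftable B.T (\<lambda>b t. taylor n b \<otimes>\<^sub>B bA t)"
proof -
  have move: "taylor n (c * b) \<otimes>\<^sub>B bA t = taylor n b \<otimes>\<^sub>B bA (c * t)"
    if "c \<in> carrier A" "b \<in> carrier A" "t \<in> carrier A" "\<And>i. rat_deriv i c = 0" for b c t
    using that(1-3) taylor_closed[of b] bA_closed[of c] bA_closed[of t] taylor_deriv_0[OF that(1,4), of n]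
    by (simp add: taylor_mult bA_mult BT.m_ac)
  show ?thesis
    unfolding Q.shiftable_def
    using move rat_deriv_square[OF char2] rat_deriv_const iota_closed taylor_closed bA_closed
    by (auto simp: taylor_add bA_add BT.l_distr BT.r_distr A_mult)
qed

lemmas Phi_lift = Q.Q_lift[OF BT.abelian_group_axioms Phi_shiftable, OF refl, folded Phi_def]

lemma Phi_q: "a \<in> carrier A \<Longrightarrow> a' \<in> carrier A \<Longrightarrow> t \<in> carrier A \<Longrightarrow>
    Phi (Q.q a a' t) = taylor n (a * a') \<otimes>\<^sub>B bA t"
  using Phi_lift(2)[of a a' t] by simp

lemma Phi_hom: "Phi \<in> ring_hom Q.Q B.T"
proof (rule Q.Q_ring_homI[OF BT.is_cring Phi_lift(1)])
  show "Phi \<one>\<^bsub>Q.Q\<^esub> = \<one>\<^bsub>B.T\<^esub>" using A_1 by (simp add: Q.q_one Phi_q bA_1 taylor_1)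
next
  fix a a' t b b' u
  assume *: "a \<in> carrier A" "a' \<in> carrier A" "t \<in> carrier A" "b \<in> carrier A" "b' \<in> carrier A" "u \<in> carrier A"
  thus "Phi (Q.q (a \<otimes>\<^bsub>A\<^esub> b) (a' \<otimes>\<^bsub>A\<^esub> b') (t \<otimes>\<^bsub>A\<^esub> u)) = Phi (Q.q a a' t) \<otimes>\<^sub>B Phi (Q.q b b' u)"
    using taylor_closed bA_closed by (simp add: Phi_q A_mult taylor_mult bA_mult BT.m_ac)
qed

section \<open>The homomorphism into Q and uniqueness\<close>

abbreviation sQ where "sQ i \<equiv> Q.em (T i) \<oplus>\<^sub>Q Q.br (T i)"

lemma em_closed: "a \<in> carrier A \<Longrightarrow> Q.em a \<in> carrier Q.Q" and br_closed: "a \<in> carrier A \<Longrightarrow> Q.br a \<in> carrier Q.Q"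
  using A_1 by simp_all

lemma sQ_closed: "i \<in> {1..n} \<Longrightarrow> sQ i \<in> carrier Q.Q"
  using em_closed[OF T_closed] br_closed[OF T_closed] by simp

lemma sQ_square:
  assumes "i \<in> {1..n}"
  shows "sQ i \<otimes>\<^sub>Q sQ i = \<zero>\<^bsub>Q.Q\<^esub>"
proof -
  let ?e = "Q.em (T i)" and ?b = "Q.br (T i)"
  have c: "T i \<in> carrier A" "?e \<in> carrier Q.Q" "?b \<in> carrier Q.Q"
    using assms T_closed em_closed br_closed by auto
  have "?e \<otimes>\<^sub>Q ?e = ?b \<otimes>\<^sub>Q ?b"
    using Q.br_sq[OF c(1)] ring_hom_mult[OF Q.em_hom c(1) c(1)] by metis
  thus ?thesis by (rule Q.Q.square_sum_char2[OF c(2,3) _ Q.Q_double])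
qed

lemma iota_hom: "\<iota> \<in> ring_hom K A" by (rule ratfun_const_hom)

text \<open>Since the \<open>sQ i\<close> have square zero, the \<Lambda>-factor maps to
  \<open>Q\<close> by its universal property, while the \<open>A\<close>-factor maps by
  \<open>em\<close>. Both restrict to the same map on constants, so they combine to a map on the
  tensor product.\<close>

lemma Psi_exists:
  "\<exists>\<Psi>\<in>ring_hom B.T Q.Q. (\<forall>a\<in>carrier A. \<Psi> (bA a) = Q.em a) \<and> (\<forall>i\<in>{1..n}. \<Psi> (bL (S i)) = sQ i)"
proof -
  have h: "(\<lambda>c. Q.em (\<iota> c)) \<in> ring_hom K Q.Q"
    using ring_hom_trans[OF iota_hom Q.em_hom] by (simp add: comp_def)
  obtain g where g: "g \<in> ring_hom \<Lambda> Q.Q" "\<And>c. g (Lc c) = Q.em (\<iota> c)" "\<And>i. i \<in> {1..n} \<Longrightarrow> g (S i) = sQ i"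
    using Lambda_lift[where n = n and s = "\<lambda>i. sQ i", OF Q.Q.is_cring h sQ_closed sQ_square] by blast
  have gc: "g l \<in> carrier Q.Q" if "l \<in> carrier \<Lambda>" for l by (rule ring_hom_closed[OF g(1) that])
  let ?\<beta> = "\<lambda>a l. Q.em a \<otimes>\<^sub>Q g l"
  have em: "Q.em (a * b) = Q.em a \<otimes>\<^sub>Q Q.em b" "Q.em (a + b) = Q.em a \<oplus>\<^sub>Q Q.em b"
    if "a \<in> carrier A" "b \<in> carrier A" for a b
    using ring_hom_mult[OF Q.em_hom that] ring_hom_add[OF Q.em_hom that] by simp_all
  note em = em[unfolded ratfun_simps(3)]
  have bal: "balanced K \<iota> A Lc \<Lambda> Q.Q ?\<beta>"
  proof (rule B.balancedI)
    fix r a l assume "a \<in> carrier A" "l \<in> carrier \<Lambda>"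
    thus "?\<beta> (\<iota> r \<otimes>\<^bsub>A\<^esub> a) l = ?\<beta> a (Lc r \<otimes>\<^bsub>\<Lambda>\<^esub> l)"
      using ring_hom_mult[OF g(1) Lc_closed, of l r] gc em_closed iota_closed
      by (simp add: em g(2) Q.Q.m_ac)
  qed (use gc em_closed ring_hom_add[OF g(1)] in \<open>auto simp: em Q.Q.l_distr Q.Q.r_distr\<close>)
  interpret l: tensor_lifting K \<iota> A Lc \<Lambda> Q.Q
    by (intro tensor_lifting.intro B_tensor Q.Q.abelian_group_axioms)
  let ?P = "tensor_lift Q.Q ?\<beta>"
  have em1: "Q.em 1 = \<one>\<^bsub>Q.Q\<^esub>" using ring_hom_one[OF Q.em_hom] by simp
  note em1 = em1[unfolded ratfun_simps(3)]
  have g1: "g \<one>\<^bsub>\<Lambda>\<^esub> = \<one>\<^bsub>Q.Q\<^esub>" by (rule ring_hom_one[OF g(1)])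
  have "?P \<in> ring_hom B.T Q.Q"
    by (rule B.lift_ring_hom[OF Q.Q.is_cring bal])
      (use gc em_closed ring_hom_mult[OF g(1)] in \<open>auto simp: em em1 g1 Q.Q.m_ac\<close>)
  moreover have "?P (bA a) = Q.em a" if "a \<in> carrier A" for a
    using l.lift_tensor[OF bal that L.one_closed] em_closed[OF that] by (simp add: g1)
  moreover have "?P (bL (S i)) = sQ i" if "i \<in> {1..n}" for i
    using l.lift_tensor[OF bal _ Lambda_var_closed[OF that], of 1] A_1 sQ_closed[OF that] by (simp add: g(3)[OF that] em1)
  ultimately show ?thesis by blast
qed

text \<open>The ring is generated by the images of \<open>em\<close> and \<open>br\<close>. These
  agree on constants, so a single condition on constants serves both images.\<close>

lemma Q_hom_eqI:
  assumes M: "cring M" and u: "u \<in> ring_hom Q.Q M" and v: "v \<in> ring_hom Q.Q M"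
    and const: "\<And>c. u (Q.em (\<iota> c)) = v (Q.em (\<iota> c))"
    and br: "\<And>i. i \<in> {1..n} \<Longrightarrow> u (Q.br (T i)) = v (Q.br (T i))"
    and em: "\<And>i. i \<in> {1..n} \<Longrightarrow> u (Q.em (T i)) = v (Q.em (T i))"
    and x: "x \<in> carrier Q.Q"
  shows "u x = v x"
proof -
  interpret M: cring M by fact
  have e: "u (Q.em a) = v (Q.em a)" if "a \<in> carrier A" for a
    by (rule ratfun_hom_eqI[OF M _ _ _ _ that])
      (use ring_hom_trans[OF Q.em_hom u] ring_hom_trans[OF Q.em_hom v] const em in \<open>auto simp: comp_def\<close>)
  have b: "u (Q.br a) = v (Q.br a)" if "a \<in> carrier A" for a
    by (rule ratfun_hom_eqI[OF M _ _ _ _ that])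
      (use ring_hom_trans[OF Q.br_hom u] ring_hom_trans[OF Q.br_hom v] const br Q.br_const in \<open>auto simp: comp_def\<close>)
  interpret u: ring_hom_ring Q.Q M u by (rule ring_hom_ringI2[OF Q.Q.ring_axioms M.ring_axioms u])
  interpret v: ring_hom_ring Q.Q M v by (rule ring_hom_ringI2[OF Q.Q.ring_axioms M.ring_axioms v])
  show ?thesis using x
  proof (induction x rule: Q.Q_induct)
    case zero thus ?case by simp
  next
    case (gen a a' t)
    thus ?case using em_closed[of t] br_closed[of "a * a'"] e[of t] b[of "a * a'"] A_mult[of a a']
      by (simp add: Q.q_eq_br)
  next
    case (diff x y) thus ?case by (simp add: a_minus_def)
  qed
qed

lemma B_hom_eqI:
  assumes M: "cring M" and u: "u \<in> ring_hom B.T M" and v: "v \<in> ring_hom B.T M"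
    and const: "\<And>c. u (bA (\<iota> c)) = v (bA (\<iota> c))"
    and T: "\<And>i. i \<in> {1..n} \<Longrightarrow> u (bA (T i)) = v (bA (T i))"
    and S: "\<And>i. i \<in> {1..n} \<Longrightarrow> u (bL (S i)) = v (bL (S i))"
    and x: "x \<in> carrier B.T"
  shows "u x = v x"
proof -
  interpret M: cring M by fact
  have a: "u (bA a) = v (bA a)" if "a \<in> carrier A" for a
    by (rule ratfun_hom_eqI[OF M _ _ _ _ that])
      (use ring_hom_trans[OF bA_hom u] ring_hom_trans[OF bA_hom v] const T in \<open>auto simp: comp_def\<close>)
  have uL: "(\<lambda>l. u (bL l)) \<in> ring_hom \<Lambda> M" "(\<lambda>l. v (bL l)) \<in> ring_hom \<Lambda> M"
    using ring_hom_trans[OF bL_hom u] ring_hom_trans[OF bL_hom v] by (simp_all add: comp_def)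
  have l: "u (bL l) = v (bL l)" if "l \<in> carrier \<Lambda>" for l
    using that
  proof (induction l rule: Lambda_induct)
    case (const c) thus ?case using assms(4)[of c] by (simp only: bA_const)
  next
    case (var i) thus ?case by (rule S)
  next
    case (add x y) thus ?case using ring_hom_add[OF uL(1) add(1,2)] ring_hom_add[OF uL(2) add(1,2)] by simp
  next
    case (mult x y) thus ?case using ring_hom_mult[OF uL(1) mult(1,2)] ring_hom_mult[OF uL(2) mult(1,2)] by simp
  qed
  interpret u: ring_hom_ring B.T M u by (rule ring_hom_ringI2[OF BT.ring_axioms M.ring_axioms u])
  interpret v: ring_hom_ring B.T M v by (rule ring_hom_ringI2[OF BT.ring_axioms M.ring_axioms v])
  show ?thesis using x
  proof (induction x rule: B.tensor_induct)
    case zero thus ?case by simp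
  next
    case (gen x y)
    thus ?case using a[of x] l[of y] tn_split[of x y] A_1 by simp
  next
    case (diff x y) thus ?case by (simp add: a_minus_def)
  qed
qed

section \<open>The augmentation ideal\<close>

abbreviation QA where "QA \<equiv> Q_alg K \<iota> A"
abbreviation I where "I \<equiv> aug_ideal K \<iota> A"
abbreviation W where "W \<equiv> W_mod K \<iota> A"
abbreviation eps where "eps \<equiv> Q_aug A"

lemma Q_alg_simps [simp]:
  "carrier QA = carrier Q.Q" "x \<otimes>\<^bsub>QA\<^esub> y = x \<otimes>\<^sub>Q y" "x \<oplus>\<^bsub>QA\<^esub> y = x \<oplus>\<^sub>Q y"
  "\<one>\<^bsub>QA\<^esub> = \<one>\<^bsub>Q.Q\<^esub>" "\<zero>\<^bsub>QA\<^esub> = \<zero>\<^bsub>Q.Q\<^esub>" "a \<odot>\<^bsub>QA\<^esub> x = Q.em a \<otimes>\<^sub>Q x"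
  by (simp_all add: Q_alg_def ring.defs module.defs)

lemma ring_hom_Q_alg: "ring_hom QA M = ring_hom Q.Q M" "ring_hom M QA = ring_hom M Q.Q"
  by (simp_all add: ring_hom_def)

lemma W_simps [simp]:
  "carrier W = I" "x \<oplus>\<^bsub>W\<^esub> y = x \<oplus>\<^sub>Q y" "\<zero>\<^bsub>W\<^esub> = \<zero>\<^bsub>Q.Q\<^esub>" "a \<odot>\<^bsub>W\<^esub> x = Q.em a \<otimes>\<^sub>Q x"
  using Q_alg_simps by (simp_all add: W_mod_def)

lemma Phi_Psi:
  obtains \<Phi> \<Psi> where "\<Phi> \<in> ring_hom Q.Q B.T" "\<Psi> \<in> ring_hom B.T Q.Q"
    "\<And>c. \<Phi> (Q.em (\<iota> c)) = bA (\<iota> c)" "\<And>c. \<Psi> (bA (\<iota> c)) = Q.em (\<iota> c)"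
    "\<And>i. i \<in> {1..n} \<Longrightarrow> \<Phi> (Q.br (T i)) = bA (T i) \<oplus>\<^sub>B bL (S i)"
    "\<And>i. i \<in> {1..n} \<Longrightarrow> \<Phi> (Q.q \<one>\<^bsub>A\<^esub> (T i) \<one>\<^bsub>A\<^esub>) = bA (T i) \<oplus>\<^sub>B bL (S i)"
    "\<And>i. i \<in> {1..n} \<Longrightarrow> \<Phi> (Q.em (T i)) = bA (T i)"
    "\<And>i. i \<in> {1..n} \<Longrightarrow> \<Psi> (bA (T i)) = Q.em (T i)"
    "\<And>i. i \<in> {1..n} \<Longrightarrow> \<Psi> (bL (S i)) = sQ i"
    "\<And>x. x \<in> carrier Q.Q \<Longrightarrow> \<Psi> (\<Phi> x) = x" "\<And>y. y \<in> carrier B.T \<Longrightarrow> \<Phi> (\<Psi> y) = y"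
proof -
  obtain \<Psi> where \<Psi>: "\<Psi> \<in> ring_hom B.T Q.Q" "\<And>a. a \<in> carrier A \<Longrightarrow> \<Psi> (bA a) = Q.em a"
    "\<And>i. i \<in> {1..n} \<Longrightarrow> \<Psi> (bL (S i)) = sQ i"
    using Psi_exists by blast
  have em: "Phi (Q.em a) = bA a" if "a \<in> carrier A" for a
    using Phi_q[OF A_1 A_1 that] bA_closed[OF that] by (simp add: taylor_1)
  have tT: "taylor n (T i) = bA (T i) \<oplus>\<^sub>B bL (S i)" if "i \<in> {1..n}" for i
    using taylor_T[OF that, of n] that by simp
  have cl: "bA (T i) \<oplus>\<^sub>B bL (S i) \<in> carrier B.T" if "i \<in> {1..n}" for i
    using bA_closed[OF T_closed] bS_closed that by blast
  have br: "Phi (Q.br (T i)) = bA (T i) \<oplus>\<^sub>B bL (S i)" if "i \<in> {1..n}" for i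
    using Phi_q[OF T_closed[OF that] A_1 A_1] cl[OF that] tT[OF that] by (simp add: bA_1)
  have br': "Phi (Q.q \<one>\<^bsub>A\<^esub> (T i) \<one>\<^bsub>A\<^esub>) = bA (T i) \<oplus>\<^sub>B bL (S i)" if "i \<in> {1..n}" for i
    using br[OF that] Q.br_swap[OF T_closed[OF that]] by simp
  \<comment> \<open>In characteristic 2 adding \<open>T_i\<close> twice cancels. This recovers
    \<open>T_i \<otimes> 1 \<otimes> 1\<close> from \<open>s_i\<close>, and \<open>S_i\<close> from
    \<open>T_i + S_i\<close>.\<close>
  have double: "x \<oplus>\<^sub>Q (x \<oplus>\<^sub>Q y) = y" if "x \<in> carrier Q.Q" "y \<in> carrier Q.Q" for x y
    using that Q.Q_double[of x] by (simp add: Q.Q.a_assoc[symmetric])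
  have double_B: "x \<oplus>\<^sub>B (x \<oplus>\<^sub>B y) = y" if "x \<in> carrier B.T" "y \<in> carrier B.T" for x y
  proof -
    have "\<one>\<^bsub>B.T\<^esub> \<oplus>\<^sub>B \<one>\<^bsub>B.T\<^esub> = bA (1 + 1)" by (simp only: bA_add A_1 bA_1)
    also have "\<dots> = \<zero>\<^bsub>B.T\<^esub>"
      using ring_hom_zero[OF bA_hom Q.A.ring_axioms BT.ring_axioms] by (simp only: ratfun_double[OF char2] ratfun_simps)
    finally have "x \<oplus>\<^sub>B x = \<zero>\<^bsub>B.T\<^esub>" using BT.l_distr[of "\<one>\<^bsub>B.T\<^esub>" "\<one>\<^bsub>B.T\<^esub>" x] that by simp
    thus ?thesis using that by (simp add: BT.a_assoc[symmetric])
  qed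
  have idQ: "(\<lambda>x. x) \<in> ring_hom Q.Q Q.Q" and idB: "(\<lambda>x. x) \<in> ring_hom B.T B.T"
    by (simp_all add: ring_hom_def)
  have QQ: "\<Psi> \<circ> Phi \<in> ring_hom Q.Q Q.Q" and BB: "Phi \<circ> \<Psi> \<in> ring_hom B.T B.T"
    using ring_hom_trans[OF Phi_hom \<Psi>(1)] ring_hom_trans[OF \<Psi>(1) Phi_hom] by simp_all
  have "\<Psi> (Phi x) = x" if "x \<in> carrier Q.Q" for x
  proof -
    have "(\<Psi> \<circ> Phi) x = x"
    proof (rule Q_hom_eqI[OF Q.Q.is_cring QQ idQ _ _ _ that])
      show "(\<Psi> \<circ> Phi) (Q.em (\<iota> c)) = Q.em (\<iota> c)" for c
        using em[OF iota_closed] \<Psi>(2)[OF iota_closed] by (metis comp_apply)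
      fix i assume i: "i \<in> {1..n}"
      show "(\<Psi> \<circ> Phi) (Q.em (T i)) = Q.em (T i)"
        using em[OF T_closed[OF i]] \<Psi>(2)[OF T_closed[OF i]] by (metis comp_apply)
      have "(\<Psi> \<circ> Phi) (Q.br (T i)) = Q.em (T i) \<oplus>\<^sub>Q sQ i"
        using br[OF i] ring_hom_add[OF \<Psi>(1) bA_closed[OF T_closed[OF i]] bS_closed[OF i]]
          \<Psi>(2)[OF T_closed[OF i]] \<Psi>(3)[OF i] by (metis comp_apply)
      also have "\<dots> = Q.br (T i)"
        by (rule double[OF em_closed[OF T_closed[OF i]] br_closed[OF T_closed[OF i]]])
      finally show "(\<Psi> \<circ> Phi) (Q.br (T i)) = Q.br (T i)" .
    qed
    thus ?thesis by simp
  qed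
  moreover have "Phi (\<Psi> y) = y" if "y \<in> carrier B.T" for y
  proof -
    have "(Phi \<circ> \<Psi>) y = y"
    proof (rule B_hom_eqI[OF BT.is_cring BB idB _ _ _ that])
      show "(Phi \<circ> \<Psi>) (bA (\<iota> c)) = bA (\<iota> c)" for c
        using em[OF iota_closed] \<Psi>(2)[OF iota_closed] by (metis comp_apply)
      fix i assume i: "i \<in> {1..n}"
      show "(Phi \<circ> \<Psi>) (bA (T i)) = bA (T i)"
        using em[OF T_closed[OF i]] \<Psi>(2)[OF T_closed[OF i]] by (metis comp_apply)
      have "(Phi \<circ> \<Psi>) (bL (S i)) = bA (T i) \<oplus>\<^sub>B (bA (T i) \<oplus>\<^sub>B bL (S i))"
        using ring_hom_add[OF Phi_hom em_closed[OF T_closed[OF i]] br_closed[OF T_closed[OF i]]]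
          em[OF T_closed[OF i]] br[OF i] \<Psi>(3)[OF i] by (metis comp_apply)
      also have "\<dots> = bL (S i)"
        by (rule double_B[OF bA_closed[OF T_closed[OF i]] bS_closed[OF i]])
      finally show "(Phi \<circ> \<Psi>) (bL (S i)) = bL (S i)" .
    qed
    thus ?thesis by simp
  qed
  ultimately show thesis
    by (intro that[OF Phi_hom \<Psi>(1)] em[OF iota_closed] \<Psi>(2)[OF iota_closed] br br'
        em[OF T_closed] \<Psi>(2)[OF T_closed] \<Psi>(3))
qed

text \<open>The augmentation is the lift attached to the identity operator, just as the functionals
  \<open>lam\<close> are attached to the mixed derivatives.\<close>

lemma eps_shiftable: "Q.shiftable A (\<lambda>b t. b \<otimes>\<^bsub>A\<^esub> t)"
  by (simp add: Q.shiftable_def A_mult algebra_simps)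

lemma eps_hom: "abelian_group_hom Q.Q A eps"
  and eps_q: "a \<in> carrier A \<Longrightarrow> a' \<in> carrier A \<Longrightarrow> t \<in> carrier A \<Longrightarrow> eps (Q.q a a' t) = a * a' * t"
  using Q.Q_lift[OF Q.A.abelian_group_axioms eps_shiftable, OF refl, folded Q_aug_def] by simp_all

lemma eps_ring_hom: "eps \<in> ring_hom Q.Q A"
  by (rule Q.Q_ring_homI[OF ratfun_cring eps_hom])
    (simp_all add: Q.q_one eps_q A_1 A_mult algebra_simps)

lemma eps_simps:
  assumes "x \<in> carrier Q.Q" "y \<in> carrier Q.Q"
  shows "eps (x \<otimes>\<^sub>Q y) = eps x * eps y" "eps (x \<oplus>\<^sub>Q y) = eps x + eps y" "eps x \<in> carrier A"
  using ring_hom_mult[OF eps_ring_hom assms] ring_hom_add[OF eps_ring_hom assms]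
    ring_hom_closed[OF eps_ring_hom assms(1)] by simp_all

lemma eps_em: "a \<in> carrier A \<Longrightarrow> eps (Q.em a) = a"
  using eps_q[of 1 1 a] A_1 by simp

lemma eps_sQ: "i \<in> {1..n} \<Longrightarrow> eps (sQ i) = 0"
  using eps_simps(2)[OF em_closed br_closed, OF T_closed T_closed, of i i] eps_q[of 1 1 "T i"] eps_q[of "T i" 1 1]
    A_1 T_closed[of i] ratfun_double[OF char2, of "T i"] by simp

lemma I_iff: "x \<in> I \<longleftrightarrow> x \<in> carrier Q.Q \<and> eps x = 0"
  by (simp add: aug_ideal_def a_kernel_def')

lemma Q_alg_module: "module A QA"
proof (rule moduleI)
  show "cring A" by (rule ratfun_cring)
  show "abelian_group QA"
    by (rule abelian_groupI)
      (use Q.Q.add.inv_closed Q.Q.l_neg in \<open>auto simp: Q.Q.a_ac\<close>)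
qed (use em_closed ring_hom_mult[OF Q.em_hom] ring_hom_add[OF Q.em_hom] ring_hom_one[OF Q.em_hom] in
    \<open>simp_all add: Q.Q.l_distr Q.Q.r_distr Q.Q.m_assoc del: ratfun_simps\<close>)

lemma I_closed:
  "\<zero>\<^bsub>Q.Q\<^esub> \<in> I" "x \<in> I \<Longrightarrow> y \<in> I \<Longrightarrow> x \<oplus>\<^sub>Q y \<in> I" "x \<in> carrier Q.Q \<Longrightarrow> y \<in> I \<Longrightarrow> x \<otimes>\<^sub>Q y \<in> I"
  using ring_hom_zero[OF eps_ring_hom Q.Q.ring_axioms Q.A.ring_axioms] by (simp_all add: I_iff eps_simps)

lemma W_vectorspace: "vectorspace A W"
proof -
  interpret M: module A QA by (rule Q_alg_module)
  have "LinearCombinations.submodule A I QA"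
    by (intro LinearCombinations.submodule.intro Q_alg_module)
      (use I_closed em_closed in \<open>auto simp: I_iff[THEN iffD1]\<close>)
  hence "module A W" unfolding W_mod_def by (rule M.submodule_is_module)
  thus ?thesis by (intro vectorspace.intro ratfun_is_field)
qed

text \<open>For \<open>J = {}\<close> this is the augmentation; the functionals for nonempty
  \<open>J\<close> become the coordinates on \<open>W\<close>.\<close>

definition lam :: "nat set \<Rightarrow> 'k ratfun Q \<Rightarrow> 'k ratfun" where
  "lam J = tensor_lift A (\<lambda>x t. multi_deriv n J (Q.m x) \<otimes>\<^bsub>A\<^esub> t)"

lemma lam_shiftable: "Q.shiftable A (\<lambda>b t. multi_deriv n J b \<otimes>\<^bsub>A\<^esub> t)"
proof -
  have move: "multi_deriv n J (c * b) * t = multi_deriv n J b * (c * t)" if "\<And>i. rat_deriv i c = 0" for c b t :: "'k ratfun"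
    using multi_deriv_linear[OF that] by (simp add: algebra_simps)
  show ?thesis
    using move[OF rat_deriv_square[OF char2]] move[OF rat_deriv_const]
    by (auto simp: Q.shiftable_def A_mult multi_deriv_closed multi_deriv_add algebra_simps)
qed

lemma lam_hom: "abelian_group_hom Q.Q A (lam J)"
  and lam_q: "a \<in> carrier A \<Longrightarrow> a' \<in> carrier A \<Longrightarrow> t \<in> carrier A \<Longrightarrow>
    lam J (Q.q a a' t) = multi_deriv n J (a * a') * t"
  using Q.Q_lift[OF Q.A.abelian_group_axioms lam_shiftable, OF refl, folded lam_def] by simp_all

lemma A_minus: "a \<in> carrier A \<Longrightarrow> b \<in> carrier A \<Longrightarrow> a \<ominus>\<^bsub>A\<^esub> b = a + b"
  using Q.A_minus[of b] by (simp add: a_minus_def)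

lemma lam_closed: "x \<in> carrier Q.Q \<Longrightarrow> lam J x \<in> carrier A"
  using abelian_group_hom.hom_closed[OF lam_hom] .

lemma lam_diff: "x \<in> carrier Q.Q \<Longrightarrow> y \<in> carrier Q.Q \<Longrightarrow> lam J (x \<ominus>\<^bsub>Q.Q\<^esub> y) = lam J x + lam J y"
  using abelian_group_hom_minus[OF lam_hom] A_minus lam_closed by simp

lemma lam_add: "x \<in> carrier Q.Q \<Longrightarrow> y \<in> carrier Q.Q \<Longrightarrow> lam J (x \<oplus>\<^sub>Q y) = lam J x + lam J y"
  using abelian_group_hom.hom_add[OF lam_hom, of x y J] by simp

lemma lam_0: "lam J \<zero>\<^bsub>Q.Q\<^esub> = 0"
  using abelian_group_hom.hom_zero[OF lam_hom, of J] by simp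

lemma Q_minus_distr:
  "z \<in> carrier Q.Q \<Longrightarrow> x \<in> carrier Q.Q \<Longrightarrow> y \<in> carrier Q.Q \<Longrightarrow>
    z \<otimes>\<^sub>Q (x \<ominus>\<^bsub>Q.Q\<^esub> y) = z \<otimes>\<^sub>Q x \<ominus>\<^bsub>Q.Q\<^esub> z \<otimes>\<^sub>Q y"
  by (simp add: a_minus_def Q.Q.r_distr Q.Q.r_minus)

lemma lam_em:
  assumes c: "c \<in> carrier A" and x: "x \<in> carrier Q.Q"
  shows "lam J (Q.em c \<otimes>\<^sub>Q x) = c * lam J x"
  using x
proof (induction x rule: Q.Q_induct)
  case zero thus ?case using em_closed[OF c] by (simp add: lam_0)
next
  case (gen a a' t)
  have "Q.em c \<otimes>\<^sub>Q Q.q a a' t = Q.q a a' (c * t)"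
    using Q.q_mult[OF A_1 A_1 c gen] gen by simp
  thus ?case using gen c by (simp add: lam_q A_mult mult.left_commute)
next
  case (diff x y)
  thus ?case using em_closed[OF c] Q_minus_distr[of "Q.em c" x y] by (simp add: lam_diff distrib_left)
qed

text \<open>On \<open>a \<otimes> a' \<otimes> t\<close> the summand \<open>em (T i)\<close> of
  \<open>sQ i\<close> multiplies outside the derivative and \<open>br (T i)\<close> multiplies
  inside it. Their sum is the commutator computed in \<open>multi_deriv_commutator\<close>.\<close>

lemma lam_sQ:
  assumes i: "i \<in> {1..n}" and x: "x \<in> carrier Q.Q"
  shows "lam J (sQ i \<otimes>\<^sub>Q x) = (if i \<in> J then lam (J - {i}) x else 0)"
  using x
proof (induction x rule: Q.Q_induct)
  case zero thus ?case using sQ_closed[OF i] by (simp add: lam_0)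
next
  case (gen a a' t)
  note T = T_closed[OF i]
  have 1: "Q.em (T i) \<otimes>\<^sub>Q Q.q a a' t = Q.q a a' (T i * t)"
    using Q.q_mult[OF A_1 A_1 T gen] gen by simp
  have 2: "Q.br (T i) \<otimes>\<^sub>Q Q.q a a' t = Q.q (T i * a) a' t"
    using Q.q_mult[OF T A_1 A_1 gen] gen by simp
  have "sQ i \<otimes>\<^sub>Q Q.q a a' t = Q.q a a' (T i * t) \<oplus>\<^sub>Q Q.q (T i * a) a' t"
    using Q.Q.l_distr[OF em_closed[OF T] br_closed[OF T] Q.q_closed[OF gen]] 1 2 by simp
  hence "lam J (sQ i \<otimes>\<^sub>Q Q.q a a' t) =
      (multi_deriv n J (T i * (a * a')) + T i * multi_deriv n J (a * a')) * t"
    using gen T by (simp add: lam_add lam_q A_mult algebra_simps)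
  also have "\<dots> = (if i \<in> J then lam (J - {i}) (Q.q a a' t) else 0)"
    using i gen multi_deriv_commutator[OF char2, of i n J "a * a'"] by (simp add: lam_q)
  finally show ?case .
next
  case (diff x y)
  thus ?case using sQ_closed[OF i] Q_minus_distr[of "sQ i" x y] by (simp add: lam_diff)
qed

section \<open>Square-free products and the span of the augmentation ideal\<close>

definition sprod :: "nat set \<Rightarrow> 'k ratfun Q" where
  "sprod J = (\<Otimes>\<^bsub>Q.Q\<^esub>i\<in>J. sQ i)"

lemma sprod_closed: "J \<subseteq> {1..n} \<Longrightarrow> sprod J \<in> carrier Q.Q"
  unfolding sprod_def using sQ_closed by (intro Q.Q.finprod_closed) auto

lemma sprod_insert:
  assumes "insert i J \<subseteq> {1..n}" "i \<notin> J"
  shows "sprod (insert i J) = sQ i \<otimes>\<^sub>Q sprod J"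
  unfolding sprod_def using assms sQ_closed finite_subset[of J "{1..n}"]
  by (intro Q.Q.finprod_insert) auto

lemma sprod_empty: "sprod {} = \<one>\<^bsub>Q.Q\<^esub>"
  by (simp add: sprod_def)

text \<open>Each factor \<open>s_i\<close> either removes \<open>i\<close> from \<open>J'\<close> or
  gives 0. When the product is used up, the remaining derivative of 1 is nonzero only if nothing of
  \<open>J'\<close> is left. As \<open>J'\<close> shrinks along the way, the induction keeps it
  arbitrary.\<close>

lemma lam_sprod:
  assumes "finite J" "J \<subseteq> {1..n}" "J' \<subseteq> {1..n}"
  shows "lam J' (sprod J) = (if J' = J then 1 else 0)"
  using assms
proof (induction J arbitrary: J' rule: finite_induct)
  case empty
  have "J' \<inter> {1..n} = J'" using empty by auto
  thus ?case using A_1 lam_q[of 1 1 1 J'] by (simp add: sprod_empty Q.q_one multi_deriv_1)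
next
  case (insert i J)
  have "i \<in> {1..n}" "J \<subseteq> {1..n}" "J' - {i} \<subseteq> {1..n}" using insert.prems by auto
  have "lam J' (sprod (insert i J)) = (if i \<in> J' then lam (J' - {i}) (sprod J) else 0)"
    unfolding sprod_insert[OF insert.prems(1) insert.hyps(2)]
    by (rule lam_sQ[OF \<open>i \<in> {1..n}\<close> sprod_closed[OF \<open>J \<subseteq> {1..n}\<close>]])
  hence "lam J' (sprod (insert i J)) = (if i \<in> J' then if J' - {i} = J then 1 else 0 else 0)"
    using insert.IH[OF \<open>J \<subseteq> {1..n}\<close> \<open>J' - {i} \<subseteq> {1..n}\<close>] by simp
  moreover have "J' = insert i J \<longleftrightarrow> i \<in> J' \<and> J' - {i} = J" using insert.hyps by auto
  ultimately show ?case by auto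
qed

lemma sQ_I: "i \<in> {1..n} \<Longrightarrow> sQ i \<in> I"
  unfolding I_iff using sQ_closed eps_sQ by blast

lemma sprod_I:
  assumes "J \<subseteq> {1..n}" "J \<noteq> {}"
  shows "sprod J \<in> I"
proof -
  obtain i where i: "i \<in> J" using assms by auto
  have "sprod J = sQ i \<otimes>\<^sub>Q sprod (J - {i})"
    using sprod_insert[of i "J - {i}"] i assms(1) by (simp add: insert_absorb)
  moreover have "i \<in> {1..n}" "J - {i} \<subseteq> {1..n}" using i assms by auto
  hence "sprod (J - {i}) \<otimes>\<^sub>Q sQ i \<in> I" "sQ i \<in> carrier Q.Q" "sprod (J - {i}) \<in> carrier Q.Q"
    by (blast intro: I_closed(3) sQ_I sprod_closed sQ_closed)+
  ultimately show ?thesis using Q.Q.m_comm by metis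
qed

text \<open>The empty set is left out because its product is 1, which has augmentation 1. The span
  \<open>N\<close> of the remaining products turns out to be all of \<open>W\<close>.\<close>

abbreviation idx where "idx \<equiv> Pow {1..n} - {{}}"
abbreviation N where "N \<equiv> LinearCombinations.module.span A W (sprod ` idx)"

lemma W_module: "module A W"
  using W_vectorspace by (simp add: vectorspace_def)

lemma N_closed:
  "sprod ` idx \<subseteq> N" "\<zero>\<^bsub>Q.Q\<^esub> \<in> N" "x \<in> N \<Longrightarrow> y \<in> N \<Longrightarrow> x \<oplus>\<^sub>Q y \<in> N"
  "a \<in> carrier A \<Longrightarrow> x \<in> N \<Longrightarrow> Q.em a \<otimes>\<^sub>Q x \<in> N" "N \<subseteq> I"
proof -
  have "sprod ` idx \<subseteq> carrier W" using sprod_I by auto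
  note s = module.span_closure[OF W_module this, unfolded W_simps]
  show "sprod ` idx \<subseteq> N" "\<zero>\<^bsub>Q.Q\<^esub> \<in> N" "N \<subseteq> I" by (rule s)+
  show "x \<in> N \<Longrightarrow> y \<in> N \<Longrightarrow> x \<oplus>\<^sub>Q y \<in> N" by (rule s)
  show "a \<in> carrier A \<Longrightarrow> x \<in> N \<Longrightarrow> Q.em a \<otimes>\<^sub>Q x \<in> N" by (rule s)
qed

lemma N_Q: "x \<in> N \<Longrightarrow> x \<in> carrier Q.Q"
  using N_closed(5) I_iff by blast

text \<open>Multiplying \<open>s_J\<close> by \<open>s_i\<close> gives the product over
  \<open>insert i J\<close> if \<open>i\<close> is new, and 0 otherwise because \<open>s_i\<close>
  has square zero.\<close>

lemma N_sQ:
  assumes i: "i \<in> {1..n}" and x: "x \<in> N"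
  shows "sQ i \<otimes>\<^sub>Q x \<in> N"
proof -
  interpret M: module A W by (rule W_module)
  note s = sQ_closed[OF i]
  have sp: "sQ i \<otimes>\<^sub>Q sprod J \<in> N" if J: "J \<in> idx" for J
  proof (cases "i \<in> J")
    case True
    have J': "J - {i} \<subseteq> {1..n}" using J by auto
    have "sprod J = sQ i \<otimes>\<^sub>Q sprod (J - {i})"
      using sprod_insert[of i "J - {i}"] J True by (auto simp: insert_absorb)
    hence "sQ i \<otimes>\<^sub>Q sprod J = (sQ i \<otimes>\<^sub>Q sQ i) \<otimes>\<^sub>Q sprod (J - {i})"
      using s sprod_closed[OF J'] by (simp add: Q.Q.m_assoc)
    thus ?thesis using N_closed(2) sQ_square[OF i] sprod_closed[OF J'] by simp
  next
    case False
    have "insert i J \<subseteq> {1..n}" using i J by blast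
    hence "sprod (insert i J) = sQ i \<otimes>\<^sub>Q sprod J" using False by (rule sprod_insert)
    moreover have "insert i J \<in> idx" using i J by blast
    hence "sprod (insert i J) \<in> N" by (rule subsetD[OF N_closed(1) imageI])
    ultimately show ?thesis by (simp only:)
  qed
  \<comment> \<open>The elements of \<open>N\<close> that \<open>s_i\<close> multiplies into
    \<open>N\<close> form a submodule containing the spanning products, hence are all of
    \<open>N\<close>.\<close>
  have "N \<subseteq> {y \<in> N. sQ i \<otimes>\<^sub>Q y \<in> N}"
  proof (rule M.span_is_subset)
    show "sprod ` idx \<subseteq> {y \<in> N. sQ i \<otimes>\<^sub>Q y \<in> N}" using sp N_closed(1) by blast
    show "LinearCombinations.submodule A {y \<in> N. sQ i \<otimes>\<^sub>Q y \<in> N} W"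
    proof (intro LinearCombinations.submodule.intro W_module)
      fix a y assume a: "a \<in> carrier A" and y: "y \<in> {y \<in> N. sQ i \<otimes>\<^sub>Q y \<in> N}"
      hence y': "y \<in> N" "sQ i \<otimes>\<^sub>Q y \<in> N" by blast+
      show "a \<odot>\<^bsub>W\<^esub> y \<in> {y \<in> N. sQ i \<otimes>\<^sub>Q y \<in> N}"
        unfolding W_simps mem_Collect_eq Q.Q.m_lcomm[OF s em_closed[OF a] N_Q[OF y'(1)]]
        by (intro conjI N_closed(4) a y')
    next
      show "{y \<in> N. sQ i \<otimes>\<^sub>Q y \<in> N} \<subseteq> carrier W" unfolding W_simps using N_closed(5) by blast
      show "\<zero>\<^bsub>W\<^esub> \<in> {y \<in> N. sQ i \<otimes>\<^sub>Q y \<in> N}"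
        unfolding W_simps mem_Collect_eq Q.Q.r_null[OF s] by (intro conjI N_closed(2))
      fix y z assume "y \<in> {y \<in> N. sQ i \<otimes>\<^sub>Q y \<in> N}" "z \<in> {y \<in> N. sQ i \<otimes>\<^sub>Q y \<in> N}"
      hence yz: "y \<in> N" "z \<in> N" "sQ i \<otimes>\<^sub>Q y \<in> N" "sQ i \<otimes>\<^sub>Q z \<in> N" by blast+
      show "y \<oplus>\<^bsub>W\<^esub> z \<in> {y \<in> N. sQ i \<otimes>\<^sub>Q y \<in> N}"
        unfolding W_simps mem_Collect_eq Q.Q.r_distr[OF N_Q[OF yz(1)] N_Q[OF yz(2)] s]
        by (intro conjI N_closed(3) yz)
    qed
  qed
  thus ?thesis using x by blast
qed

text \<open>\<open>Q = A + N\<close>: the right-hand side contains 1 and is stable under \<open>A\<close> and all \<open>a \<otimes> 1 \<otimes> 1\<close>.\<close>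

definition U where "U = {x \<in> carrier Q.Q. \<exists>a\<in>carrier A. \<exists>y\<in>N. x = Q.em a \<oplus>\<^sub>Q y}"

lemma U_add: "x \<in> U \<Longrightarrow> x' \<in> U \<Longrightarrow> x \<oplus>\<^sub>Q x' \<in> U"
proof -
  assume "x \<in> U" "x' \<in> U"
  then obtain a a' y y' where *: "a \<in> carrier A" "a' \<in> carrier A" "y \<in> N" "y' \<in> N"
    "x = Q.em a \<oplus>\<^sub>Q y" "x' = Q.em a' \<oplus>\<^sub>Q y'" unfolding U_def by blast
  have cl: "Q.em a \<in> carrier Q.Q" "Q.em a' \<in> carrier Q.Q" "y \<in> carrier Q.Q" "y' \<in> carrier Q.Q"
    using * em_closed N_Q by auto
  have "x \<oplus>\<^sub>Q x' = Q.em (a \<oplus>\<^bsub>A\<^esub> a') \<oplus>\<^sub>Q (y \<oplus>\<^sub>Q y')"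
    unfolding * ring_hom_add[OF Q.em_hom *(1,2)] using cl by (simp add: Q.Q.a_ac)
  moreover have "a \<oplus>\<^bsub>A\<^esub> a' \<in> carrier A" using * by (simp add: A_add)
  moreover have "x \<oplus>\<^sub>Q x' \<in> carrier Q.Q" unfolding * using cl by simp
  ultimately show ?thesis unfolding U_def using N_closed(3) *(3,4) by blast
qed

lemma U_em: "c \<in> carrier A \<Longrightarrow> x \<in> U \<Longrightarrow> Q.em c \<otimes>\<^sub>Q x \<in> U"
proof -
  assume c: "c \<in> carrier A" and "x \<in> U"
  then obtain a y where *: "a \<in> carrier A" "y \<in> N" "x = Q.em a \<oplus>\<^sub>Q y" unfolding U_def by blast
  have cl: "Q.em a \<in> carrier Q.Q" "Q.em c \<in> carrier Q.Q" "y \<in> carrier Q.Q"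
    using * c em_closed N_Q by auto
  have "Q.em c \<otimes>\<^sub>Q x = Q.em (c \<otimes>\<^bsub>A\<^esub> a) \<oplus>\<^sub>Q Q.em c \<otimes>\<^sub>Q y"
    unfolding * ring_hom_mult[OF Q.em_hom c *(1)] using cl by (simp add: Q.Q.r_distr)
  moreover have "c \<otimes>\<^bsub>A\<^esub> a \<in> carrier A" using * c by (simp add: A_mult)
  moreover have "Q.em c \<otimes>\<^sub>Q x \<in> carrier Q.Q" unfolding * using cl by simp
  ultimately show ?thesis unfolding U_def using N_closed(4)[OF c *(2)] by blast
qed

lemma N_U: "y \<in> N \<Longrightarrow> y \<in> U"
proof -
  assume y: "y \<in> N"
  have "Q.em 0 = \<zero>\<^bsub>Q.Q\<^esub>" using ring_hom_zero[OF Q.em_hom Q.A.ring_axioms Q.Q.ring_axioms] by simp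
  hence "y = Q.em 0 \<oplus>\<^sub>Q y" using N_Q[OF y] by simp
  thus ?thesis unfolding U_def using y N_Q[OF y] A_0 by blast
qed

text \<open>Multiplication by \<open>s_i\<close> moves the summand from \<open>A\<close> into
  \<open>N\<close> as well, since \<open>s_i\<close> is itself the product over
  \<open>{i}\<close>.\<close>

lemma U_sQ:
  assumes i: "i \<in> {1..n}" and x: "x \<in> U"
  shows "sQ i \<otimes>\<^sub>Q x \<in> U"
proof -
  obtain a y where *: "a \<in> carrier A" "y \<in> N" "x = Q.em a \<oplus>\<^sub>Q y" using x unfolding U_def by blast
  have cl: "Q.em a \<in> carrier Q.Q" "y \<in> carrier Q.Q" "sQ i \<in> carrier Q.Q"
    using * i em_closed N_Q sQ_closed by auto
  have "sprod {i} = sQ i" using sprod_insert[of i "{}"] i cl(3) by (simp add: sprod_empty)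
  moreover have "{i} \<in> idx" using i by blast
  hence "sprod {i} \<in> N" by (rule subsetD[OF N_closed(1) imageI])
  ultimately have "sQ i \<in> N" by (simp only:)
  hence "Q.em a \<otimes>\<^sub>Q sQ i \<oplus>\<^sub>Q sQ i \<otimes>\<^sub>Q y \<in> N"
    using N_closed(3,4) N_sQ[OF i *(2)] *(1) by blast
  moreover have "sQ i \<otimes>\<^sub>Q x = Q.em a \<otimes>\<^sub>Q sQ i \<oplus>\<^sub>Q sQ i \<otimes>\<^sub>Q y"
    unfolding * using cl Q.Q.m_comm[OF cl(3,1)] Q.Q.r_distr[OF cl(1,2,3)] by metis
  ultimately show ?thesis using N_U by simp
qed

text \<open>The quantifier over \<open>x\<close> stays inside the induction so that the case of a
  product can apply one hypothesis to the output of the other.\<close>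

lemma U_br:
  assumes a: "a \<in> carrier A"
  shows "\<forall>x\<in>U. Q.br a \<otimes>\<^sub>Q x \<in> U"
  using a
proof (induction a rule: ratfun_induct)
  case (const c)
  have "Q.br (\<iota> c) = Q.em (\<iota> c)" by (rule Q.br_const) simp
  thus ?case using U_em[OF iota_closed] by metis
next
  case (var i)
  show ?case
  proof
    fix x assume x: "x \<in> U"
    have cl: "Q.em (T i) \<in> carrier Q.Q" "Q.br (T i) \<in> carrier Q.Q" "x \<in> carrier Q.Q"
      using x em_closed br_closed T_closed[OF var] by (auto simp: U_def)
    \<comment> \<open>In characteristic 2 the defining equation of \<open>s_i\<close> can be solved
      for \<open>br (T i)\<close>, and \<open>U\<close> is stable under both summands.\<close>
    have "Q.em (T i) \<oplus>\<^sub>Q sQ i = Q.br (T i)"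
      using cl(1,2) Q.Q_double[OF cl(1)] Q.Q.a_assoc[OF cl(1,1,2)] Q.Q.l_zero[OF cl(2)] by metis
    hence "Q.br (T i) \<otimes>\<^sub>Q x = Q.em (T i) \<otimes>\<^sub>Q x \<oplus>\<^sub>Q sQ i \<otimes>\<^sub>Q x"
      using Q.Q.l_distr[OF cl(1) sQ_closed[OF var] cl(3)] by metis
    thus "Q.br (T i) \<otimes>\<^sub>Q x \<in> U"
      using U_add[OF U_em[OF T_closed[OF var] x] U_sQ[OF var x]] by metis
  qed
next
  case (add a b)
  show ?case
  proof
    fix x assume x: "x \<in> U"
    hence "x \<in> carrier Q.Q" by (simp add: U_def)
    hence "Q.br (a + b) \<otimes>\<^sub>Q x = Q.br a \<otimes>\<^sub>Q x \<oplus>\<^sub>Q Q.br b \<otimes>\<^sub>Q x"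
      using ring_hom_add[OF Q.br_hom add(1,2)] Q.Q.l_distr[OF br_closed[OF add(1)] br_closed[OF add(2)]]
      unfolding ratfun_simps by metis
    thus "Q.br (a + b) \<otimes>\<^sub>Q x \<in> U" using U_add add.IH x by metis
  qed
next
  case (mult a b)
  show ?case
  proof
    fix x assume x: "x \<in> U"
    hence "x \<in> carrier Q.Q" by (simp add: U_def)
    hence "Q.br (a * b) \<otimes>\<^sub>Q x = Q.br a \<otimes>\<^sub>Q (Q.br b \<otimes>\<^sub>Q x)"
      using ring_hom_mult[OF Q.br_hom mult(1,2)] Q.Q.m_assoc[OF br_closed[OF mult(1)] br_closed[OF mult(2)]]
      unfolding ratfun_simps by metis
    thus "Q.br (a * b) \<otimes>\<^sub>Q x \<in> U" using mult.IH x by metis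
  qed
next
  case (inverse a)
  let ?c = "inverse a * inverse a"
  have c: "inverse a \<in> carrier A" "?c \<in> carrier A"
    using ratfun_closed2(4)[of a n] A_mult inverse by auto
  \<comment> \<open>The factor \<open>?c\<close> is a square, so \<open>br ?c\<close> equals
    \<open>em ?c\<close>, under which \<open>U\<close> is already stable; only multiplication by
    \<open>br a\<close> remains.\<close>
  have "inverse a = a * ?c" using inverse(2) by (simp add: mult.assoc[symmetric])
  hence "Q.br (inverse a) = Q.br (a * ?c)" by metis
  also have "\<dots> = Q.br a \<otimes>\<^sub>Q Q.br ?c"
    using ring_hom_mult[OF Q.br_hom inverse(1) c(2)] by simp
  also have "Q.br ?c = Q.em ?c"
    using ring_hom_mult[OF Q.br_hom c(1) c(1)] Q.br_sq[OF c(1)] by simp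
  finally have eq: "Q.br (inverse a) = Q.br a \<otimes>\<^sub>Q Q.em ?c" .
  show ?case
  proof
    fix x assume x: "x \<in> U"
    hence "x \<in> carrier Q.Q" by (simp add: U_def)
    hence "Q.br (inverse a) \<otimes>\<^sub>Q x = Q.br a \<otimes>\<^sub>Q (Q.em ?c \<otimes>\<^sub>Q x)"
      unfolding eq using Q.Q.m_assoc[OF br_closed[OF inverse(1)] em_closed[OF c(2)]] by metis
    thus "Q.br (inverse a) \<otimes>\<^sub>Q x \<in> U" using inverse.IH U_em[OF c(2) x] by metis
  qed
qed

lemma Q_eq_U: "x \<in> carrier Q.Q \<Longrightarrow> x \<in> U"
proof (induction x rule: Q.Q_induct)
  case zero thus ?case using N_U N_closed(2) by blast
next
  case (gen a a' t)
  have em: "Q.em t \<in> U" unfolding U_def using gen(3) em_closed[OF gen(3)] N_closed(2) by (auto intro!: bexI[of _ t] bexI[of _ "\<zero>\<^bsub>Q.Q\<^esub>"])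
  have "Q.q a a' t = Q.br (a \<otimes>\<^bsub>A\<^esub> a') \<otimes>\<^sub>Q Q.em t" by (rule Q.q_eq_br[OF gen])
  moreover have "a \<otimes>\<^bsub>A\<^esub> a' \<in> carrier A" using gen by (simp add: A_mult)
  ultimately show ?case using U_br em by metis
next
  case (diff x y)
  thus ?case using U_add[of x y] Q.Q_minus[of y] by (simp add: a_minus_def)
qed

lemma W_dim: "vectorspace.fin_dim A W \<and> vectorspace.dim A W = 2 ^ n - 1"
proof -
  have "vectorspace.fin_dim A W \<and> vectorspace.dim A W = card idx"
  proof (rule vectorspace_dim_dual_family[OF W_vectorspace, where v = sprod and \<mu> = lam])
    show "finite idx" by simp
    show "sprod J \<in> carrier W" if "J \<in> idx" for J using that sprod_I by simp
    show "carrier W \<subseteq> N"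
    proof
      fix x assume "x \<in> carrier W"
      hence x: "x \<in> carrier Q.Q" "eps x = 0" by (simp_all add: I_iff)
      obtain a y where *: "a \<in> carrier A" "y \<in> N" "x = Q.em a \<oplus>\<^sub>Q y"
        using Q_eq_U[OF x(1)] unfolding U_def by blast
      have y: "y \<in> carrier Q.Q" "eps y = 0" using *(2) N_closed(5) I_iff by blast+
      \<comment> \<open>Elements of \<open>N\<close> have augmentation 0, so the augmentation of
        \<open>x\<close> is its component \<open>a\<close>.\<close>
      have "a = 0" using x(2) eps_simps(2)[OF em_closed[OF *(1)] y(1)] eps_em[OF *(1)] y(2) *(3) by simp
      moreover have "Q.em 0 = \<zero>\<^bsub>Q.Q\<^esub>" using ring_hom_zero[OF Q.em_hom Q.A.ring_axioms Q.Q.ring_axioms] by simp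
      ultimately show "x \<in> N" using * y(1) by simp
    qed
    fix J assume J: "J \<in> idx"
    show "abelian_group_hom W A (lam J)"
      by (rule abelian_group_homI')
        (use W_module lam_closed lam_add Q.A.abelian_group_axioms in \<open>auto simp: module_def I_iff\<close>)
    show "lam J (a \<odot>\<^bsub>W\<^esub> x) = a \<otimes>\<^bsub>A\<^esub> lam J x" if "a \<in> carrier A" "x \<in> carrier W" for a x
      using that lam_em by (simp add: I_iff)
    show "lam J (sprod J') = (if J = J' then \<one>\<^bsub>A\<^esub> else \<zero>\<^bsub>A\<^esub>)" if "J' \<in> idx" for J'
      using that J finite_subset[of J' "{1..n}"] lam_sprod[of J' J] by auto
  qed
  thus ?thesis by (simp add: card_Diff_singleton card_Pow)
qed

section \<open>The map to differentials\<close>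

interpretation k: kaehler_setting K \<iota> A
  by (intro kaehler_setting.intro kaehler_setting_axioms.intro ratfun_cring iota_closed)
interpretation O: module A k.\<Omega> by (rule k.kaehler_module)

abbreviation Omega_add (infixl "\<oplus>\<^sub>\<Omega>" 65) where "x \<oplus>\<^sub>\<Omega> y \<equiv> x \<oplus>\<^bsub>k.\<Omega>\<^esub> y"
abbreviation Omega_smult (infixl "\<odot>\<^sub>\<Omega>" 70) where "a \<odot>\<^sub>\<Omega> w \<equiv> a \<odot>\<^bsub>k.\<Omega>\<^esub> w"
abbreviation \<kappa> where "\<kappa> \<equiv> Q_to_kaehler K \<iota> A"

lemma Omega_double: "w \<in> carrier k.\<Omega> \<Longrightarrow> w \<oplus>\<^sub>\<Omega> w = \<zero>\<^bsub>k.\<Omega>\<^esub>"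
  using O.smult_l_distr[OF Q.A.one_closed Q.A.one_closed, of w] Q.two O.smult_one[of w] O.smult_l_null[of w]
  by metis

lemma Omega_minus: "w \<in> carrier k.\<Omega> \<Longrightarrow> \<ominus>\<^bsub>k.\<Omega>\<^esub> w = w"
  using Omega_double[of w] by (simp add: O.minus_equality)

lemma d_square: "c \<in> carrier A \<Longrightarrow> k.d (c \<otimes>\<^bsub>A\<^esub> c) = \<zero>\<^bsub>k.\<Omega>\<^esub>"
  unfolding k.d_mult by (rule Omega_double) simp

text \<open>Squares and constants have differential 0, so the Leibniz rule makes \<open>d\<close>
  linear over them.\<close>

lemma kappa_shiftable: "Q.shiftable k.\<Omega> (\<lambda>b t. t \<odot>\<^sub>\<Omega> k.d b)"
proof -
  have move: "t \<odot>\<^sub>\<Omega> k.d (c \<otimes>\<^bsub>A\<^esub> b) = (c \<otimes>\<^bsub>A\<^esub> t) \<odot>\<^sub>\<Omega> k.d b"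
    if "c \<in> carrier A" "b \<in> carrier A" "t \<in> carrier A" "k.d c = \<zero>\<^bsub>k.\<Omega>\<^esub>" for b c t
    using that by (simp add: k.d_mult O.smult_assoc1[symmetric] Q.A.m_comm del: ratfun_simps)
  show ?thesis
    unfolding Q.shiftable_def
    using move d_square k.d_const iota_closed
    by (auto simp: k.d_add O.smult_r_distr O.smult_l_distr simp del: ratfun_simps)
qed

text \<open>In characteristic 2 the minus sign is a plus sign, and the antisymmetric expression in
  the definition becomes the Leibniz expansion of \<open>d(a a')\<close>.\<close>

lemma kappa_inner:
  assumes "a \<in> carrier A" "a' \<in> carrier A"
  shows "(a' \<odot>\<^sub>\<Omega> k.d a) \<ominus>\<^bsub>k.\<Omega>\<^esub> (a \<odot>\<^sub>\<Omega> k.d a') = k.d (a \<otimes>\<^bsub>A\<^esub> a')"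
  using assms by (simp add: a_minus_def Omega_minus k.d_mult O.a_comm del: ratfun_simps)

lemma kappa_lift:
  "abelian_group_hom Q.Q k.\<Omega> \<kappa>"
  "a \<in> carrier A \<Longrightarrow> a' \<in> carrier A \<Longrightarrow> t \<in> carrier A \<Longrightarrow> \<kappa> (Q.q a a' t) = t \<odot>\<^sub>\<Omega> k.d (a \<otimes>\<^bsub>A\<^esub> a')"
proof -
  let ?\<beta> = "\<lambda>a a'. (a' \<odot>\<^sub>\<Omega> k.d a) \<ominus>\<^bsub>k.\<Omega>\<^esub> (a \<odot>\<^sub>\<Omega> k.d a')"
  have TA: "tensor_product K \<iota> A \<iota> A" by (rule Q.TA_tensor)
  interpret TA: tensor_product K \<iota> A \<iota> A by (rule TA)
  interpret l: tensor_lifting K \<iota> A \<iota> A k.\<Omega>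
    by (intro tensor_lifting.intro TA O.abelian_group_axioms)
  have bal: "balanced K \<iota> A \<iota> A k.\<Omega> ?\<beta>"
    by (rule TA.balancedI)
      (simp_all add: kappa_inner iota_closed del: ratfun_simps,
        simp_all add: iota_closed Q.A.l_distr Q.A.r_distr Q.A.m_lcomm Q.A.m_assoc k.d_add del: ratfun_simps)
  have mh: "Q.m \<in> ring_hom TA.T A" by (rule Q.mult_map_hom)
  have dm: "abelian_group_hom TA.T k.\<Omega> (\<lambda>x. k.d (Q.m x))"
  proof (rule abelian_group_homI')
    show "abelian_group TA.T" using TA.T_cring by (simp add: cring_def ring_def)
    show "abelian_group k.\<Omega>" by (rule O.abelian_group_axioms)
  qed (use ring_hom_closed[OF mh] ring_hom_add[OF mh] in \<open>simp_all add: k.d_add del: ratfun_simps\<close>)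
  \<comment> \<open>Two additive maps that agree on pure tensors are equal. This brings the nested
    lift into the form \<open>F (m x) t\<close> to which \<open>Q_lift\<close> applies.\<close>
  have inner: "tensor_lift k.\<Omega> ?\<beta> x = k.d (Q.m x)" if "x \<in> carrier TA.T" for x
    by (rule l.hom_eqI[OF l.lift_hom[OF bal] dm that])
      (simp add: l.lift_tensor[OF bal] kappa_inner Q.mult_map_tensor del: ratfun_simps)
  have eq: "\<kappa> = tensor_lift k.\<Omega> (\<lambda>x t. t \<odot>\<^sub>\<Omega> tensor_lift k.\<Omega> ?\<beta> x)"
    by (simp add: Q_to_kaehler_def Let_def)
  note lift = Q.Q_lift[OF O.abelian_group_axioms kappa_shiftable, of "\<lambda>x t. t \<odot>\<^sub>\<Omega> tensor_lift k.\<Omega> ?\<beta> x"]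
  show "abelian_group_hom Q.Q k.\<Omega> \<kappa>" unfolding eq by (rule lift(1)) (simp add: inner)
  show "a \<in> carrier A \<Longrightarrow> a' \<in> carrier A \<Longrightarrow> t \<in> carrier A \<Longrightarrow> \<kappa> (Q.q a a' t) = t \<odot>\<^sub>\<Omega> k.d (a \<otimes>\<^bsub>A\<^esub> a')"
    unfolding eq by (rule lift(2)) (simp_all add: inner)
qed

text \<open>Both sides are additive in \<open>x\<close> and in \<open>y\<close>. On generators the
  formula is the Leibniz rule for the product of \<open>a a'\<close> and \<open>b b'\<close>, scaled
  by \<open>t s\<close>.\<close>

lemma kappa_mult:
  assumes x: "x \<in> carrier Q.Q" and y: "y \<in> carrier Q.Q"
  shows "\<kappa> (x \<otimes>\<^sub>Q y) = eps x \<odot>\<^sub>\<Omega> \<kappa> y \<oplus>\<^sub>\<Omega> eps y \<odot>\<^sub>\<Omega> \<kappa> x"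
proof -
  interpret e: abelian_group_hom Q.Q A eps by (rule eps_hom)
  interpret c: abelian_group_hom Q.Q k.\<Omega> \<kappa> by (rule kappa_lift(1))
  have scaled: "(t \<otimes>\<^bsub>A\<^esub> s) \<odot>\<^sub>\<Omega> k.d (a \<otimes>\<^bsub>A\<^esub> b) =
      (a \<otimes>\<^bsub>A\<^esub> t) \<odot>\<^sub>\<Omega> (s \<odot>\<^sub>\<Omega> k.d b) \<oplus>\<^sub>\<Omega> (b \<otimes>\<^bsub>A\<^esub> s) \<odot>\<^sub>\<Omega> (t \<odot>\<^sub>\<Omega> k.d a)"
    if "a \<in> carrier A" "b \<in> carrier A" "t \<in> carrier A" "s \<in> carrier A" for a b t s
    using that
    by (simp add: k.d_mult O.smult_r_distr O.smult_assoc1[symmetric] Q.A.m_ac del: ratfun_simps)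
  show ?thesis using x
  proof (induction x rule: Q.Q_induct)
    case zero
    thus ?case using y by (simp del: ratfun_simps)
  next
    case (gen a a' t)
    note g = gen
    show ?case using y
    proof (induction y rule: Q.Q_induct)
      case zero
      thus ?case using gen by (simp del: ratfun_simps)
    next
      case (gen b b' s)
      let ?a = "a \<otimes>\<^bsub>A\<^esub> a'" and ?b = "b \<otimes>\<^bsub>A\<^esub> b'"
      have ab: "?a \<in> carrier A" "?b \<in> carrier A" using g gen by (simp_all add: A_mult)
      have swap: "(a \<otimes>\<^bsub>A\<^esub> b) \<otimes>\<^bsub>A\<^esub> (a' \<otimes>\<^bsub>A\<^esub> b') = ?a \<otimes>\<^bsub>A\<^esub> ?b"
        using g gen by (simp add: Q.A.m_ac del: ratfun_simps)
      have eps': "eps (Q.q a a' t) = ?a \<otimes>\<^bsub>A\<^esub> t" "eps (Q.q b b' s) = ?b \<otimes>\<^bsub>A\<^esub> s"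
        using g gen eps_q by simp_all
      have "\<kappa> (Q.q a a' t \<otimes>\<^sub>Q Q.q b b' s) = (t \<otimes>\<^bsub>A\<^esub> s) \<odot>\<^sub>\<Omega> k.d (?a \<otimes>\<^bsub>A\<^esub> ?b)"
        using g gen kappa_lift(2)[of "a \<otimes>\<^bsub>A\<^esub> b" "a' \<otimes>\<^bsub>A\<^esub> b'" "t \<otimes>\<^bsub>A\<^esub> s"]
        by (simp add: Q.q_mult swap del: ratfun_simps)
      also have "\<dots> = (?a \<otimes>\<^bsub>A\<^esub> t) \<odot>\<^sub>\<Omega> (s \<odot>\<^sub>\<Omega> k.d ?b) \<oplus>\<^sub>\<Omega> (?b \<otimes>\<^bsub>A\<^esub> s) \<odot>\<^sub>\<Omega> (t \<odot>\<^sub>\<Omega> k.d ?a)"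
        by (rule scaled) (use g gen ab in simp_all)
      finally show ?case using g gen kappa_lift(2) eps' by simp
    next
      case (diff y z)
      have cl: "eps y \<in> carrier A" "eps z \<in> carrier A" using diff eps_simps(3) by blast+
      show ?case
        using diff g cl Q_minus_distr[of "Q.q a a' t" y z]
        by (simp add: abelian_group_hom_minus[OF kappa_lift(1)] abelian_group_hom_minus[OF eps_hom]
            a_minus_def O.smult_r_distr O.smult_l_distr O.smult_r_minus O.smult_l_minus O.minus_add O.a_ac
            del: ratfun_simps)
    qed
  next
    case (diff x z)
    have cl: "eps x \<in> carrier A" "eps z \<in> carrier A" "eps y \<in> carrier A" using diff y eps_simps(3) by blast+
    have "(x \<ominus>\<^bsub>Q.Q\<^esub> z) \<otimes>\<^sub>Q y = x \<otimes>\<^sub>Q y \<ominus>\<^bsub>Q.Q\<^esub> z \<otimes>\<^sub>Q y"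
      using diff y by (simp add: a_minus_def Q.Q.l_distr Q.Q.l_minus)
    thus ?case
      using diff y cl
      by (simp add: abelian_group_hom_minus[OF kappa_lift(1)] abelian_group_hom_minus[OF eps_hom]
          a_minus_def O.smult_r_distr O.smult_l_distr O.smult_r_minus O.smult_l_minus O.minus_add O.a_ac
          del: ratfun_simps)
  qed
qed

lemma kappa_I_mult: "x \<in> I \<Longrightarrow> y \<in> I \<Longrightarrow> \<kappa> (x \<otimes>\<^sub>Q y) = \<zero>\<^bsub>k.\<Omega>\<^esub>"
  using kappa_mult[of x y] abelian_group_hom.hom_closed[OF kappa_lift(1)] O.smult_l_null
  by (simp add: I_iff)

text \<open>A generator of the square of the ideal is a product of two elements with augmentation 0,
  so both terms of the Leibniz formula vanish. Membership in the carrier is kept for additivity in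
  the sum case.\<close>

lemma kappa_ideal_prod: "x \<in> ideal_prod QA I I \<Longrightarrow> x \<in> carrier Q.Q \<and> \<kappa> x = \<zero>\<^bsub>k.\<Omega>\<^esub>"
proof (induction x rule: ideal_prod.induct)
  case (prod x y)
  thus ?case using kappa_I_mult by (simp add: I_iff)
next
  case (sum x y)
  thus ?case using abelian_group_hom.hom_add[OF kappa_lift(1), of x y] by simp
qed

lemma Q_cring: "cring Q.Q" by (rule Q.Q.is_cring)

lemma kappa_not_inj:
  assumes "n \<ge> 2"
  shows "\<not> inj_on \<kappa> (carrier W)"
proof
  assume inj: "inj_on \<kappa> (carrier W)"
  have sub: "{1, 2} \<subseteq> {1..n}" "{2} \<subseteq> {1..n}" using assms by auto
  have s: "sQ 1 \<in> I" "sQ 2 \<in> I" using sub by (auto intro!: sQ_I simp del: One_nat_def ratfun_simps)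
  have "sprod {1, 2} = sQ 1 \<otimes>\<^sub>Q sprod {2}" using sprod_insert[of 1 "{2}"] sub by simp
  also have "sprod {2} = sQ 2" using sprod_insert[of 2 "{}"] sub s by (simp add: sprod_empty I_iff)
  finally have eq: "sprod {1, 2} = sQ 1 \<otimes>\<^sub>Q sQ 2" .
  have "\<kappa> (sprod {1, 2}) = \<kappa> \<zero>\<^bsub>Q.Q\<^esub>"
    using kappa_I_mult[OF s] abelian_group_hom.hom_zero[OF kappa_lift(1)] eq by simp
  moreover have "sprod {1, 2} \<in> carrier W" "\<zero>\<^bsub>Q.Q\<^esub> \<in> carrier W"
    using sprod_I[OF sub(1)] I_closed(1) by simp_all
  ultimately have "sprod {1, 2} = \<zero>\<^bsub>Q.Q\<^esub>" using inj by (auto dest: inj_onD)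
  \<comment> \<open>The functional for \<open>{1, 2}\<close> takes the value 1 on
    \<open>s_1 s_2\<close>, which is therefore nonzero.\<close>
  thus False using lam_sprod[of "{1, 2}" "{1, 2}"] sub lam_0[of "{1, 2}"] by simp
qed

end

text \<open>That a map is determined by its values on generators is rendered as existence in
  \<open>Phis\<close> or \<open>Psis\<close> together with agreement of all members on the carrier.
  Agreement replaces equality because a HOL function is unconstrained outside the carrier.
  Membership in \<open>alg_hom\<close> fixes the values on constants, which the displayed formulas
  leave implicit.\<close>

theorem proposition4p3:
  fixes n :: nat
  assumes "CHAR('k::field) = 2" and "n \<ge> 1"
  shows
    "let K = (ring_of_type_algebra :: 'k ring);
         \<iota> = (ratfun_const :: 'k \<Rightarrow> 'k ratfun);
         A = (ratfun_field n :: 'k ratfun ring);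
         T = (ratfun_var :: nat \<Rightarrow> 'k ratfun);
         \<Lambda> = (Lambda_ring n :: 'k mpoly set ring);
         S = (Lambda_var n :: nat \<Rightarrow> 'k mpoly set);
         Q = Q_alg K \<iota> A;
         q = Q_tensor K \<iota> A;
         B = tensor_ring K \<iota> A (Lambda_const n) \<Lambda>;
         b = tensor K \<iota> A (Lambda_const n) \<Lambda>;
         I = aug_ideal K \<iota> A;
         W = W_mod K \<iota> A;
         \<Omega> = kaehler K \<iota> A;
         \<kappa> = Q_to_kaehler K \<iota> A;
         Phis = {\<Phi> \<in> alg_hom K (\<lambda>k. q \<one>\<^bsub>A\<^esub> \<one>\<^bsub>A\<^esub> (\<iota> k)) Q (\<lambda>k. b (\<iota> k) \<one>\<^bsub>\<Lambda>\<^esub>) B.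
           \<forall>i\<in>{1..n}.
             \<Phi> (q (T i) \<one>\<^bsub>A\<^esub> \<one>\<^bsub>A\<^esub>) = b (T i) \<one>\<^bsub>\<Lambda>\<^esub> \<oplus>\<^bsub>B\<^esub> b \<one>\<^bsub>A\<^esub> (S i) \<and>
             \<Phi> (q \<one>\<^bsub>A\<^esub> (T i) \<one>\<^bsub>A\<^esub>) = b (T i) \<one>\<^bsub>\<Lambda>\<^esub> \<oplus>\<^bsub>B\<^esub> b \<one>\<^bsub>A\<^esub> (S i) \<and>
             \<Phi> (q \<one>\<^bsub>A\<^esub> \<one>\<^bsub>A\<^esub> (T i)) = b (T i) \<one>\<^bsub>\<Lambda>\<^esub>};
         Psis = {\<Psi> \<in> alg_hom K (\<lambda>k. b (\<iota> k) \<one>\<^bsub>\<Lambda>\<^esub>) B (\<lambda>k. q \<one>\<^bsub>A\<^esub> \<one>\<^bsub>A\<^esub> (\<iota> k)) Q.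
           \<forall>i\<in>{1..n}.
             \<Psi> (b (T i) \<one>\<^bsub>\<Lambda>\<^esub>) = q \<one>\<^bsub>A\<^esub> \<one>\<^bsub>A\<^esub> (T i) \<and>
             \<Psi> (b \<one>\<^bsub>A\<^esub> (S i)) = q \<one>\<^bsub>A\<^esub> \<one>\<^bsub>A\<^esub> (T i) \<oplus>\<^bsub>Q\<^esub> q (T i) \<one>\<^bsub>A\<^esub> \<one>\<^bsub>A\<^esub>}
     in (\<exists>\<Phi>\<in>Phis. \<exists>\<Psi>\<in>Psis.
           (\<forall>\<Phi>'\<in>Phis. \<forall>x\<in>carrier Q. \<Phi>' x = \<Phi> x) \<and>
           (\<forall>\<Psi>'\<in>Psis. \<forall>y\<in>carrier B. \<Psi>' y = \<Psi> y) \<and>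
           (\<forall>x\<in>carrier Q. \<Psi> (\<Phi> x) = x) \<and>
           (\<forall>y\<in>carrier B. \<Phi> (\<Psi> y) = y)) \<and>
        (vectorspace A W \<and> vectorspace.fin_dim A W \<and> vectorspace.dim A W = 2 ^ n - 1) \<and>
        (vectorspace A \<Omega> \<and> vectorspace.fin_dim A \<Omega> \<and> vectorspace.dim A \<Omega> = n) \<and>
        (n \<ge> 2 \<longrightarrow> \<not> inj_on \<kappa> (carrier W)) \<and>
        (\<forall>x\<in>ideal_prod Q I I. \<kappa> x = \<zero>\<^bsub>\<Omega>\<^esub>)"
proof -
  interpret R: ratfun_char2 n "TYPE('k)" by unfold_locales (rule assms(1))
  let ?Q = "Q_ring R.K R.\<iota> R.A" and ?B = "tensor_ring R.K R.\<iota> R.A R.Lc R.\<Lambda>"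
  let ?q = "Q_tensor R.K R.\<iota> R.A" and ?b = "tensor R.K R.\<iota> R.A R.Lc R.\<Lambda>"
  let ?em = "?q \<one>\<^bsub>R.A\<^esub> \<one>\<^bsub>R.A\<^esub>" and ?bA = "\<lambda>a. ?b a \<one>\<^bsub>R.\<Lambda>\<^esub>"
  let ?Phis = "{\<Phi> \<in> alg_hom R.K (\<lambda>k. ?em (R.\<iota> k)) R.QA (\<lambda>k. ?bA (R.\<iota> k)) ?B.
    \<forall>i\<in>{1..n}.
      \<Phi> (?q (R.T i) \<one>\<^bsub>R.A\<^esub> \<one>\<^bsub>R.A\<^esub>) = ?bA (R.T i) \<oplus>\<^bsub>?B\<^esub> ?b \<one>\<^bsub>R.A\<^esub> (R.S i) \<and>
      \<Phi> (?q \<one>\<^bsub>R.A\<^esub> (R.T i) \<one>\<^bsub>R.A\<^esub>) = ?bA (R.T i) \<oplus>\<^bsub>?B\<^esub> ?b \<one>\<^bsub>R.A\<^esub> (R.S i) \<and>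
      \<Phi> (?em (R.T i)) = ?bA (R.T i)}"
  let ?Psis = "{\<Psi> \<in> alg_hom R.K (\<lambda>k. ?bA (R.\<iota> k)) ?B (\<lambda>k. ?em (R.\<iota> k)) R.QA.
    \<forall>i\<in>{1..n}.
      \<Psi> (?bA (R.T i)) = ?em (R.T i) \<and>
      \<Psi> (?b \<one>\<^bsub>R.A\<^esub> (R.S i)) = ?em (R.T i) \<oplus>\<^bsub>R.QA\<^esub> ?q (R.T i) \<one>\<^bsub>R.A\<^esub> \<one>\<^bsub>R.A\<^esub>}"
  have B_cring: "cring ?B" by (rule tensor_product.T_cring[OF R.B_tensor])
  have "\<exists>\<Phi>\<in>?Phis. \<exists>\<Psi>\<in>?Psis.
      (\<forall>\<Phi>'\<in>?Phis. \<forall>x\<in>carrier R.QA. \<Phi>' x = \<Phi> x) \<and>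
      (\<forall>\<Psi>'\<in>?Psis. \<forall>y\<in>carrier ?B. \<Psi>' y = \<Psi> y) \<and>
      (\<forall>x\<in>carrier R.QA. \<Psi> (\<Phi> x) = x) \<and> (\<forall>y\<in>carrier ?B. \<Phi> (\<Psi> y) = y)" (is ?iso)
  proof (rule R.Phi_Psi)
    fix \<Phi> \<Psi>
    assume hom: "\<Phi> \<in> ring_hom ?Q ?B" "\<Psi> \<in> ring_hom ?B ?Q"
      and c: "\<And>c. \<Phi> (?em (R.\<iota> c)) = ?bA (R.\<iota> c)" "\<And>c. \<Psi> (?bA (R.\<iota> c)) = ?em (R.\<iota> c)"
      and v: "\<And>i. i \<in> {1..n} \<Longrightarrow> \<Phi> (?q (R.T i) \<one>\<^bsub>R.A\<^esub> \<one>\<^bsub>R.A\<^esub>) = ?bA (R.T i) \<oplus>\<^bsub>?B\<^esub> ?b \<one>\<^bsub>R.A\<^esub> (R.S i)"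
        "\<And>i. i \<in> {1..n} \<Longrightarrow> \<Phi> (?q \<one>\<^bsub>R.A\<^esub> (R.T i) \<one>\<^bsub>R.A\<^esub>) = ?bA (R.T i) \<oplus>\<^bsub>?B\<^esub> ?b \<one>\<^bsub>R.A\<^esub> (R.S i)"
        "\<And>i. i \<in> {1..n} \<Longrightarrow> \<Phi> (?em (R.T i)) = ?bA (R.T i)"
        "\<And>i. i \<in> {1..n} \<Longrightarrow> \<Psi> (?bA (R.T i)) = ?em (R.T i)"
        "\<And>i. i \<in> {1..n} \<Longrightarrow> \<Psi> (?b \<one>\<^bsub>R.A\<^esub> (R.S i)) =
          ?em (R.T i) \<oplus>\<^bsub>?Q\<^esub> ?q (R.T i) \<one>\<^bsub>R.A\<^esub> \<one>\<^bsub>R.A\<^esub>"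
      and inv: "\<And>x. x \<in> carrier ?Q \<Longrightarrow> \<Psi> (\<Phi> x) = x" "\<And>y. y \<in> carrier ?B \<Longrightarrow> \<Phi> (\<Psi> y) = y"
    have Phi: "\<Phi> \<in> ?Phis"
      unfolding alg_hom_def mem_Collect_eq R.ring_hom_Q_alg by (intro conjI ballI hom c v)
    have Psi: "\<Psi> \<in> ?Psis"
      unfolding alg_hom_def mem_Collect_eq R.ring_hom_Q_alg R.Q_alg_simps by (intro conjI ballI hom c v)
    \<comment> \<open>Any member of \<open>?Phis\<close> has the prescribed values on constants and
      on both kinds of variables, and these determine a homomorphism out of
      \<open>Q\<close>.\<close>
    have uQ: "\<Phi>' x = \<Phi> x" if \<Phi>': "\<Phi>' \<in> ?Phis" and x: "x \<in> carrier R.QA" for \<Phi>' x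
    proof (rule R.Q_hom_eqI[OF B_cring _ hom(1)])
      show "\<Phi>' \<in> ring_hom ?Q ?B" using \<Phi>' unfolding alg_hom_def mem_Collect_eq R.ring_hom_Q_alg by blast
      show "\<Phi>' (?em (R.\<iota> k)) = \<Phi> (?em (R.\<iota> k))" for k
        using \<Phi>' unfolding alg_hom_def mem_Collect_eq ring_of_type_simps c by blast
      show "\<Phi>' (?q (R.T i) \<one>\<^bsub>R.A\<^esub> \<one>\<^bsub>R.A\<^esub>) = \<Phi> (?q (R.T i) \<one>\<^bsub>R.A\<^esub> \<one>\<^bsub>R.A\<^esub>)"
        "\<Phi>' (?em (R.T i)) = \<Phi> (?em (R.T i))" if i: "i \<in> {1..n}" for i
        using \<Phi>' i unfolding mem_Collect_eq v(1,3)[OF i] by blast+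
      show "x \<in> carrier ?Q" using x unfolding R.Q_alg_simps .
    qed
    have uB: "\<Psi>' y = \<Psi> y" if \<Psi>': "\<Psi>' \<in> ?Psis" and y: "y \<in> carrier ?B" for \<Psi>' y
    proof (rule R.B_hom_eqI[OF R.Q_cring _ hom(2)])
      show "\<Psi>' \<in> ring_hom ?B ?Q" using \<Psi>' unfolding alg_hom_def mem_Collect_eq R.ring_hom_Q_alg by blast
      show "\<Psi>' (?bA (R.\<iota> k)) = \<Psi> (?bA (R.\<iota> k))" for k
        using \<Psi>' unfolding alg_hom_def mem_Collect_eq ring_of_type_simps c by blast
      show "\<Psi>' (?bA (R.T i)) = \<Psi> (?bA (R.T i))"
        "\<Psi>' (?b \<one>\<^bsub>R.A\<^esub> (R.S i)) = \<Psi> (?b \<one>\<^bsub>R.A\<^esub> (R.S i))" if i: "i \<in> {1..n}" for i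
        using \<Psi>' i unfolding mem_Collect_eq R.Q_alg_simps v(4,5)[OF i] by blast+
      show "y \<in> carrier ?B" by (rule y)
    qed
    show ?iso
    proof (rule bexI[OF _ Phi], rule bexI[OF _ Psi], intro conjI ballI)
      show "\<Phi>' x = \<Phi> x" if "\<Phi>' \<in> ?Phis" "x \<in> carrier R.QA" for \<Phi>' x by (rule uQ[OF that])
      show "\<Psi>' y = \<Psi> y" if "\<Psi>' \<in> ?Psis" "y \<in> carrier ?B" for \<Psi>' y by (rule uB[OF that])
      show "\<Psi> (\<Phi> x) = x" if "x \<in> carrier R.QA" for x
        by (rule inv(1)) (rule that[unfolded R.Q_alg_simps])
      show "\<Phi> (\<Psi> y) = y" if "y \<in> carrier ?B" for y by (rule inv(2)[OF that])
    qed
  qed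
  note iso = this
  note W = R.W_dim and \<Omega> = kaehler_ratfun_dim[where 'k = 'k, of n]
  show ?thesis
    unfolding Let_def
  proof (intro conjI)
    show ?iso by (rule iso)
    show "vectorspace R.A R.W" by (rule R.W_vectorspace)
    show "vectorspace.fin_dim R.A R.W" by (rule conjunct1[OF W])
    show "vectorspace.dim R.A R.W = 2 ^ n - 1" by (rule conjunct2[OF W])
    show "vectorspace R.A (kaehler R.K R.\<iota> R.A)" by (rule conjunct1[OF \<Omega>])
    show "vectorspace.fin_dim R.A (kaehler R.K R.\<iota> R.A)" by (rule conjunct1[OF conjunct2[OF \<Omega>]])
    show "vectorspace.dim R.A (kaehler R.K R.\<iota> R.A) = n" by (rule conjunct2[OF conjunct2[OF \<Omega>]])
    show "n \<ge> 2 \<longrightarrow> \<not> inj_on R.\<kappa> (carrier R.W)" by (intro impI R.kappa_not_inj)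
    show "\<forall>x\<in>ideal_prod R.QA R.I R.I. R.\<kappa> x = \<zero>\<^bsub>kaehler R.K R.\<iota> R.A\<^esub>"
      by (intro ballI conjunct2[OF R.kappa_ideal_prod])
  qed
qed

end
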